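(* Let $\vec P=(p_1,\dots,p_m)$ with $1<p_1,\dots,p_m<\infty$, let $\frac1p=\frac1{p_1}+\cdots+\frac1{p_m}$, let $\vec w=(w_1,\dots,w_m)$ be an $m$-tuple of weights on $\mathbf R^n$, and let $\nu_{\vec w}=\prod_{j=1}^m w_j^{p/p_j}$. Then the multilinear strong maximal function $\mathcal M_{\mathcal R}$ is bounded $$\mathcal M_{\mathcal R}:\ L^{p_1}(w_1)\times\cdots\times L^{p_m}(w_m)\to L^{p,\infty}(\nu_{\vec w})$$ if and only if $\vec w\in A_{\vec P,\mathcal R}$.
   Context: $\mathcal R$ is the family of all open rectangles in $\mathbf R^n$ with sides parallel to the coordinate axes. For a vector $\vec f=(f_1,\dots,f_m)$ of locally integrable functions on $\mathbf R^n$, $$\mathcal M_{\mathcal R}(\vec f\,)(x)=\sup_{R\ni x,\ R\in\mathcal R}\ \prod_{i=1}^m\Big(\frac1{|R|}\int_R|f_i(y)|\,dy\Big),\qquad x\in\mathbf R^n.$$ A weight (associated with $\mathcal R$) is a non-negative measurable function $w$ on $\mathbf R^n$ with $\int_R w\,dx<\infty$ for every $R\in\mathcal R$. Boundedness means that $\sup_{\lambda>0}\lambda\,\nu_{\vec w}(\{x\in\mathbf R^n:\mathcal M_{\mathcal R}(\vec f\,)(x)>\lambda\})^{1/p}\le C\prod_{i=1}^m\big(\int_{\mathbf R^n}|f_i|^{p_i}w_i\,dx\big)^{1/p_i}$ with a constant $C$ independent of $\vec f$, where $\nu_{\vec w}(E)=\int_E\nu_{\vec w}\,dx$. The condition $\vec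 w\in A_{\vec P,\mathcal R}$ means $$\sup_{R\in\mathcal R}\Big(\frac1{|R|}\int_R\nu_{\vec w}(x)\,dx\Big)\prod_{j=1}^m\Big(\frac1{|R|}\int_R w_j(x)^{1-p_j'}\,dx\Big)^{p/p_j'}<\infty,$$ where $1/p_j+1/p_j'=1$. *)

theory Defs
  imports "HOL-Analysis.Analysis"
begin

text \<open>
  The dimension is \<open>CARD('n)\<close> and the number of functions is \<open>CARD('m)\<close>; tuples are functions on
  the finite type \<open>'m\<close>. Measurability and integration are with respect to \<^term>\<open>lebesgue\<close>.
  Quantities that may be infinite live in \<^typ>\<open>ennreal\<close>, where \<open>0 * \<infinity> = 0\<close>.
\<close>

text \<open>
  Real powers on \<open>[0, \<infinity>]\<close>. Unlike \<^term>\<open>(powr)\<close> on the reals, a negative power of \<open>0\<close> is \<open>\<infinity>\<close>;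
  this matters for \<open>w\<^sub>j powr (1 - p\<^sub>j')\<close> where the weight \<open>w\<^sub>j\<close> vanishes.
\<close>

definition enn_powr :: "ennreal \<Rightarrow> real \<Rightarrow> ennreal" (infixr "powr\<^sub>e" 80) where
  "x powr\<^sub>e a =
    (if a = 0 then 1
     else if x = 0 then (if a > 0 then 0 else \<infinity>)
     else if x = \<infinity> then (if a > 0 then \<infinity> else 0)
     else ennreal (enn2real x powr a))"

lemma enn_powr_ennreal: "x > 0 \<Longrightarrow> ennreal x powr\<^sub>e a = ennreal (x powr a)"
  by (simp add: enn_powr_def)

definition rectangles :: "(real ^ 'n) set set" where
  "rectangles = {box a b | a b. \<forall>i. a $ i < b $ i}"

definition rect_average :: "(real ^ 'n) set \<Rightarrow> (real ^ 'n \<Rightarrow> ennreal) \<Rightarrow> ennreal" where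
  "rect_average R g = (\<integral>\<^sup>+ x\<in>R. g x \<partial>lebesgue) / emeasure lebesgue R"

definition strong_maximal :: "('m::finite \<Rightarrow> real ^ 'n \<Rightarrow> real) \<Rightarrow> real ^ 'n \<Rightarrow> ennreal" where
  "strong_maximal f x =
    (SUP R \<in> {R \<in> rectangles. x \<in> R}. \<Prod>i\<in>UNIV. rect_average R (\<lambda>y. ennreal \<bar>f i y\<bar>))"

definition locally_integrable :: "(real ^ 'n \<Rightarrow> real) \<Rightarrow> bool" where
  "locally_integrable g \<longleftrightarrow>
    g \<in> borel_measurable lebesgue \<and> (\<forall>K. compact K \<longrightarrow> set_integrable lebesgue K g)"

definition weight :: "(real ^ 'n \<Rightarrow> real) \<Rightarrow> bool" where
  "weight w \<longleftrightarrow>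
    w \<in> borel_measurable lebesgue \<and> (\<forall>x. 0 \<le> w x) \<and>
    (\<forall>R\<in>rectangles. (\<integral>\<^sup>+ x\<in>R. ennreal (w x) \<partial>lebesgue) < \<infinity>)"

definition joint_weight ::
  "('m::finite \<Rightarrow> real) \<Rightarrow> real \<Rightarrow> ('m \<Rightarrow> real ^ 'n \<Rightarrow> real) \<Rightarrow> real ^ 'n \<Rightarrow> real" where
  "joint_weight P p w x = (\<Prod>j\<in>UNIV. w j x powr (p / P j))"

definition conj_exponent :: "real \<Rightarrow> real" where
  "conj_exponent q = q / (q - 1)"

lemma conj_exponent: "q > 1 \<Longrightarrow> 1 / q + 1 / conj_exponent q = 1"
  by (simp add: conj_exponent_def field_simps)

definition A_class ::
  "('m::finite \<Rightarrow> real) \<Rightarrow> real \<Rightarrow> ('m \<Rightarrow> real ^ 'n \<Rightarrow> real) \<Rightarrow> bool" where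
  "A_class P p w \<longleftrightarrow>
    (SUP R \<in> rectangles.
       rect_average R (\<lambda>x. ennreal (joint_weight P p w x)) *
       (\<Prod>j\<in>UNIV. rect_average R (\<lambda>x. ennreal (w j x) powr\<^sub>e (1 - conj_exponent (P j)))
                    powr\<^sub>e (p / conj_exponent (P j)))) < \<infinity>"

text \<open>\<open>\<integral>\<bar>g\<bar>\<^sup>q w\<close>, the \<open>q\<close>-th power of the norm of \<open>L\<^sup>q(w)\<close>.\<close>

definition weighted_integral ::
  "real \<Rightarrow> (real ^ 'n \<Rightarrow> real) \<Rightarrow> (real ^ 'n \<Rightarrow> real) \<Rightarrow> ennreal" where
  "weighted_integral q w g = (\<integral>\<^sup>+ x. ennreal (\<bar>g x\<bar> powr q * w x) \<partial>lebesgue)"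

definition weak_quasinorm ::
  "real \<Rightarrow> (real ^ 'n \<Rightarrow> real) \<Rightarrow> (real ^ 'n \<Rightarrow> ennreal) \<Rightarrow> ennreal" where
  "weak_quasinorm p v g =
    (SUP t \<in> {0<..}. ennreal t *
       (\<integral>\<^sup>+ x\<in>{x. g x > ennreal t}. ennreal (v x) \<partial>lebesgue) powr\<^sub>e (1 / p))"

text \<open>
  Boundedness of the strong maximal function from
  \<open>L\<^bsup>p\<^sub>1\<^esup>(w\<^sub>1) \<times> \<dots> \<times> L\<^bsup>p\<^sub>m\<^esup>(w\<^sub>m)\<close> to weak \<open>L\<^sup>p(\<nu>\<^sub>w)\<close>. Restricting to \<open>f\<^sub>i \<in> L\<^bsup>p\<^sub>i\<^esup>(w\<^sub>i)\<close> avoids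
  assigning a value to a product of norms of the form \<open>0 \<sqdot> \<infinity>\<close>.
\<close>

definition strong_maximal_weak_bounded ::
  "('m::finite \<Rightarrow> real) \<Rightarrow> real \<Rightarrow> ('m \<Rightarrow> real ^ 'n \<Rightarrow> real) \<Rightarrow> bool" where
  "strong_maximal_weak_bounded P p w \<longleftrightarrow>
    (\<exists>C::real. 0 \<le> C \<and>
      (\<forall>f. (\<forall>i. locally_integrable (f i) \<and> weighted_integral (P i) (w i) (f i) < \<infinity>) \<longrightarrow>
        weak_quasinorm p (joint_weight P p w) (strong_maximal f)
          \<le> ennreal C * (\<Prod>i\<in>UNIV. weighted_integral (P i) (w i) (f i) powr\<^sub>e (1 / P i))))"

end

theory Submission
  imports Defs "HOL-Real_Asymp.Real_Asymp"
begin

text \<open>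
  Put \<open>\<sigma>\<^sub>j = w\<^sub>j powr (1 - p\<^sub>j')\<close>. Hoelder's inequality for
  \<open>1 = \<nu> powr (1/(pm)) * \<Prod>j. \<sigma>\<^sub>j powr (1/(p\<^sub>j' m))\<close> and the \<open>A\<^sub>P\<close> condition show that \<open>\<nu>\<close> and all \<open>\<sigma>\<^sub>j\<close>
  are doubling: a subset of a rectangle \<open>R\<close> of at least half its volume carries a fixed
  proportion of the mass of \<open>R\<close>. No other property of the weights is needed for maximal estimates.

  Finitely many rectangles cut space into the cells of a finite grid, which turns these estimates
  into statements about finite sums. On a grid, the strong maximal function weighted by a doubling \<open>\<mu>\<close>
  is bounded on \<open>L\<^sup>k(\<mu>)\<close>, \<open>k > 1\<close>, by induction on the number of directions. For a new
  direction, a Cordoba-Fefferman selection among the rectangles with average at least \<open>s\<close> produces a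
  set \<open>U\<close> with \<open>s \<mu>(U) \<le> C \<integral>\<^sub>U M' h d\<mu>\<close>, where \<open>M'\<close> is the maximal function in the old directions,
  and all these rectangles lie where \<open>M'\<close> of a slight enlargement of \<open>U\<close> is not small. Doob's argument
  then gives the bound.

  For the weak type estimate, pick greedily from the rectangles with \<open>\<Prod>i. \<langle>f\<^sub>i\<rangle>\<^sub>R > t\<close> those which are
  at least half outside the previous ones. The \<open>A\<^sub>P\<close> condition bounds \<open>\<nu>(R)\<close> by
  \<open>A t powr (-p) * \<Prod>i. (\<sigma>\<^sub>i(R) (\<integral>\<^sub>R f\<^sub>i / \<sigma>\<^sub>i(R)) powr p\<^sub>i) powr (p/p\<^sub>i)\<close>, and the sum over the
  selected rectangles is controlled by the weighted arithmetic-geometric mean inequality and the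
  maximal functions for the \<open>\<sigma>\<^sub>i\<close>.

  Conversely, \<open>A\<^sub>P\<close> follows by testing on \<open>f\<^sub>i = 1\<^sub>R (w\<^sub>i + 1/N) powr (1 - p\<^sub>i')\<close> and letting \<open>N \<rightarrow> \<infinity>\<close>.
\<close>

subsection \<open>Inequalities for finite sums\<close>

text \<open>Jensen's inequality for \<open>exp\<close> at the points \<open>ln (x i)\<close>. A
  vanishing \<open>x i\<close> is split off, since there \<open>exp (ln (x i))\<close> is not
  \<open>x i\<close>; it makes the left side zero.\<close>

lemma weighted_arith_geo_mean:
  fixes x t :: "'a \<Rightarrow> real"
  assumes "finite I" and t: "\<And>i. i \<in> I \<Longrightarrow> 0 < t i" and t1: "sum t I = 1"
    and x: "\<And>i. i \<in> I \<Longrightarrow> 0 \<le> x i"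
  shows "(\<Prod>i\<in>I. x i powr t i) \<le> (\<Sum>i\<in>I. t i * x i)"
proof (cases "\<exists>i\<in>I. x i = 0")
  case True
  then have "(\<Prod>i\<in>I. x i powr t i) = 0"
    using \<open>finite I\<close> by (auto intro!: prod_zero)
  then show ?thesis
    using t x by (simp add: sum_nonneg less_imp_le)
next
  case False
  have "(\<Prod>i\<in>I. x i powr t i) = exp (\<Sum>i\<in>I. t i * ln (x i))"
    using False by (simp add: exp_sum \<open>finite I\<close> powr_def mult.commute)
  also have "\<dots> \<le> (\<Sum>i\<in>I. t i * exp (ln (x i)))"
    using convex_on_sum[OF \<open>finite I\<close> _ exp_convex t1, of "\<lambda>i. ln (x i)"] t t1
    by (force simp: less_imp_le)
  also have "\<dots> = (\<Sum>i\<in>I. t i * x i)"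
    using False x by (intro sum.cong) (auto simp: less_le)
  finally show ?thesis .
qed

lemma young_powr:
  fixes x y k :: real
  assumes "0 \<le> x" "0 \<le> y" "1 < k"
  shows "x * y powr (k - 1) \<le> x powr k / k + (1 - 1 / k) * y powr k"
proof (cases "x = 0 \<or> y = 0")
  case False
  moreover have "k * (1 - 1 / k) = k - 1"
    using assms by (simp add: field_simps)
  ultimately show ?thesis
    using Youngs_inequality_0[of "1/k" "1 - 1/k" "x powr k" "y powr k"] assms
    by (simp add: powr_powr)
qed (use assms in auto)

text \<open>
  Abel summation over the values of \<open>g\<close>; the derivatives of \<open>(1 - 1/k) x powr k\<close> and
  \<open>x powr (k - 1)\<close> differ by the factor \<open>x\<close>, up to which the tail hypothesis compares the sums.
  The lower bound \<open>b\<close> is there for the induction.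
\<close>
lemma layer_cake_le:
  fixes n f g :: "'a \<Rightarrow> real"
  assumes "finite A" "1 < k" "0 \<le> b"
    and n: "\<And>a. a \<in> A \<Longrightarrow> 0 \<le> n a" and gb: "\<And>a. a \<in> A \<Longrightarrow> b \<le> g a"
    and tail: "\<And>s. b < s \<Longrightarrow> s * (\<Sum>a | a \<in> A \<and> s \<le> g a. n a) \<le> (\<Sum>a | a \<in> A \<and> s \<le> g a. n a * f a)"
  shows "(\<Sum>a\<in>A. n a * ((1 - 1 / k) * (g a powr k - b powr k)))
    \<le> (\<Sum>a\<in>A. n a * f a * (g a powr (k - 1) - b powr (k - 1)))"
  using \<open>finite A\<close> assms(3-)
proof (induction "card A" arbitrary: A b rule: less_induct)
  case less
  define B where "B = {a \<in> A. g a > b}"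
  have restrict: "(\<Sum>a\<in>A. n a * ((1 - 1 / k) * (g a powr k - b powr k))) = (\<Sum>a\<in>B. n a * ((1 - 1 / k) * (g a powr k - b powr k)))"
    "(\<Sum>a\<in>A. n a * f a * (g a powr (k - 1) - b powr (k - 1))) = (\<Sum>a\<in>B. n a * f a * (g a powr (k - 1) - b powr (k - 1)))"
    using less.prems(1,4) unfolding B_def
    by (auto intro!: sum.mono_neutral_right simp: order_less_le)
  have "finite B" using less.prems(1) by (simp add: B_def)
  show ?case
  proof (cases "B = {}")
    case True
    then show ?thesis unfolding restrict by simp
  next
    case False
    \<comment> \<open>The layer between \<open>b\<close> and the least value \<open>s\<close> above
      it is peeled off: it involves all of \<open>B\<close> with constant height, and the part above
      \<open>s\<close> is the induction hypothesis for \<open>B'\<close> with lower bound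
      \<open>s\<close>.\<close>
    define s where "s = Min (g ` B)"
    have "s \<in> g ` B" unfolding s_def using False \<open>finite B\<close> by (intro Min_in) auto
    then obtain a0 where a0: "a0 \<in> B" "s = g a0" by blast
    have smin: "s \<le> g a" if "a \<in> B" for a
      unfolding s_def using that \<open>finite B\<close> by simp
    have "s > b" using a0 by (auto simp: B_def)
    define B' where "B' = {a \<in> B. g a > s}"
    have "card B' < card A"
      using less.prems(1) a0 by (intro psubset_card_mono) (auto simp: B'_def B_def)
    have tailB: "{a. a \<in> B \<and> r \<le> g a} = {a. a \<in> A \<and> r \<le> g a}" if "r > b" for r
      using that by (auto simp: B_def)
    have tailB': "{a. a \<in> B' \<and> r \<le> g a} = {a. a \<in> A \<and> r \<le> g a}" if "r > s" for r
      using that \<open>s > b\<close> by (auto simp: B_def B'_def)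
    have tB: "s * sum n B \<le> (\<Sum>a\<in>B. n a * f a)"
    proof -
      have "{a. a \<in> A \<and> s \<le> g a} = B" using smin \<open>s > b\<close> by (auto simp: B_def)
      then show ?thesis using less.prems(5)[OF \<open>s > b\<close>] by simp
    qed
    have IH: "(\<Sum>a\<in>B'. n a * ((1 - 1 / k) * (g a powr k - s powr k)))
        \<le> (\<Sum>a\<in>B'. n a * f a * (g a powr (k - 1) - s powr (k - 1)))"
    proof (rule less.hyps[OF \<open>card B' < card A\<close>])
      show "r * (\<Sum>a | a \<in> B' \<and> r \<le> g a. n a) \<le> (\<Sum>a | a \<in> B' \<and> r \<le> g a. n a * f a)" if "s < r" for r
        using less.prems(5)[of r] \<open>s > b\<close> that by (simp add: tailB')
    qed (use less.prems \<open>s > b\<close> in \<open>auto simp: B'_def B_def\<close>)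
    have IHB: "(\<Sum>a\<in>B. n a * ((1 - 1 / k) * (g a powr k - s powr k)))
        \<le> (\<Sum>a\<in>B. n a * f a * (g a powr (k - 1) - s powr (k - 1)))"
    proof -
      have "(\<Sum>a\<in>B. n a * ((1 - 1 / k) * (g a powr k - s powr k))) = (\<Sum>a\<in>B'. n a * ((1 - 1 / k) * (g a powr k - s powr k)))"
        "(\<Sum>a\<in>B. n a * f a * (g a powr (k - 1) - s powr (k - 1))) = (\<Sum>a\<in>B'. n a * f a * (g a powr (k - 1) - s powr (k - 1)))"
        using \<open>finite B\<close> smin unfolding B'_def
        by (auto intro!: sum.mono_neutral_right simp: order_less_le)
      then show ?thesis using IH by simp
    qed
    \<comment> \<open>Young's inequality for \<open>s * b powr (k - 1)\<close>; this is the estimate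
      for a single layer.\<close>
    have y: "(1 - 1/k) * (s powr k - b powr k) \<le> s * (s powr (k - 1) - b powr (k - 1))"
    proof -
      have "s * s powr (k - 1) = s powr k"
        using \<open>s > b\<close> less.prems(2) by (simp add: powr_mult_base)
      then show ?thesis
        using young_powr[of s b k] \<open>s > b\<close> less.prems(2) \<open>1 < k\<close> by (simp add: algebra_simps)
    qed
    have nB: "0 \<le> sum n B" using less.prems(3) by (auto simp: B_def intro: sum_nonneg)
    have mono: "b powr (k - 1) \<le> s powr (k - 1)"
      using \<open>s > b\<close> less.prems(2) \<open>1 < k\<close> by (intro powr_mono2) auto
    have "sum n B * ((1 - 1/k) * (s powr k - b powr k)) \<le> sum n B * (s * (s powr (k - 1) - b powr (k - 1)))"
      using y nB by (rule mult_left_mono)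
    also have "\<dots> = (s * sum n B) * (s powr (k - 1) - b powr (k - 1))" by simp
    also have "\<dots> \<le> (\<Sum>a\<in>B. n a * f a) * (s powr (k - 1) - b powr (k - 1))"
      using tB mono by (intro mult_right_mono) auto
    finally have *: "sum n B * ((1 - 1/k) * (s powr k - b powr k)) \<le> (\<Sum>a\<in>B. n a * f a) * (s powr (k - 1) - b powr (k - 1))" .
    have "(\<Sum>a\<in>B. n a * ((1 - 1 / k) * (g a powr k - b powr k)))
      = (\<Sum>a\<in>B. n a * ((1 - 1 / k) * (g a powr k - s powr k))) + sum n B * ((1 - 1/k) * (s powr k - b powr k))"
      unfolding sum_distrib_right sum.distrib[symmetric] by (intro sum.cong refl) (simp add: right_diff_distrib)
    also have "\<dots> \<le> (\<Sum>a\<in>B. n a * f a * (g a powr (k - 1) - s powr (k - 1))) + (\<Sum>a\<in>B. n a * f a) * (s powr (k - 1) - b powr (k - 1))"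
      using IHB * by simp
    also have "\<dots> = (\<Sum>a\<in>B. n a * f a * (g a powr (k - 1) - b powr (k - 1)))"
      unfolding sum_distrib_right sum.distrib[symmetric] by (intro sum.cong refl) (simp add: right_diff_distrib)
    finally show ?thesis unfolding restrict .
  qed
qed

text \<open>Abel summation with \<open>b = 0\<close> bounds the left side by
  \<open>c * k / (k - 1)\<close> times the sum of \<open>n a * f a * g a powr (k - 1)\<close>.
  Young's inequality splits the product, and the resulting \<open>1 - 1 / k\<close> part of the left
  side is absorbed, which is legitimate because all sums are finite.\<close>

lemma doob_inequality_sum:
  fixes n f g :: "'a \<Rightarrow> real"
  assumes "finite A" "1 < k" "0 \<le> c"
    and n: "\<And>a. a \<in> A \<Longrightarrow> 0 \<le> n a" and f: "\<And>a. a \<in> A \<Longrightarrow> 0 \<le> f a" and g: "\<And>a. a \<in> A \<Longrightarrow> 0 \<le> g a"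
    and tail: "\<And>s. 0 < s \<Longrightarrow> s * (\<Sum>a | a \<in> A \<and> s \<le> g a. n a) \<le> c * (\<Sum>a | a \<in> A \<and> s \<le> g a. n a * f a)"
  shows "(\<Sum>a\<in>A. n a * g a powr k) \<le> (c * k / (k - 1)) powr k * (\<Sum>a\<in>A. n a * f a powr k)"
proof -
  define d where "d = k / (k - 1)"
  have d: "0 < d" "(1 - 1/k) * d = 1" using \<open>1 < k\<close> by (auto simp: d_def field_simps)
  let ?S = "\<Sum>a\<in>A. n a * g a powr k"
  have "(1 - 1/k) * ?S = (\<Sum>a\<in>A. n a * ((1 - 1 / k) * (g a powr k - 0 powr k)))"
    using \<open>1 < k\<close> by (simp add: sum_distrib_left mult_ac)
  also have "\<dots> \<le> (\<Sum>a\<in>A. n a * (c * f a) * (g a powr (k - 1) - 0 powr (k - 1)))"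
    using tail by (intro layer_cake_le) (use assms in \<open>auto simp: sum_distrib_left mult_ac\<close>)
  finally have "d * ((1 - 1/k) * ?S) \<le> d * (\<Sum>a\<in>A. n a * (c * f a) * g a powr (k - 1))"
    using d \<open>1 < k\<close> by (intro mult_left_mono) auto
  moreover have "d * ((1 - 1/k) * ?S) = ?S"
  proof -
    have "d * ((1 - 1/k) * ?S) = ((1 - 1/k) * d) * ?S" by (simp only: mult_ac)
    then show ?thesis unfolding d(2) by simp
  qed
  ultimately have "?S \<le> (\<Sum>a\<in>A. n a * ((d * c * f a) * g a powr (k - 1)))"
    by (simp add: sum_distrib_left mult_ac)
  also have "\<dots> \<le> (\<Sum>a\<in>A. n a * ((d * c * f a) powr k / k + (1 - 1/k) * g a powr k))"
    using d assms by (intro sum_mono mult_left_mono young_powr) auto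
  also have "\<dots> = (\<Sum>a\<in>A. n a * (d * c * f a) powr k) / k + (1 - 1/k) * ?S"
    by (simp add: sum.distrib sum_distrib_left sum_divide_distrib distrib_left mult_ac)
  finally have "?S / k \<le> (\<Sum>a\<in>A. n a * (d * c * f a) powr k) / k"
    by (simp add: algebra_simps)
  then have "?S \<le> (\<Sum>a\<in>A. n a * (d * c * f a) powr k)"
    using \<open>1 < k\<close> by (simp add: divide_le_cancel)
  also have "\<dots> = (d * c) powr k * (\<Sum>a\<in>A. n a * f a powr k)"
    using d assms by (auto simp: sum_distrib_left powr_mult mult_ac intro!: sum.cong)
  finally show ?thesis by (simp add: d_def mult_ac)
qed

subsection \<open>Doubling weights and maximal functions on a grid\<close>

lemma sum_Un_le:
  fixes f :: "'a \<Rightarrow> real"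
  assumes "finite A" "finite B" "\<And>a. 0 \<le> f a"
  shows "sum f (A \<union> B) \<le> sum f A + sum f B"
  using sum_Un[of A B f] sum_nonneg[of "A \<inter> B" f] assms by simp

lemma sum_Union_le:
  fixes f :: "'a \<Rightarrow> real"
  assumes "finite \<F>" "\<And>A. A \<in> \<F> \<Longrightarrow> finite A" "\<And>a. 0 \<le> f a"
  shows "sum f (\<Union>\<F>) \<le> (\<Sum>A\<in>\<F>. sum f A)"
  using assms
proof (induction \<F> rule: finite_induct)
  case (insert A \<F>)
  then show ?case using sum_Un_le[of A "\<Union>\<F>" f] by fastforce
qed simp

definition grid :: "nat \<Rightarrow> ('n \<Rightarrow> nat) set" where
  "grid N = {a. \<forall>i. a i < N}"

definition grid_rect :: "('n \<Rightarrow> nat) \<Rightarrow> ('n \<Rightarrow> nat) \<Rightarrow> ('n \<Rightarrow> nat) set" where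
  "grid_rect l u = {a. \<forall>i. l i \<le> a i \<and> a i < u i}"

text \<open>The parameter \<open>K\<close> carries the induction on directions: from
  \<open>{}\<close>, which leaves only single cells, to \<open>UNIV\<close>, which gives every
  rectangle of the grid.\<close>

definition grid_rects :: "nat \<Rightarrow> 'n set \<Rightarrow> ('n \<Rightarrow> nat) set set" where
  "grid_rects N K = {grid_rect l u | l u. (\<forall>i. l i < u i \<and> u i \<le> N) \<and> (\<forall>i. i \<notin> K \<longrightarrow> u i = Suc (l i))}"

text \<open>One sequence of lengths serves all axes, because the geometric grid uses the same
  breakpoints in every direction.\<close>

definition cell_vol :: "(nat \<Rightarrow> real) \<Rightarrow> ('n::finite \<Rightarrow> nat) \<Rightarrow> real" where
  "cell_vol len a = (\<Prod>i\<in>UNIV. len (a i))"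

abbreviation grid_vol :: "(nat \<Rightarrow> real) \<Rightarrow> ('n::finite \<Rightarrow> nat) set \<Rightarrow> real" where
  "grid_vol len A \<equiv> sum (cell_vol len) A"

text \<open>The discrete form of \<open>rect_doubling\<close>. The set \<open>A\<close> is an
  arbitrary set of cells, because it will be the part of a rectangle inside or outside a union of
  others.\<close>

definition grid_doubling :: "real \<Rightarrow> (nat \<Rightarrow> real) \<Rightarrow> (('n::finite \<Rightarrow> nat) \<Rightarrow> real) \<Rightarrow> bool" where
  "grid_doubling C len \<mu> \<longleftrightarrow> (\<forall>j. 0 < len j) \<and> (\<forall>a. 0 < \<mu> a) \<and>
    (\<forall>l u A. (\<forall>i. l i < u i) \<longrightarrow> A \<subseteq> grid_rect l u \<longrightarrow>
       grid_vol len (grid_rect l u) \<le> 2 * grid_vol len A \<longrightarrow> sum \<mu> (grid_rect l u) \<le> C * sum \<mu> A)"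

definition grid_avg :: "(('n \<Rightarrow> nat) \<Rightarrow> real) \<Rightarrow> (('n \<Rightarrow> nat) \<Rightarrow> real) \<Rightarrow> ('n \<Rightarrow> nat) set \<Rightarrow> real" where
  "grid_avg \<mu> h R = (\<Sum>a\<in>R. \<mu> a * h a) / sum \<mu> R"

text \<open>For \<open>a\<close> in \<open>grid N\<close> the maximum is over a nonempty finite set,
  as \<open>{a}\<close> is admissible. Outside the grid it is a maximum over the empty set and
  carries no meaning, so the estimates concern cells of the grid only.\<close>

definition grid_maximal :: "nat \<Rightarrow> 'n set \<Rightarrow> (('n \<Rightarrow> nat) \<Rightarrow> real) \<Rightarrow> (('n \<Rightarrow> nat) \<Rightarrow> real) \<Rightarrow> ('n \<Rightarrow> nat) \<Rightarrow> real" where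
  "grid_maximal N K \<mu> h a = Max (grid_avg \<mu> h ` {R \<in> grid_rects N K. a \<in> R})"

lemma finite_grid_rect [simp]: "finite (grid_rect l (u :: 'n::finite \<Rightarrow> nat))"
proof -
  have "grid_rect l u = PiE UNIV (\<lambda>i. {l i..<u i})"
    by (auto simp: grid_rect_def PiE_def Pi_def extensional_def)
  then show ?thesis by (simp add: finite_PiE)
qed

lemma grid_eq: "grid N = grid_rect (\<lambda>_. 0) (\<lambda>_. N)"
  by (simp add: grid_def grid_rect_def)

lemma finite_grid [simp]: "finite (grid N :: ('n::finite \<Rightarrow> nat) set)"
  by (simp add: grid_eq)

lemma grid_rectsI:
  "(\<And>i. l i < u i) \<Longrightarrow> (\<And>i. u i \<le> N) \<Longrightarrow> (\<And>i. i \<notin> K \<Longrightarrow> u i = Suc (l i)) \<Longrightarrow> grid_rect l u \<in> grid_rects N K"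
  by (auto simp: grid_rects_def)

lemma grid_rects_subset: "R \<in> grid_rects N K \<Longrightarrow> R \<subseteq> grid N"
  by (fastforce simp: grid_rects_def grid_rect_def grid_def intro: less_le_trans)

lemma finite_grid_rects [simp]: "finite (grid_rects N (K :: 'n::finite set))"
  by (rule finite_subset[of _ "Pow (grid N)"]) (auto dest: grid_rects_subset)

lemma finite_in_grid_rects: "R \<in> grid_rects N (K :: 'n::finite set) \<Longrightarrow> finite R"
  by (meson finite_grid finite_subset grid_rects_subset)

lemma grid_rect_nonempty: "(\<And>i. l i < u i) \<Longrightarrow> l \<in> grid_rect l u"
  by (simp add: grid_rect_def)

lemma singleton_in_grid_rects:
  assumes "a \<in> grid N"
  shows "{a} \<in> grid_rects N K"
proof -
  have "{a} = grid_rect a (\<lambda>i. Suc (a i))"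
    unfolding grid_rect_def less_Suc_eq_le by (auto simp: fun_eq_iff eq_iff)
  moreover have "grid_rect a (\<lambda>i. Suc (a i)) \<in> grid_rects N K"
    using assms by (intro grid_rectsI) (auto simp: grid_def Suc_le_eq)
  ultimately show ?thesis by simp
qed

lemma cell_vol_pos: "(\<And>j. 0 < len j) \<Longrightarrow> 0 < cell_vol len a"
  unfolding cell_vol_def by (intro prod_pos) auto

lemma cell_vol_upd:
  "cell_vol len (a(i := j)) = len j * (\<Prod>k\<in>UNIV - {i}. len (a k))"
  unfolding cell_vol_def by (subst prod.remove[of _ i]) (auto intro!: prod.cong)

lemma grid_maximal_ge:
  assumes "R \<in> grid_rects N K" "a \<in> R"
  shows "grid_avg \<mu> h R \<le> grid_maximal N (K :: 'n::finite set) \<mu> h a"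
  unfolding grid_maximal_def using assms by (intro Max_ge) auto

lemma grid_maximal_attained:
  assumes "a \<in> grid N"
  obtains R where "R \<in> grid_rects N K" "a \<in> R" "grid_maximal N (K :: 'n::finite set) \<mu> h a = grid_avg \<mu> h R"
proof -
  have "grid_maximal N K \<mu> h a \<in> grid_avg \<mu> h ` {R \<in> grid_rects N K. a \<in> R}"
    unfolding grid_maximal_def using singleton_in_grid_rects[OF assms] by (intro Max_in) auto
  then show ?thesis using that by auto
qed

lemma grid_avg_nonneg:
  "(\<And>a. 0 \<le> \<mu> a) \<Longrightarrow> (\<And>a. 0 \<le> h a) \<Longrightarrow> 0 \<le> grid_avg \<mu> h R"
  unfolding grid_avg_def by (intro divide_nonneg_nonneg sum_nonneg) auto

lemma grid_maximal_nonneg: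
  assumes "\<And>a. 0 \<le> \<mu> a" "\<And>a. 0 \<le> h a" "a \<in> grid N"
  shows "0 \<le> grid_maximal N (K :: 'n::finite set) \<mu> h a"
  using grid_maximal_attained[OF assms(3), of K \<mu> h] grid_avg_nonneg[of \<mu> h] assms by metis

lemma grid_doublingD:
  assumes "grid_doubling C len \<mu>" "R \<in> grid_rects N K" "A \<subseteq> R" "grid_vol len R \<le> 2 * grid_vol len A"
  shows "sum \<mu> R \<le> C * sum \<mu> A"
  using assms unfolding grid_doubling_def grid_rects_def by blast

lemma grid_doubling_pos:
  assumes "grid_doubling C len \<mu>"
  shows "0 < \<mu> a" "0 < len j"
  using assms by (auto simp: grid_doubling_def)

section \<open>Segments in one direction and the sets that half fill them\<close>

definition segment :: "'n \<Rightarrow> ('n \<Rightarrow> nat) \<Rightarrow> nat \<Rightarrow> nat \<Rightarrow> ('n \<Rightarrow> nat) set" where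
  "segment i a \<alpha> \<beta> = (\<lambda>j. a(i := j)) ` {\<alpha>..<\<beta>}"

lemma in_segment: "b \<in> segment i a \<alpha> \<beta> \<longleftrightarrow> \<alpha> \<le> b i \<and> b i < \<beta> \<and> (\<forall>k. k \<noteq> i \<longrightarrow> b k = a k)"
  by (auto simp: segment_def image_iff fun_eq_iff)

lemma segment_eq_grid_rect: "segment i a \<alpha> \<beta> = grid_rect (a(i := \<alpha>)) ((\<lambda>k. Suc (a k))(i := \<beta>))"
proof (rule set_eqI)
  fix x
  have "x \<in> grid_rect (a(i := \<alpha>)) ((\<lambda>k. Suc (a k))(i := \<beta>)) \<longleftrightarrow>
      (\<forall>k. if k = i then \<alpha> \<le> x k \<and> x k < \<beta> else x k = a k)"
    unfolding grid_rect_def mem_Collect_eq by (rule iff_allI) auto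
  then show "x \<in> segment i a \<alpha> \<beta> \<longleftrightarrow> x \<in> grid_rect (a(i := \<alpha>)) ((\<lambda>k. Suc (a k))(i := \<beta>))"
    unfolding in_segment by metis
qed

lemma segment_in_grid_rects:
  "a \<in> grid N \<Longrightarrow> \<alpha> < \<beta> \<Longrightarrow> \<beta> \<le> N \<Longrightarrow> segment i a \<alpha> \<beta> \<in> grid_rects N {i}"
  unfolding segment_eq_grid_rect by (rule grid_rectsI) (auto simp: grid_def Suc_le_eq)

lemma finite_segment [simp]: "finite (segment i a \<alpha> \<beta>)"
  by (simp add: segment_def)

lemma vol_segment:
  "grid_vol len (segment i a \<alpha> \<beta>) = sum len {\<alpha>..<\<beta>} * (\<Prod>k\<in>UNIV - {i}. len (a k))"
proof -
  have "inj_on (\<lambda>j. a(i := j)) {\<alpha>..<\<beta>}"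
    by (auto simp: inj_on_def fun_eq_iff split: if_splits)
  then show ?thesis
    unfolding segment_def by (simp add: sum.reindex cell_vol_upd sum_distrib_right)
qed

lemma segment_cong: "b \<in> segment i a \<alpha> \<beta> \<Longrightarrow> segment i a \<alpha> \<beta> = segment i b \<alpha> \<beta>"
  by (auto simp: in_segment)

text \<open>For positive lengths the union of these segments is the set where the one-dimensional
  maximal function in direction \<open>i\<close>, taken with respect to volume, of the indicator of
  \<open>U\<close> is at least one half. It serves as a slight enlargement of
  \<open>U\<close>.\<close>

definition half_filled :: "nat \<Rightarrow> (nat \<Rightarrow> real) \<Rightarrow> 'n::finite \<Rightarrow> ('n \<Rightarrow> nat) set \<Rightarrow> ('n \<Rightarrow> nat) set set" where
  "half_filled N len i U = {Q. (\<exists>a \<alpha> \<beta>. a \<in> grid N \<and> \<alpha> < \<beta> \<and> \<beta> \<le> N \<and> Q = segment i a \<alpha> \<beta>) \<and>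
      grid_vol len Q \<le> 2 * grid_vol len (Q \<inter> U)}"

lemma half_filled_subset: "half_filled N len i U \<subseteq> grid_rects N {i}"
  by (auto simp: half_filled_def segment_in_grid_rects)

lemma half_filled_subset_grid: "\<Union>(half_filled N len i U) \<subseteq> grid N"
  using half_filled_subset grid_rects_subset by blast

lemma half_filled_mono:
  assumes "\<And>j. 0 < len j" "U \<subseteq> V"
  shows "half_filled N len i U \<subseteq> half_filled N len i V"
proof
  fix Q assume Q: "Q \<in> half_filled N len i U"
  then have "finite Q" by (auto simp: half_filled_def)
  then have "grid_vol len (Q \<inter> U) \<le> grid_vol len (Q \<inter> V)"
    using assms by (intro sum_mono2) (auto intro: less_imp_le cell_vol_pos)
  then show "Q \<in> half_filled N len i V" using Q unfolding half_filled_def by auto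
qed

lemma half_filled_superset:
  assumes "\<And>j. 0 < len j" "U \<subseteq> grid N"
  shows "U \<subseteq> \<Union>(half_filled N len i U)"
proof
  fix a assume "a \<in> U"
  then have "a \<in> grid N" using assms by auto
  have "{a} = segment i a (a i) (Suc (a i))"
    by (simp add: segment_def)
  moreover have "a i < Suc (a i)" "Suc (a i) \<le> N"
    using \<open>a \<in> grid N\<close> by (auto simp: grid_def Suc_le_eq)
  ultimately have "\<exists>b \<alpha> \<beta>. b \<in> grid N \<and> \<alpha> < \<beta> \<and> \<beta> \<le> N \<and> {a} = segment i b \<alpha> \<beta>"
    using \<open>a \<in> grid N\<close> by blast
  moreover have "grid_vol len {a} \<le> 2 * grid_vol len ({a} \<inter> U)"
    using \<open>a \<in> U\<close> cell_vol_pos[of len a, OF assms(1)] by simp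
  ultimately show "a \<in> \<Union>(half_filled N len i U)"
    unfolding half_filled_def by blast
qed

lemma minimal_subcover:
  assumes "finite \<Q>"
  obtains \<Q>' where "\<Q>' \<subseteq> \<Q>" "\<Union>\<Q>' = \<Union>\<Q>" "\<forall>Q\<in>\<Q>'. \<Union>(\<Q>' - {Q}) \<noteq> \<Union>\<Q>"
  using assms
proof (induction \<Q> arbitrary: thesis rule: finite_psubset_induct)
  case (psubset \<Q>)
  show ?case
  proof (cases "\<exists>Q\<in>\<Q>. \<Union>(\<Q> - {Q}) = \<Union>\<Q>")
    case True
    then obtain Q where "Q \<in> \<Q>" "\<Union>(\<Q> - {Q}) = \<Union>\<Q>" by blast
    then show ?thesis
      using psubset.IH[of "\<Q> - {Q}"] psubset.prems by (metis Diff_subset psubsetI subset_trans Diff_iff singletonI)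
  next
    case False
    then show ?thesis using psubset.prems[of \<Q>] by blast
  qed
qed

text \<open>All segments through \<open>x\<close> lie on one line. The one that starts first and the
  one that ends last together cover every other, so a third one could be dropped without changing
  the union.\<close>

lemma minimal_segments_overlap:
  assumes min: "\<And>Q. Q \<in> \<Q> \<Longrightarrow> \<Union>(\<Q> - {Q}) \<noteq> \<Union>\<Q>" and "finite \<Q>"
    and seg: "\<And>Q. Q \<in> \<Q> \<Longrightarrow> \<exists>a \<alpha> \<beta>. Q = segment i a \<alpha> \<beta>"
  shows "card {Q \<in> \<Q>. x \<in> Q} \<le> 2"
proof (cases "{Q \<in> \<Q>. x \<in> Q} = {}")
  case False
  let ?S = "{Q \<in> \<Q>. x \<in> Q}"
  have "\<forall>Q\<in>?S. \<exists>\<alpha> \<beta>. Q = segment i x \<alpha> \<beta>"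
  proof
    fix Q assume "Q \<in> ?S"
    then obtain a \<alpha> \<beta> where "Q = segment i a \<alpha> \<beta>" "x \<in> Q" using seg by blast
    then have "Q = segment i x \<alpha> \<beta>" using segment_cong by metis
    then show "\<exists>\<alpha> \<beta>. Q = segment i x \<alpha> \<beta>" by blast
  qed
  then obtain lo hi where lh: "\<And>Q. Q \<in> ?S \<Longrightarrow> Q = segment i x (lo Q) (hi Q)"
    by metis
  have "finite ?S" using \<open>finite \<Q>\<close> by simp
  obtain Q1 where Q1: "Q1 \<in> ?S" "\<And>Q. Q \<in> ?S \<Longrightarrow> lo Q1 \<le> lo Q"
  proof -
    have "Min (lo ` ?S) \<in> lo ` ?S" using False \<open>finite ?S\<close> by (intro Min_in) auto
    then obtain Q where "Q \<in> ?S" "lo Q = Min (lo ` ?S)" by auto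
    moreover have "Min (lo ` ?S) \<le> lo Q'" if "Q' \<in> ?S" for Q'
      using that \<open>finite ?S\<close> by (intro Min_le) auto
    ultimately show ?thesis using that by auto
  qed
  obtain Q2 where Q2: "Q2 \<in> ?S" "\<And>Q. Q \<in> ?S \<Longrightarrow> hi Q \<le> hi Q2"
  proof -
    have "Max (hi ` ?S) \<in> hi ` ?S" using False \<open>finite ?S\<close> by (intro Max_in) auto
    then obtain Q where "Q \<in> ?S" "hi Q = Max (hi ` ?S)" by auto
    moreover have "hi Q' \<le> Max (hi ` ?S)" if "Q' \<in> ?S" for Q'
      using that \<open>finite ?S\<close> by (intro Max_ge) auto
    ultimately show ?thesis using that by auto
  qed
  have "?S \<subseteq> {Q1, Q2}"
  proof
    fix Q assume Q: "Q \<in> ?S"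
    show "Q \<in> {Q1, Q2}"
    proof (rule ccontr)
      assume n: "Q \<notin> {Q1, Q2}"
      have x: "x \<in> Q" "x \<in> Q1" "x \<in> Q2" using Q Q1 Q2 by auto
      have "Q \<subseteq> Q1 \<union> Q2"
      proof
        fix b assume b: "b \<in> Q"
        have b': "lo Q \<le> b i" "b i < hi Q" "\<And>k. k \<noteq> i \<Longrightarrow> b k = x k"
          using b lh[OF Q] by (metis in_segment)+
        have x1: "x i < hi Q1" "lo Q2 \<le> x i"
          using x lh[OF Q1(1)] lh[OF Q2(1)] by (metis in_segment)+
        have "b \<in> segment i x (lo Q1) (hi Q1) \<or> b \<in> segment i x (lo Q2) (hi Q2)"
          using b' x1 Q1(2)[OF Q] Q2(2)[OF Q] by (force simp: in_segment)
        then show "b \<in> Q1 \<union> Q2" using lh[OF Q1(1)] lh[OF Q2(1)] by auto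
      qed
      then have "\<Union>(\<Q> - {Q}) = \<Union>\<Q>" using n Q Q1 Q2 by blast
      then show False using min Q by blast
    qed
  qed
  then have "card ?S \<le> card {Q1, Q2}" by (intro card_mono) auto
  then show ?thesis using card_insert_le_m1[of 2 "{Q2}" Q1] by simp
qed (metis card.empty zero_le)

text \<open>Doubling compares each half filled segment with its part in \<open>U\<close>. In a
  minimal subcover every cell lies in at most two segments, which accounts for the factor 2.\<close>

lemma half_filled_bound:
  assumes d: "grid_doubling C len \<mu>" and "0 \<le> C" "finite U"
  shows "sum \<mu> (\<Union>(half_filled N len i U)) \<le> 2 * C * sum \<mu> U"
proof -
  note pos = grid_doubling_pos[OF d]
  have fin: "finite (half_filled N len i U)"
    using half_filled_subset finite_grid_rects by (rule finite_subset)
  obtain \<Q> where Q: "\<Q> \<subseteq> half_filled N len i U" "\<Union>\<Q> = \<Union>(half_filled N len i U)"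
    "\<forall>Q\<in>\<Q>. \<Union>(\<Q> - {Q}) \<noteq> \<Union>(half_filled N len i U)"
    by (rule minimal_subcover[OF fin])
  have "finite \<Q>" using Q(1) fin by (rule finite_subset)
  have card: "card {Q \<in> \<Q>. x \<in> Q} \<le> 2" for x
  proof (rule minimal_segments_overlap[of _ i])
    show "\<exists>a \<alpha> \<beta>. Q = segment i a \<alpha> \<beta>" if "Q \<in> \<Q>" for Q
      using subsetD[OF Q(1) that] by (auto simp: half_filled_def)
  qed (use Q \<open>finite \<Q>\<close> in auto)
  have finQ: "finite Q" if "Q \<in> \<Q>" for Q
    using that Q(1) by (auto simp: half_filled_def)
  have "sum \<mu> (\<Union>\<Q>) \<le> (\<Sum>Q\<in>\<Q>. sum \<mu> Q)"
    using \<open>finite \<Q>\<close> finQ sum_Union_le[of \<Q> \<mu>] pos by (simp add: less_imp_le)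
  also have "\<dots> \<le> (\<Sum>Q\<in>\<Q>. C * sum \<mu> (Q \<inter> U))"
  proof (rule sum_mono)
    fix Q assume "Q \<in> \<Q>"
    then have "Q \<in> grid_rects N {i}" "grid_vol len Q \<le> 2 * grid_vol len (Q \<inter> U)"
      using Q(1) half_filled_subset[of N len i U] by (auto simp: half_filled_def)
    then show "sum \<mu> Q \<le> C * sum \<mu> (Q \<inter> U)"
      using grid_doublingD[OF d] by blast
  qed
  also have "\<dots> = C * (\<Sum>Q\<in>\<Q>. \<Sum>a\<in>U. if a \<in> Q then \<mu> a else 0)"
    using \<open>finite U\<close> by (simp add: sum_distrib_left sum.inter_restrict[symmetric] Int_commute)
  also have "\<dots> = C * (\<Sum>a\<in>U. \<Sum>Q\<in>\<Q>. if a \<in> Q then \<mu> a else 0)"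
    by (subst sum.swap) simp
  also have "\<dots> = C * (\<Sum>a\<in>U. real (card {Q \<in> \<Q>. a \<in> Q}) * \<mu> a)"
    using \<open>finite \<Q>\<close> by (simp add: sum.inter_filter[symmetric])
  also have "\<dots> \<le> C * (\<Sum>a\<in>U. 2 * \<mu> a)"
    using card pos \<open>0 \<le> C\<close> by (intro mult_left_mono sum_mono mult_right_mono) (auto simp: less_imp_le)
  finally show ?thesis unfolding Q(2) by (simp add: sum_distrib_left[symmetric])
qed

subsection \<open>Selection of rectangles\<close>

definition strip :: "'n \<Rightarrow> nat \<Rightarrow> ('n \<Rightarrow> nat) set \<Rightarrow> ('n \<Rightarrow> nat) set" where
  "strip i j R = {a \<in> R. a i = j}"

lemma strip_grid_rect:
  assumes "l i \<le> j" "j < u i"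
  shows "strip i j (grid_rect l u) = grid_rect (l(i := j)) (u(i := Suc j))"
proof (rule set_eqI)
  fix a
  have "a \<in> grid_rect (l(i := j)) (u(i := Suc j)) \<longleftrightarrow>
      (\<forall>k. if k = i then a k = j else l k \<le> a k \<and> a k < u k)"
    unfolding grid_rect_def mem_Collect_eq by (rule iff_allI) auto
  then show "a \<in> strip i j (grid_rect l u) \<longleftrightarrow> a \<in> grid_rect (l(i := j)) (u(i := Suc j))"
    unfolding strip_def grid_rect_def mem_Collect_eq using assms by metis
qed

text \<open>Fixing the coordinate \<open>i\<close> makes the rectangle one cell thick in that
  direction, so the slice is seen by the maximal function for the directions
  \<open>K\<close>.\<close>

lemma strip_in_grid_rects:
  assumes "R \<in> grid_rects N (insert i K)" "a \<in> R"
  shows "strip i (a i) R \<in> grid_rects N K"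
proof -
  obtain l u where R: "R = grid_rect l u" "\<And>k. l k < u k \<and> u k \<le> N"
    "\<And>k. k \<notin> insert i K \<Longrightarrow> u k = Suc (l k)"
    using assms unfolding grid_rects_def by blast
  have a: "l i \<le> a i" "a i < u i" using assms R by (auto simp: grid_rect_def)
  show ?thesis unfolding R(1) strip_grid_rect[of l i "a i" u, OF a]
    by (rule grid_rectsI) (use R a in \<open>auto simp: Suc_le_eq intro: less_le_trans\<close>)
qed

lemma sum_strips:
  "finite R \<Longrightarrow> sum f R = (\<Sum>j\<in>(\<lambda>a. a i) ` R. sum f (strip i j R))"
  unfolding strip_def by (rule sum.image_gen)

text \<open>Only the factor of \<open>cell_vol\<close> in direction \<open>i\<close> changes under
  the shift, and the shift is injective because \<open>X\<close> lies in one slice. The identity is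
  cross-multiplied to avoid a division.\<close>

lemma vol_shift:
  assumes "\<And>a. a \<in> X \<Longrightarrow> a i = j0"
  shows "len j0 * grid_vol len ((\<lambda>a. a(i := j)) ` X) = len j * grid_vol len X"
proof -
  have "inj_on (\<lambda>a. a(i := j)) X"
  proof (rule inj_onI)
    fix a b assume "a \<in> X" "b \<in> X" "a(i := j) = b(i := j)"
    then show "a = b" using assms by (metis fun_upd_idem fun_upd_upd)
  qed
  then have "grid_vol len ((\<lambda>a. a(i := j)) ` X) = (\<Sum>a\<in>X. cell_vol len (a(i := j)))"
    by (simp add: sum.reindex)
  moreover have "len j0 * cell_vol len (a(i := j)) = len j * cell_vol len a" if "a \<in> X" for a
    using cell_vol_upd[of len a i j] cell_vol_upd[of len a i j0] assms[OF that]
    by (metis fun_upd_idem mult.left_commute)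
  ultimately show ?thesis by (simp add: sum_distrib_left)
qed

text \<open>On each slice, doubling charges the integral of \<open>h\<close> to the part outside
  \<open>U\<close>, where the slice average is at most the maximal function in the directions
  \<open>K\<close>. Summing over the slices then yields the whole rectangle.\<close>

lemma sum_rect_le_maximal:
  assumes d: "grid_doubling C len \<mu>" and "1 \<le> C" and h: "\<And>a. 0 \<le> h a"
    and R: "R \<in> grid_rects N (insert i K)"
    and big: "\<And>a. a \<in> R \<Longrightarrow> grid_vol len (strip i (a i) R) \<le> 2 * grid_vol len (strip i (a i) R - U)"
  shows "(\<Sum>a\<in>R. \<mu> a * h a) \<le> C * (\<Sum>a\<in>R - U. \<mu> a * grid_maximal N K \<mu> h a)"
proof -
  note pos = grid_doubling_pos[OF d]
  let ?M = "grid_maximal N K \<mu> h"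
  have "finite R" using R finite_in_grid_rects by blast
  have strip: "(\<Sum>a\<in>strip i (b i) R. \<mu> a * h a) \<le> C * (\<Sum>a\<in>strip i (b i) R - U. \<mu> a * ?M a)" if "b \<in> R" for b
  proof -
    let ?S = "strip i (b i) R"
    have S: "?S \<in> grid_rects N K" using strip_in_grid_rects[OF R that] .
    have "finite ?S" using S finite_in_grid_rects by blast
    have "b \<in> ?S" using that by (simp add: strip_def)
    then have "0 < sum \<mu> ?S" using pos \<open>finite ?S\<close> by (intro sum_pos) auto
    then have "(\<Sum>a\<in>?S. \<mu> a * h a) = grid_avg \<mu> h ?S * sum \<mu> ?S"
      by (simp add: grid_avg_def)
    also have "\<dots> \<le> grid_avg \<mu> h ?S * (C * sum \<mu> (?S - U))"
      using grid_doublingD[OF d S, of "?S - U"] big[OF that] pos h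
      by (intro mult_left_mono grid_avg_nonneg) (auto simp: less_imp_le)
    also have "\<dots> = C * (\<Sum>a\<in>?S - U. \<mu> a * grid_avg \<mu> h ?S)"
      by (simp add: sum_distrib_right[symmetric])
    also have "\<dots> \<le> C * (\<Sum>a\<in>?S - U. \<mu> a * ?M a)"
      using \<open>1 \<le> C\<close> pos S by (intro mult_left_mono sum_mono grid_maximal_ge) (auto simp: less_imp_le)
    finally show ?thesis .
  qed
  have "(\<Sum>a\<in>R. \<mu> a * h a) = (\<Sum>j\<in>(\<lambda>a. a i) ` R. \<Sum>a\<in>strip i j R. \<mu> a * h a)"
    using \<open>finite R\<close> by (rule sum_strips)
  also have "\<dots> \<le> (\<Sum>j\<in>(\<lambda>a. a i) ` R. C * (\<Sum>a\<in>strip i j R - U. \<mu> a * ?M a))"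
    using strip by (intro sum_mono) auto
  also have "\<dots> = C * (\<Sum>j\<in>(\<lambda>a. a i) ` R. \<Sum>a\<in>strip i j R. if a \<in> U then 0 else \<mu> a * ?M a)"
  proof -
    have "(\<Sum>a\<in>A - U. \<mu> a * ?M a) = (\<Sum>a\<in>A. if a \<in> U then 0 else \<mu> a * ?M a)" if "finite A" for A
    proof -
      have "A - U = {a \<in> A. \<not> a \<in> U}" by auto
      then show ?thesis using that by (simp add: sum.inter_filter) (auto intro: sum.cong)
    qed
    moreover have "finite (strip i j R)" for j using \<open>finite R\<close> by (simp add: strip_def)
    ultimately show ?thesis by (simp add: sum_distrib_left)
  qed
  also have "\<dots> = C * (\<Sum>a\<in>R. if a \<in> U then 0 else \<mu> a * ?M a)"
    by (subst sum_strips[OF \<open>finite R\<close>, of _ i]) simp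
  also have "(\<Sum>a\<in>R. if a \<in> U then 0 else \<mu> a * ?M a) = (\<Sum>a\<in>R - U. \<mu> a * ?M a)"
  proof -
    have "R - U = {a \<in> R. \<not> a \<in> U}" by auto
    then show ?thesis using \<open>finite R\<close> by (simp add: sum.inter_filter) (auto intro: sum.cong)
  qed
  finally show ?thesis .
qed

text \<open>
  If a rectangle \<open>R'\<close> inside \<open>U\<close> is at least as long as \<open>R\<close> in direction \<open>i\<close> and meets it, then every
  line through the intersection spends at least half of its way through \<open>R \<union> R'\<close> inside \<open>U\<close>.
\<close>
lemma shift_in_half_filled:
  assumes len: "\<And>j. 0 < len j"
    and R: "R \<in> grid_rects N K" and R': "R' \<in> grid_rects N K" "R' \<subseteq> U"
    and le: "sum len ((\<lambda>a. a i) ` R) \<le> sum len ((\<lambda>a. a i) ` R')"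
    and b: "b \<in> R" "b \<in> R'" and a: "a \<in> R"
  shows "b(i := a i) \<in> \<Union>(half_filled N len i U)"
proof -
  have proj: "(\<lambda>a. a i) ` grid_rect l u = {l i..<u i}" if "\<And>k. l k < u k" for l u
  proof (intro equalityI subsetI)
    fix j assume "j \<in> {l i..<u i}"
    then have "l(i := j) \<in> grid_rect l u" using that by (auto simp: grid_rect_def)
    then show "j \<in> (\<lambda>a. a i) ` grid_rect l u" by (force intro: rev_image_eqI)
  qed (auto simp: grid_rect_def)
  obtain l u where lu: "R = grid_rect l u" "\<And>k. l k < u k \<and> u k \<le> N"
    using R unfolding grid_rects_def by blast
  obtain l' u' where lu': "R' = grid_rect l' u'" "\<And>k. l' k < u' k \<and> u' k \<le> N"
    using R' unfolding grid_rects_def by blast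
  \<comment> \<open>The segment through \<open>b\<close> spans the hull of both projections. They
    share the coordinate \<open>b i\<close>, so its length is at most the sum of theirs, hence at
    most twice that of the projection of \<open>R'\<close>, and the part over \<open>R'\<close> lies
    in \<open>U\<close>.\<close>
  define \<alpha> \<beta> where "\<alpha> = min (l i) (l' i)" and "\<beta> = max (u i) (u' i)"
  let ?c = "\<Prod>k\<in>UNIV - {i}. len (b k)"
  have bi: "l i \<le> b i" "b i < u i" "l' i \<le> b i" "b i < u' i"
    using b lu(1) lu'(1) by (auto simp: grid_rect_def)
  have "sum len {l i..<u i} \<le> sum len {l' i..<u' i}"
    using le lu lu' proj by simp
  moreover have "sum len {\<alpha>..<\<beta>} \<le> sum len {l i..<u i} + sum len {l' i..<u' i}"
  proof -
    have "{\<alpha>..<\<beta>} \<subseteq> {l i..<u i} \<union> {l' i..<u' i}"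
      using bi unfolding \<alpha>_def \<beta>_def by auto
    then have "sum len {\<alpha>..<\<beta>} \<le> sum len ({l i..<u i} \<union> {l' i..<u' i})"
      using len by (intro sum_mono2) (auto intro: less_imp_le)
    also have "\<dots> \<le> sum len {l i..<u i} + sum len {l' i..<u' i}"
      using len by (intro sum_Un_le) (auto intro: less_imp_le)
    finally show ?thesis .
  qed
  ultimately have "sum len {\<alpha>..<\<beta>} * ?c \<le> (2 * sum len {l' i..<u' i}) * ?c"
    using len by (intro mult_right_mono prod_nonneg) (auto intro: less_imp_le)
  then have "grid_vol len (segment i b \<alpha> \<beta>) \<le> 2 * grid_vol len (segment i b (l' i) (u' i))"
    by (simp add: vol_segment)
  moreover have "grid_vol len (segment i b (l' i) (u' i)) \<le> grid_vol len (segment i b \<alpha> \<beta> \<inter> U)"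
  proof (rule sum_mono2)
    have "c \<in> R'" if c: "c \<in> segment i b (l' i) (u' i)" for c
    proof -
      have "l' k \<le> c k \<and> c k < u' k" for k
        using c b(2) lu'(1) by (cases "k = i") (auto simp: in_segment grid_rect_def)
      then show ?thesis by (simp add: lu'(1) grid_rect_def)
    qed
    moreover have "segment i b (l' i) (u' i) \<subseteq> segment i b \<alpha> \<beta>"
      by (auto simp: in_segment \<alpha>_def \<beta>_def)
    ultimately show "segment i b (l' i) (u' i) \<subseteq> segment i b \<alpha> \<beta> \<inter> U" using R'(2) by auto
  qed (use len in \<open>auto intro: less_imp_le cell_vol_pos\<close>)
  moreover have "b \<in> grid N" using b R grid_rects_subset by blast
  moreover have "\<alpha> < \<beta>" "\<beta> \<le> N" using bi lu lu' by (auto simp: \<alpha>_def \<beta>_def)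
  ultimately have "segment i b \<alpha> \<beta> \<in> half_filled N len i U"
    unfolding half_filled_def by force
  moreover have "b(i := a i) \<in> segment i b \<alpha> \<beta>"
    using a lu(1) by (auto simp: in_segment \<alpha>_def \<beta>_def grid_rect_def min_le_iff_disj less_max_iff_disj)
  ultimately show ?thesis by blast
qed

text \<open>
  The rectangles are processed in order of decreasing length in direction \<open>i\<close>; \<open>U\<close> is the union of the
  selected ones, where a rectangle is selected if each of its strips is at least half outside
  the rectangles selected before.
\<close>
lemma greedy_selection:
  fixes K :: "'n::finite set"
  assumes d: "grid_doubling C len \<mu>" and "1 \<le> C" and h: "\<And>a. 0 \<le> h a" and "0 \<le> s"
    and \<F>: "\<F> \<subseteq> grid_rects N (insert i K)"
    and s: "\<And>R. R \<in> \<F> \<Longrightarrow> s * sum \<mu> R \<le> (\<Sum>a\<in>R. \<mu> a * h a)"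
  obtains U where "U \<subseteq> \<Union>\<F>" "s * sum \<mu> U \<le> C * (\<Sum>a\<in>U. \<mu> a * grid_maximal N K \<mu> h a)"
    "\<And>R a. R \<in> \<F> \<Longrightarrow> a \<in> R \<Longrightarrow> grid_vol len (strip i (a i) R)
       \<le> 2 * grid_vol len (strip i (a i) R \<inter> \<Union>(half_filled N len i U))"
proof -
  note pos = grid_doubling_pos[OF d]
  let ?M = "grid_maximal N K \<mu> h"
  let ?len = "\<lambda>R. sum len ((\<lambda>a. a i) ` R)"
  \<comment> \<open>The first conjunct makes \<open>U\<close> a union of processed rectangles: it
    supplies, for a point of \<open>U\<close>, a member of \<open>S\<close> through it that lies
    inside \<open>U\<close>. The last one is kept for discarded rectangles as well as for selected
    ones.\<close>
  define P where "P S U \<longleftrightarrow> (\<forall>a\<in>U. \<exists>R\<in>S. a \<in> R \<and> R \<subseteq> U) \<and> s * sum \<mu> U \<le> C * (\<Sum>a\<in>U. \<mu> a * ?M a) \<and>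
    (\<forall>R\<in>S. \<forall>a\<in>R. grid_vol len (strip i (a i) R) \<le> 2 * grid_vol len (strip i (a i) R \<inter> \<Union>(half_filled N len i U)))" for S U
  have "finite \<F>" using \<F> finite_grid_rects finite_subset by blast
  then have "\<F> \<subseteq> grid_rects N (insert i K) \<Longrightarrow> (\<And>R. R \<in> \<F> \<Longrightarrow> s * sum \<mu> R \<le> (\<Sum>a\<in>R. \<mu> a * h a)) \<Longrightarrow> \<exists>U. P \<F> U"
  \<comment> \<open>Ranking by the negated length makes the rectangle added last the shortest one:
    every member of \<open>S\<close> is at least as long as \<open>R\<close> in direction
    \<open>i\<close>.\<close>
  proof (induction \<F> rule: finite_ranking_induct[where f = "\<lambda>R. - ?len R"])
    case empty
    then show ?case by (intro exI[of _ "{}"]) (simp add: P_def)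
  next
    case (insert R S)
    then obtain U where U: "P S U" by auto
    have R: "R \<in> grid_rects N (insert i K)" using insert.prems by auto
    have finR: "finite R" using R finite_in_grid_rects by blast
    have Ugrid: "U \<subseteq> grid N"
    proof
      fix a assume "a \<in> U"
      then obtain R' where "R' \<in> S" "a \<in> R'" using U unfolding P_def by blast
      then show "a \<in> grid N" using insert.prems(1) grid_rects_subset[of R' N "insert i K"] by auto
    qed
    then have finU: "finite U" using finite_grid finite_subset by blast
    show ?case
    proof (cases "\<forall>a\<in>R. grid_vol len (strip i (a i) R) \<le> 2 * grid_vol len (strip i (a i) R - U)")
      case True
      have "s * sum \<mu> (U \<union> R) \<le> s * (sum \<mu> U + sum \<mu> R)"
        using pos finR finU \<open>0 \<le> s\<close> by (intro mult_left_mono sum_Un_le) (auto simp: less_imp_le)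
      also have "\<dots> \<le> C * (\<Sum>a\<in>U. \<mu> a * ?M a) + (\<Sum>a\<in>R. \<mu> a * h a)"
        using U insert.prems(2)[of R] by (simp add: P_def distrib_left)
      also have "\<dots> \<le> C * (\<Sum>a\<in>U. \<mu> a * ?M a) + C * (\<Sum>a\<in>R - U. \<mu> a * ?M a)"
        using sum_rect_le_maximal[OF d \<open>1 \<le> C\<close> h R] True by simp
      also have "\<dots> = C * (\<Sum>a\<in>U \<union> R. \<mu> a * ?M a)"
      proof -
        have "U \<union> R = U \<union> (R - U)" by auto
        then show ?thesis using finU finR
          by (simp add: sum.union_disjoint distrib_left del: Un_Diff_cancel)
      qed
      finally have 1: "s * sum \<mu> (U \<union> R) \<le> C * (\<Sum>a\<in>U \<union> R. \<mu> a * ?M a)" .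
      let ?H = "\<lambda>U. \<Union>(half_filled N len i U)"
      have UR: "U \<union> R \<subseteq> ?H (U \<union> R)"
        using half_filled_superset[of len "U \<union> R" N i] pos Ugrid grid_rects_subset[OF R] by auto
      have 2: "grid_vol len (strip i (a i) R') \<le> 2 * grid_vol len (strip i (a i) R' \<inter> ?H (U \<union> R))"
        if "R' \<in> insert R S" "a \<in> R'" for R' a
      proof (cases "R' = R")
        case True
        then have "strip i (a i) R' \<inter> ?H (U \<union> R) = strip i (a i) R'"
          using UR by (auto simp: strip_def)
        moreover have "0 \<le> grid_vol len (strip i (a i) R')"
          using pos by (intro sum_nonneg less_imp_le cell_vol_pos)
        ultimately show ?thesis by simp
      next
        case False
        then have R': "R' \<in> S" using that by auto
        then have "finite R'" using insert.prems(1) finite_in_grid_rects by blast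
        then have "grid_vol len (strip i (a i) R' \<inter> ?H U) \<le> grid_vol len (strip i (a i) R' \<inter> ?H (U \<union> R))"
          using Union_mono[OF half_filled_mono[of len U "U \<union> R" N i, OF pos(2)]]
          by (intro sum_mono2 less_imp_le[OF cell_vol_pos[OF pos(2)]]) (auto simp: strip_def)
        moreover have "grid_vol len (strip i (a i) R') \<le> 2 * grid_vol len (strip i (a i) R' \<inter> ?H U)"
          using U R' that(2) by (auto simp: P_def)
        ultimately show ?thesis by linarith
      qed
      have cover: "\<forall>a\<in>U \<union> R. \<exists>R'\<in>insert R S. a \<in> R' \<and> R' \<subseteq> U \<union> R"
      proof
        fix a assume "a \<in> U \<union> R"
        then consider "a \<in> R" | R' where "R' \<in> S" "a \<in> R'" "R' \<subseteq> U"
          using U unfolding P_def by blast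
        then show "\<exists>R'\<in>insert R S. a \<in> R' \<and> R' \<subseteq> U \<union> R" by cases auto
      qed
      have "P (insert R S) (U \<union> R)" unfolding P_def by (intro conjI cover 1 ballI 2)
      then show ?thesis by blast
    next
      case False
      then obtain b0 where b0: "b0 \<in> R" "2 * grid_vol len (strip i (b0 i) R - U) < grid_vol len (strip i (b0 i) R)"
        by force
      \<comment> \<open>A single slice of \<open>R\<close> with more than half of its volume in
        \<open>U\<close> is enough. Any point of \<open>?X\<close> lies in a rectangle inside
        \<open>U\<close> at least as long as \<open>R\<close>, so all translates of
        \<open>?X\<close> along direction \<open>i\<close> within \<open>R\<close> stay in the
        enlargement, and they fill at least half of every slice.\<close>
      let ?X = "strip i (b0 i) R \<inter> U"
      have "finite (strip i (b0 i) R)" using finR by (simp add: strip_def)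
      then have X: "grid_vol len (strip i (b0 i) R) \<le> 2 * grid_vol len ?X"
        using b0(2) sum.Int_Diff[of "strip i (b0 i) R" "cell_vol len" U] by simp
      have "grid_vol len (strip i (a i) R) \<le> 2 * grid_vol len (strip i (a i) R \<inter> \<Union>(half_filled N len i U))"
        if a: "a \<in> R" for a
      proof -
        obtain l u where lu: "R = grid_rect l u" using R unfolding grid_rects_def by blast
        have up: "b(i := a i) \<in> R" if "b \<in> R" for b
          using that a unfolding lu grid_rect_def by auto
        have "strip i (a i) R = (\<lambda>b. b(i := a i)) ` strip i (b0 i) R"
        proof (intro equalityI subsetI)
          fix b assume b: "b \<in> strip i (a i) R"
          then have "b(i := b0 i) \<in> strip i (b0 i) R"
            using b0(1) unfolding strip_def lu grid_rect_def by auto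
          moreover have "b = (b(i := b0 i))(i := a i)" using b by (auto simp: strip_def)
          ultimately show "b \<in> (\<lambda>b. b(i := a i)) ` strip i (b0 i) R" by blast
        qed (use up in \<open>auto simp: strip_def\<close>)
        then have "len (b0 i) * grid_vol len (strip i (a i) R) = len (a i) * grid_vol len (strip i (b0 i) R)"
          using vol_shift[of "strip i (b0 i) R" i "b0 i" len "a i"] by (simp add: strip_def)
        also have "\<dots> \<le> len (a i) * (2 * grid_vol len ?X)"
          using X pos by (intro mult_left_mono) (auto simp: less_imp_le)
        also have "\<dots> = 2 * (len (b0 i) * grid_vol len ((\<lambda>b. b(i := a i)) ` ?X))"
          using vol_shift[of ?X i "b0 i" len "a i"] by (simp add: strip_def)
        also have "\<dots> \<le> 2 * (len (b0 i) * grid_vol len (strip i (a i) R \<inter> \<Union>(half_filled N len i U)))"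
        proof (intro mult_left_mono sum_mono2)
          show "(\<lambda>b. b(i := a i)) ` ?X \<subseteq> strip i (a i) R \<inter> \<Union>(half_filled N len i U)"
          proof
            fix c assume "c \<in> (\<lambda>b. b(i := a i)) ` ?X"
            then obtain b where b: "c = b(i := a i)" "b \<in> R" "b \<in> U" by (auto simp: strip_def)
            obtain R' where R': "R' \<in> S" "b \<in> R'" "R' \<subseteq> U" using U b(3) unfolding P_def by blast
            have "b(i := a i) \<in> \<Union>(half_filled N len i U)"
            proof (rule shift_in_half_filled[OF pos(2) R _ R'(3) _ b(2) R'(2) a])
              show "?len R \<le> ?len R'" using insert.hyps R'(1) by auto
            qed (use R' insert.prems in auto)
            then show "c \<in> strip i (a i) R \<inter> \<Union>(half_filled N len i U)"
              using b up by (auto simp: strip_def)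
          qed
          show "finite (strip i (a i) R \<inter> \<Union>(half_filled N len i U))"
            using finR by (simp add: strip_def)
        qed (use pos in \<open>auto intro: less_imp_le cell_vol_pos\<close>)
        finally show ?thesis using pos(2)[of "b0 i"] by simp
      qed
      moreover have "\<exists>R'\<in>insert R S. a \<in> R' \<and> R' \<subseteq> U" if "a \<in> U" for a
        using that U unfolding P_def by auto
      ultimately have "P (insert R S) U" using U unfolding P_def by simp
      then show ?thesis by blast
    qed
  qed
  then obtain U where U: "P \<F> U" using \<F> s by blast
  show ?thesis
  proof (rule that)
    show "U \<subseteq> \<Union>\<F>" using U unfolding P_def by blast
  qed (use U in \<open>auto simp: P_def\<close>)
qed

subsection \<open>Maximal inequalities on a grid\<close>

definition grid_strong_type :: "real \<Rightarrow> real \<Rightarrow> nat \<Rightarrow> 'n set \<Rightarrow> (('n \<Rightarrow> nat) \<Rightarrow> real) \<Rightarrow> bool" where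
  "grid_strong_type B k N K \<mu> \<longleftrightarrow> (\<forall>h. (\<forall>a. 0 \<le> h a) \<longrightarrow>
     (\<Sum>a\<in>grid N. \<mu> a * grid_maximal N K \<mu> h a powr k) \<le> B * (\<Sum>a\<in>grid N. \<mu> a * h a powr k))"

lemma in_grid_rects_nonempty: "R \<in> grid_rects N K \<Longrightarrow> R \<noteq> {}"
  using grid_rect_nonempty unfolding grid_rects_def mem_Collect_eq by (metis empty_iff)

text \<open>By doubling, the \<open>\<mu>\<close>-averages of the indicator of \<open>V\<close> on
  the given rectangles are at least \<open>1 / C\<close>. Hence \<open>C\<close> times its maximal
  function is at least 1 on \<open>X\<close>, and Chebyshev's inequality with exponent
  \<open>k\<close> gives the bound. The hypothesis is about volume, the conclusion about
  \<open>\<mu>\<close>.\<close>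

lemma grid_measure_half_covered:
  fixes K :: "'n::finite set"
  assumes d: "grid_doubling C len \<mu>" and "1 \<le> C" "0 < k" and B: "grid_strong_type B k N K \<mu>"
    and V: "V \<subseteq> grid N"
    and X: "\<And>a. a \<in> X \<Longrightarrow> \<exists>R\<in>grid_rects N K. a \<in> R \<and> grid_vol len R \<le> 2 * grid_vol len (R \<inter> V)"
  shows "sum \<mu> X \<le> C powr k * B * sum \<mu> V"
proof -
  note pos = grid_doubling_pos[OF d]
  let ?M = "grid_maximal N K \<mu> (indicator V)"
  have "X \<subseteq> grid N" using X grid_rects_subset by blast
  have M0: "0 \<le> ?M a" if "a \<in> grid N" for a
    using pos that by (intro grid_maximal_nonneg) (auto simp: less_imp_le)
  have ge: "1 \<le> C * ?M a" if "a \<in> X" for a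
  proof -
    obtain R where R: "R \<in> grid_rects N K" "a \<in> R" "grid_vol len R \<le> 2 * grid_vol len (R \<inter> V)"
      using X[OF \<open>a \<in> X\<close>] by blast
    have "finite R" using R(1) by (rule finite_in_grid_rects)
    then have "0 < sum \<mu> R" using pos R(2) by (intro sum_pos) auto
    have "(\<Sum>a\<in>R. \<mu> a * indicator V a) = sum \<mu> (R \<inter> V)"
      using \<open>finite R\<close> by (simp add: indicator_def sum.inter_restrict mult.commute if_distrib cong: if_cong)
    moreover have "sum \<mu> R \<le> C * sum \<mu> (R \<inter> V)"
      using grid_doublingD[OF d R(1) _ R(3)] by simp
    ultimately have "1 \<le> C * grid_avg \<mu> (indicator V) R"
      using \<open>0 < sum \<mu> R\<close> by (simp add: grid_avg_def field_simps)
    also have "\<dots> \<le> C * ?M a"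
      using R \<open>1 \<le> C\<close> by (intro mult_left_mono grid_maximal_ge) auto
    finally show ?thesis .
  qed
  have "sum \<mu> X \<le> (\<Sum>a\<in>X. \<mu> a * (C * ?M a) powr k)"
  proof (rule sum_mono)
    fix a assume "a \<in> X"
    then have "1 \<le> (C * ?M a) powr k" using ge \<open>0 < k\<close> by (intro ge_one_powr_ge_zero) auto
    then show "\<mu> a \<le> \<mu> a * (C * ?M a) powr k" using pos(1)[of a] by simp
  qed
  also have "\<dots> \<le> (\<Sum>a\<in>grid N. \<mu> a * (C * ?M a) powr k)"
    using \<open>X \<subseteq> grid N\<close> pos by (intro sum_mono2) (auto simp: less_imp_le)
  also have "\<dots> = C powr k * (\<Sum>a\<in>grid N. \<mu> a * ?M a powr k)"
    using M0 \<open>1 \<le> C\<close> by (simp add: powr_mult sum_distrib_left mult_ac)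
  also have "\<dots> \<le> C powr k * (B * (\<Sum>a\<in>grid N. \<mu> a * indicator V a powr k))"
    using B unfolding grid_strong_type_def by (intro mult_left_mono) auto
  also have "(\<Sum>a\<in>grid N. \<mu> a * indicator V a powr k) = sum \<mu> V"
  proof -
    have "(\<Sum>a\<in>grid N. \<mu> a * indicator V a powr k) = (\<Sum>a\<in>grid N. if a \<in> V then \<mu> a else 0)"
      by (intro sum.cong) (auto simp: indicator_def)
    also have "\<dots> = sum \<mu> (grid N \<inter> V)" by (simp add: sum.inter_restrict)
    finally show ?thesis using V by (simp add: Int_absorb1)
  qed
  finally show ?thesis by (simp add: mult_ac)
qed

text \<open>Every point of the superlevel set lies on a slice half covered by the enlargement of the
  selected union \<open>U\<close>. Passing back to \<open>U\<close> costs
  \<open>C powr k * B\<close> for the covering by slices and \<open>2 * C\<close> for the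
  enlargement; the last factor \<open>C\<close> belongs to the selection. The sum on the right runs
  over the superlevel set itself, as Doob's argument requires.\<close>

lemma grid_maximal_weak_type_insert:
  fixes K :: "'n::finite set"
  assumes d: "grid_doubling C len \<mu>" and "1 \<le> C" "0 < k" and "0 \<le> B" and B: "grid_strong_type B k N K \<mu>"
    and h: "\<And>a. 0 \<le> h a" and "0 < s"
  shows "s * (\<Sum>a | a \<in> grid N \<and> s \<le> grid_maximal N (insert i K) \<mu> h a. \<mu> a)
    \<le> (C powr k * B * (2 * C) * C) * (\<Sum>a | a \<in> grid N \<and> s \<le> grid_maximal N (insert i K) \<mu> h a. \<mu> a * grid_maximal N K \<mu> h a)"
proof -
  note pos = grid_doubling_pos[OF d]
  let ?M = "grid_maximal N K \<mu> h"
  let ?X = "{a. a \<in> grid N \<and> s \<le> grid_maximal N (insert i K) \<mu> h a}"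
  define \<F> where "\<F> = {R \<in> grid_rects N (insert i K). s \<le> grid_avg \<mu> h R}"
  have \<F>X: "\<Union>\<F> = ?X"
  proof (intro equalityI subsetI)
    fix a assume "a \<in> \<Union>\<F>"
    then obtain R where R: "R \<in> grid_rects N (insert i K)" "s \<le> grid_avg \<mu> h R" "a \<in> R"
      by (auto simp: \<F>_def)
    then show "a \<in> ?X"
      using grid_maximal_ge[OF R(1,3), of \<mu> h] grid_rects_subset[OF R(1)] by auto
  next
    fix a assume "a \<in> ?X"
    then show "a \<in> \<Union>\<F>"
      using grid_maximal_attained[of a N "insert i K" \<mu> h] unfolding \<F>_def
      by (smt (verit) UnionI mem_Collect_eq)
  qed
  have avg: "s * sum \<mu> R \<le> (\<Sum>a\<in>R. \<mu> a * h a)" if "R \<in> \<F>" for R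
  proof -
    have R: "R \<in> grid_rects N (insert i K)" using that by (simp add: \<F>_def)
    have "0 < sum \<mu> R"
      using pos finite_in_grid_rects[OF R] in_grid_rects_nonempty[OF R] by (intro sum_pos) auto
    then show ?thesis using that by (simp add: \<F>_def grid_avg_def pos_le_divide_eq)
  qed
  have "\<F> \<subseteq> grid_rects N (insert i K)" by (auto simp: \<F>_def)
  from greedy_selection[OF d \<open>1 \<le> C\<close> h less_imp_le[OF \<open>0 < s\<close>] this avg]
  obtain U where U: "U \<subseteq> \<Union>\<F>" "s * sum \<mu> U \<le> C * (\<Sum>a\<in>U. \<mu> a * ?M a)"
    "\<And>R a. R \<in> \<F> \<Longrightarrow> a \<in> R \<Longrightarrow> grid_vol len (strip i (a i) R)
       \<le> 2 * grid_vol len (strip i (a i) R \<inter> \<Union>(half_filled N len i U))"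
    by blast
  have UX: "U \<subseteq> ?X" using U(1) \<F>X by simp
  have M0: "0 \<le> ?M a" if "a \<in> grid N" for a
    using pos h that by (intro grid_maximal_nonneg) (auto simp: less_imp_le)
  have "finite U" using UX finite_subset[of U "grid N"] by auto
  have "sum \<mu> ?X \<le> C powr k * B * sum \<mu> (\<Union>(half_filled N len i U))"
  proof (rule grid_measure_half_covered[OF d \<open>1 \<le> C\<close> \<open>0 < k\<close> B half_filled_subset_grid])
    fix a assume "a \<in> ?X"
    then obtain R where R: "R \<in> \<F>" "a \<in> R" using \<F>X by blast
    have "strip i (a i) R \<in> grid_rects N K"
      using strip_in_grid_rects[of R N i K a] R by (auto simp: \<F>_def)
    moreover have "a \<in> strip i (a i) R" using R by (simp add: strip_def)
    ultimately show "\<exists>R\<in>grid_rects N K. a \<in> R \<and> grid_vol len R \<le> 2 * grid_vol len (R \<inter> \<Union>(half_filled N len i U))"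
      using U(3)[OF R] by blast
  qed
  also have "\<dots> \<le> C powr k * B * (2 * C * sum \<mu> U)"
    using half_filled_bound[OF d _ \<open>finite U\<close>] \<open>1 \<le> C\<close> \<open>0 \<le> B\<close> by (intro mult_left_mono) auto
  finally have "s * sum \<mu> ?X \<le> s * (C powr k * B * (2 * C * sum \<mu> U))"
    using \<open>0 < s\<close> by (intro mult_left_mono) auto
  also have "\<dots> = (C powr k * B * (2 * C)) * (s * sum \<mu> U)" by simp
  also have "\<dots> \<le> (C powr k * B * (2 * C)) * (C * (\<Sum>a\<in>U. \<mu> a * ?M a))"
    using U(2) \<open>1 \<le> C\<close> \<open>0 \<le> B\<close> by (intro mult_left_mono) auto
  also have "\<dots> \<le> (C powr k * B * (2 * C)) * (C * (\<Sum>a\<in>?X. \<mu> a * ?M a))"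
    using \<open>1 \<le> C\<close> \<open>0 \<le> B\<close> UX M0 pos
    by (intro mult_left_mono sum_mono2) (auto simp: less_imp_le intro!: mult_nonneg_nonneg)
  finally show ?thesis by (simp add: mult_ac)
qed

text \<open>Induction on the directions: with none free, the maximal function is \<open>h\<close>
  itself, and Doob's inequality adds one direction at a time. The order of the quantifiers matters,
  since \<open>B\<close> must not depend on the grid or on the weight.\<close>

lemma grid_maximal_strong_type:
  fixes K :: "'n::finite set"
  assumes "1 < k" "1 \<le> C"
  shows "\<exists>B>0. \<forall>N len \<mu>. grid_doubling C len \<mu> \<longrightarrow> grid_strong_type B k N K \<mu>"
  using finite[of K]
proof (induction K rule: finite_induct)
  case empty
  have "grid_strong_type 1 k N {} \<mu>" if d: "grid_doubling C len \<mu>" for N len and \<mu> :: "('n \<Rightarrow> nat) \<Rightarrow> real"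
    unfolding grid_strong_type_def
  proof (intro allI impI)
    fix h :: "('n \<Rightarrow> nat) \<Rightarrow> real"
    have "grid_maximal N {} \<mu> h a = h a" if a: "a \<in> grid N" for a
    proof -
      obtain R where R: "R \<in> grid_rects N {}" "a \<in> R" "grid_maximal N {} \<mu> h a = grid_avg \<mu> h R"
        using grid_maximal_attained[OF a] by blast
      then obtain l where "R = grid_rect l (\<lambda>i. Suc (l i))"
        unfolding grid_rects_def by (auto simp flip: fun_eq_iff)
      then have "R = {a}"
        using R(2) by (auto simp: grid_rect_def less_Suc_eq_le fun_eq_iff) (metis le_antisym)+
      then show ?thesis
        using R(3) grid_doubling_pos(1)[OF d, of a] by (simp add: grid_avg_def)
    qed
    then show "(\<Sum>a\<in>grid N. \<mu> a * grid_maximal N {} \<mu> h a powr k) \<le> 1 * (\<Sum>a\<in>grid N. \<mu> a * h a powr k)"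
      by simp
  qed
  then show ?case by (intro exI[of _ 1]) auto
next
  case (insert i K)
  then obtain B where B: "0 < B" "\<And>N len \<mu>. grid_doubling C len \<mu> \<Longrightarrow> grid_strong_type B k N K \<mu>"
    by blast
  define c where "c = C powr k * B * (2 * C) * C"
  have "0 < c" using B assms by (simp add: c_def)
  define B' where "B' = (c * k / (k - 1)) powr k * B"
  have "grid_strong_type B' k N (insert i K) \<mu>" if d: "grid_doubling C len \<mu>" for N len \<mu>
    unfolding grid_strong_type_def
  proof (intro allI impI)
    fix h :: "('n \<Rightarrow> nat) \<Rightarrow> real" assume h: "\<forall>a. 0 \<le> h a"
    note pos = grid_doubling_pos[OF d]
    have M0: "0 \<le> grid_maximal N L \<mu> h a" if "a \<in> grid N" for a and L :: "'n set"
      using pos h that by (intro grid_maximal_nonneg) (auto simp: less_imp_le)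
    have "(\<Sum>a\<in>grid N. \<mu> a * grid_maximal N (insert i K) \<mu> h a powr k)
        \<le> (c * k / (k - 1)) powr k * (\<Sum>a\<in>grid N. \<mu> a * grid_maximal N K \<mu> h a powr k)"
    proof (rule doob_inequality_sum)
      show "s * (\<Sum>a | a \<in> grid N \<and> s \<le> grid_maximal N (insert i K) \<mu> h a. \<mu> a)
        \<le> c * (\<Sum>a | a \<in> grid N \<and> s \<le> grid_maximal N (insert i K) \<mu> h a. \<mu> a * grid_maximal N K \<mu> h a)"
        if "0 < s" for s
        unfolding c_def using grid_maximal_weak_type_insert[OF d _ _ _ B(2)[OF d] _ that] assms B(1) h by simp
    qed (use assms \<open>0 < c\<close> pos M0 in \<open>auto simp: less_imp_le\<close>)
    also have "\<dots> \<le> (c * k / (k - 1)) powr k * (B * (\<Sum>a\<in>grid N. \<mu> a * h a powr k))"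
      using B(2)[OF d] h unfolding grid_strong_type_def by (intro mult_left_mono) auto
    finally show "(\<Sum>a\<in>grid N. \<mu> a * grid_maximal N (insert i K) \<mu> h a powr k) \<le> B' * (\<Sum>a\<in>grid N. \<mu> a * h a powr k)"
      by (simp add: B'_def mult_ac)
  qed
  moreover have "0 < B'" using B assms \<open>0 < c\<close> by (simp add: B'_def)
  ultimately show ?case by blast
qed

text \<open>In the application \<open>h i\<close> is a quotient of masses on each cell, and the
  bound assumed for each \<open>R\<close> comes from the multiple weight condition at a fixed level.
  A greedy selection with disjoint increments lets these bounds be added up; the rectangles not
  selected are half covered by the selected ones.\<close>

lemma grid_weak_type_product:
  fixes P \<theta> :: "'m::finite \<Rightarrow> real"
  assumes P: "\<And>i. 1 < P i" and "1 \<le> C" and \<theta>: "\<And>i. 0 < \<theta> i" "sum \<theta> UNIV = 1"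
  obtains B where "0 < B"
    "\<And>N len (\<nu> :: ('n::finite \<Rightarrow> nat) \<Rightarrow> real) \<sigma> h A \<F>. grid_doubling C len \<nu> \<Longrightarrow> (\<And>i. grid_doubling C len (\<sigma> i)) \<Longrightarrow>
      (\<And>i a. 0 \<le> h i a) \<Longrightarrow> 0 \<le> A \<Longrightarrow> \<F> \<subseteq> grid_rects N UNIV \<Longrightarrow>
      (\<And>R. R \<in> \<F> \<Longrightarrow> sum \<nu> R \<le> A * (\<Prod>i\<in>UNIV. (sum (\<sigma> i) R * grid_avg (\<sigma> i) (h i) R powr P i) powr \<theta> i)) \<Longrightarrow>
      sum \<nu> (\<Union>\<F>) \<le> B * A * (\<Prod>i\<in>UNIV. (\<Sum>a\<in>grid N. \<sigma> i a * h i a powr P i) powr \<theta> i)"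
proof -
  obtain B0 where B0: "B0 > 0"
    "\<And>N len (\<mu> :: ('n \<Rightarrow> nat) \<Rightarrow> real). grid_doubling C len \<mu> \<Longrightarrow> grid_strong_type B0 2 N UNIV \<mu>"
    using grid_maximal_strong_type[of 2 C "UNIV :: 'n set"] \<open>1 \<le> C\<close> by auto
  have "\<forall>i. \<exists>B>0. \<forall>N len (\<mu> :: ('n \<Rightarrow> nat) \<Rightarrow> real). grid_doubling C len \<mu> \<longrightarrow> grid_strong_type B (P i) N UNIV \<mu>"
    using grid_maximal_strong_type[OF P \<open>1 \<le> C\<close>, where K = "UNIV :: 'n set"] by blast
  then obtain B1 where B1: "\<And>i. B1 i > 0"
    "\<And>i N len (\<mu> :: ('n \<Rightarrow> nat) \<Rightarrow> real). grid_doubling C len \<mu> \<Longrightarrow> grid_strong_type (B1 i) (P i) N UNIV \<mu>"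
    by metis
  \<comment> \<open>\<open>C powr 2 * B0\<close> passes from the selected union to all rectangles,
    by the maximal inequality for \<open>\<nu>\<close> with exponent 2. The product comes from the
    normalising constants \<open>W i\<close>.\<close>
  define B where "B = C powr 2 * B0 * (\<Prod>i\<in>UNIV. (C * B1 i) powr \<theta> i)"
  have "0 < B" unfolding B_def using B0 B1 \<open>1 \<le> C\<close> by (intro mult_pos_pos prod_pos) (auto simp: less_imp_neq[symmetric])
  show ?thesis
  proof (rule that[OF \<open>0 < B\<close>])
    fix N len A \<F> and \<nu> :: "('n \<Rightarrow> nat) \<Rightarrow> real" and \<sigma> h
    assume d0: "grid_doubling C len \<nu>" and d: "\<And>i. grid_doubling C len (\<sigma> i)" and h: "\<And>i a. 0 \<le> h i a"
      and "0 \<le> A" and \<F>: "\<F> \<subseteq> grid_rects N UNIV"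
      and R\<F>: "\<And>R. R \<in> \<F> \<Longrightarrow> sum \<nu> R \<le> A * (\<Prod>i\<in>UNIV. (sum (\<sigma> i) R * grid_avg (\<sigma> i) (h i) R powr P i) powr \<theta> i)"
    show "sum \<nu> (\<Union>\<F>) \<le> B * A * (\<Prod>i\<in>UNIV. (\<Sum>a\<in>grid N. \<sigma> i a * h i a powr P i) powr \<theta> i)"
    proof (cases "\<F> = {}")
      case True
      then show ?thesis using \<open>0 < B\<close> \<open>0 \<le> A\<close> by (simp add: prod_nonneg)
    next
      case False
      then obtain R0 where R0: "R0 \<in> \<F>" by blast
      note pos = grid_doubling_pos[OF d] and pos0 = grid_doubling_pos[OF d0]
      let ?M = "\<lambda>i. grid_maximal N UNIV (\<sigma> i) (h i)"
      define S where "S i = (\<Sum>a\<in>grid N. \<sigma> i a * h i a powr P i)" for i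
      \<comment> \<open>\<open>W i\<close> bounds \<open>C\<close> times the sum of
        \<open>\<sigma> i a * ?M i a powr P i\<close> over the grid, so for \<open>E\<close> inside
        the grid \<open>V i E / W i\<close> is a share between 0 and 1.\<close>
      define W where "W i = C * B1 i * S i" for i
      define V where "V i E = C * (\<Sum>a\<in>E. \<sigma> i a * ?M i a powr P i)" for i E
      \<comment> \<open>The normalisation divides by \<open>W i\<close>. If \<open>S i\<close> were
        zero, \<open>h i\<close> would vanish on the grid and the assumed bound would leave
        \<open>R0\<close> without \<open>\<nu>\<close>-mass.\<close>
      have Spos: "0 < S i" for i
      proof (rule ccontr)
        assume "\<not> 0 < S i"
        moreover have nn: "0 \<le> \<sigma> i a * h i a powr P i" for a using pos(1)[of i a] by simp
        ultimately have "S i = 0" unfolding S_def using sum_nonneg[of "grid N" "\<lambda>a. \<sigma> i a * h i a powr P i"] by force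
        then have "h i a = 0" if "a \<in> grid N" for a
          using that nn pos(1)[of i a] unfolding S_def by (fastforce simp: sum_nonneg_eq_0_iff)
        moreover have "R0 \<subseteq> grid N" using R0 \<F> grid_rects_subset by blast
        ultimately have "(\<Sum>a\<in>R0. \<sigma> i a * h i a) = 0" by (intro sum.neutral) auto
        then have "grid_avg (\<sigma> i) (h i) R0 = 0" by (simp add: grid_avg_def)
        then have "(\<Prod>i\<in>UNIV. (sum (\<sigma> i) R0 * grid_avg (\<sigma> i) (h i) R0 powr P i) powr \<theta> i) = 0"
          by (intro prod_zero) auto
        then have "sum \<nu> R0 \<le> 0" using R\<F>[OF R0] by (simp only: mult_zero_right)
        moreover have "0 < sum \<nu> R0"
          using in_grid_rects_nonempty[OF subsetD[OF \<F> R0]] finite_in_grid_rects[OF subsetD[OF \<F> R0]] pos0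
          by (intro sum_pos) auto
        ultimately show False by simp
      qed
      have W: "0 < W i" for i using Spos B1 \<open>1 \<le> C\<close> by (simp add: W_def)
      have nnV: "0 \<le> \<sigma> i a * ?M i a powr P i" for i a using pos(1)[of i a] by simp
      have V0: "0 \<le> V i E" for i E unfolding V_def using \<open>1 \<le> C\<close> by (intro mult_nonneg_nonneg[of C] sum_nonneg nnV) simp
      have VW: "V i E \<le> W i" if "E \<subseteq> grid N" for i E
      proof -
        have "(\<Sum>a\<in>E. \<sigma> i a * ?M i a powr P i) \<le> (\<Sum>a\<in>grid N. \<sigma> i a * ?M i a powr P i)"
          using that nnV by (intro sum_mono2) auto
        also have "\<dots> \<le> B1 i * S i"
          using B1(2)[OF d] h unfolding grid_strong_type_def S_def by blast
        finally show ?thesis unfolding V_def W_def using \<open>1 \<le> C\<close> by (simp add: mult.assoc)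
      qed
      define D where "D = A * (\<Prod>i\<in>UNIV. W i powr \<theta> i)"
      have "0 \<le> D" using \<open>0 \<le> A\<close> by (simp add: D_def prod_nonneg)
      \<comment> \<open>The arithmetic-geometric mean inequality replaces a product of shares by
        this weighted sum. It is additive over disjoint sets and at most 1 within the grid, so the
        bounds for disjoint increments add up to at most \<open>D\<close>.\<close>
      define \<Phi> where "\<Phi> E = (\<Sum>i\<in>UNIV. \<theta> i * (V i E / W i))" for E
      have select: "sum \<nu> R \<le> D * \<Phi> (R - U)"
        if R: "R \<in> \<F>" and v: "grid_vol len R \<le> 2 * grid_vol len (R - U)" for R U
      proof -
        have Rg: "R \<in> grid_rects N UNIV" using R \<F> by auto
        have "sum (\<sigma> i) R * grid_avg (\<sigma> i) (h i) R powr P i \<le> V i (R - U)" for i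
        proof -
          have "sum (\<sigma> i) R * grid_avg (\<sigma> i) (h i) R powr P i
              \<le> (C * sum (\<sigma> i) (R - U)) * grid_avg (\<sigma> i) (h i) R powr P i"
            using grid_doublingD[OF d Rg _ v] by (intro mult_right_mono) auto
          also have "\<dots> = C * (\<Sum>a\<in>R - U. \<sigma> i a * grid_avg (\<sigma> i) (h i) R powr P i)"
            by (simp add: sum_distrib_right[symmetric])
          also have "\<dots> \<le> V i (R - U)"
            unfolding V_def using \<open>1 \<le> C\<close> pos(1)[of i] P[of i] h Rg
            by (intro mult_left_mono sum_mono powr_mono2 grid_maximal_ge grid_avg_nonneg) (auto simp: less_imp_le)
          finally show ?thesis .
        qed
        then have "sum \<nu> R \<le> A * (\<Prod>i\<in>UNIV. V i (R - U) powr \<theta> i)"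
          using \<open>0 \<le> A\<close> \<theta> pos
          by (intro order_trans[OF R\<F>[OF R]] mult_left_mono prod_mono conjI powr_mono2)
             (auto intro!: mult_nonneg_nonneg sum_nonneg simp: less_imp_le)
        also have "\<dots> = D * (\<Prod>i\<in>UNIV. (V i (R - U) / W i) powr \<theta> i)"
        proof -
          have "V i (R - U) powr \<theta> i = W i powr \<theta> i * (V i (R - U) / W i) powr \<theta> i" for i
            using W[of i] V0[of i] by (simp add: powr_divide less_imp_neq[symmetric])
          then show ?thesis by (simp add: D_def prod.distrib)
        qed
        also have "\<dots> \<le> D * \<Phi> (R - U)"
          unfolding \<Phi>_def using \<open>0 \<le> D\<close> \<theta> V0 W
          by (intro mult_left_mono weighted_arith_geo_mean) (auto simp: less_imp_le)
        finally show ?thesis .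
      qed
      have "finite \<F>" using \<F> finite_grid_rects finite_subset by blast
      \<comment> \<open>The order is arbitrary here: \<open>R\<close> joins \<open>U\<close> if at
        least half of its volume lies outside \<open>U\<close>, and otherwise at least half of it is
        inside already. The hypotheses on \<open>\<F>\<close> are restated so that the induction can
        restrict them to subfamilies.\<close>
      then have "\<F> \<subseteq> grid_rects N UNIV \<Longrightarrow> (\<And>R U. R \<in> \<F> \<Longrightarrow> grid_vol len R \<le> 2 * grid_vol len (R - U) \<Longrightarrow> sum \<nu> R \<le> D * \<Phi> (R - U)) \<Longrightarrow>
        \<exists>U\<subseteq>grid N. sum \<nu> U \<le> D * \<Phi> U \<and> (\<forall>R\<in>\<F>. grid_vol len R \<le> 2 * grid_vol len (R \<inter> U))"
      proof (induction \<F> rule: finite_induct)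
        case empty
        then show ?case by (intro exI[of _ "{}"]) (simp add: \<Phi>_def V_def)
      next
        case (insert R \<F>)
        then obtain U where U: "U \<subseteq> grid N" "sum \<nu> U \<le> D * \<Phi> U"
          "\<And>R. R \<in> \<F> \<Longrightarrow> grid_vol len R \<le> 2 * grid_vol len (R \<inter> U)" by auto
        have fin: "finite R'" if "R' \<in> insert R \<F>" for R' using that insert.prems(1) finite_in_grid_rects by blast
        have finU: "finite U" using U(1) finite_grid finite_subset by blast
        show ?case
        proof (cases "grid_vol len R \<le> 2 * grid_vol len (R - U)")
          case True
          have "sum \<nu> (U \<union> R) \<le> sum \<nu> U + sum \<nu> R"
            using finU fin pos0 by (intro sum_Un_le) (auto simp: less_imp_le)
          also have "\<dots> \<le> D * \<Phi> U + D * \<Phi> (R - U)" using U(2) insert.prems(2)[of R U] True by auto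
          also have "\<dots> = D * \<Phi> (U \<union> R)"
          proof -
            have "V i (U \<union> R) = V i U + V i (R - U)" for i
            proof -
              have "U \<union> R = U \<union> (R - U)" by auto
              then show ?thesis using finU fin[of R] unfolding V_def
                by (simp add: sum.union_disjoint distrib_left del: Un_Diff_cancel)
            qed
            then have "\<Phi> (U \<union> R) = \<Phi> U + \<Phi> (R - U)"
              by (simp add: \<Phi>_def sum.distrib distrib_left add_divide_distrib)
            then show ?thesis by (simp add: distrib_left)
          qed
          finally have 1: "sum \<nu> (U \<union> R) \<le> D * \<Phi> (U \<union> R)" .
          have 2: "grid_vol len R' \<le> 2 * grid_vol len (R' \<inter> (U \<union> R))" if "R' \<in> insert R \<F>" for R'
          proof (cases "R' = R")
            case True
            have "0 \<le> grid_vol len R" by (intro sum_nonneg less_imp_le cell_vol_pos pos0(2))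
            then show ?thesis using True by simp
          next
            case False
            have "grid_vol len (R' \<inter> U) \<le> grid_vol len (R' \<inter> (U \<union> R))"
              using fin[OF that] by (intro sum_mono2 less_imp_le[OF cell_vol_pos[OF pos0(2)]]) auto
            then show ?thesis using U(3)[of R'] False that by auto
          qed
          show ?thesis
            using 1 2 U(1) grid_rects_subset[of R N UNIV] insert.prems(1) by (intro exI[of _ "U \<union> R"]) auto
        next
          case False
          then have "grid_vol len R \<le> 2 * grid_vol len (R \<inter> U)"
            using sum.Int_Diff[of R "cell_vol len" U] fin[of R] by simp
          then show ?thesis using U by (intro exI[of _ U]) auto
        qed
      qed
      then obtain U where U: "U \<subseteq> grid N" "sum \<nu> U \<le> D * \<Phi> U"
        "\<And>R. R \<in> \<F> \<Longrightarrow> grid_vol len R \<le> 2 * grid_vol len (R \<inter> U)"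
        using select \<F> by auto
      have "\<Phi> U \<le> (\<Sum>i\<in>UNIV. \<theta> i * 1)"
        unfolding \<Phi>_def using VW[OF U(1)] W \<theta> by (intro sum_mono mult_left_mono) (auto simp: less_imp_le)
      then have "\<Phi> U \<le> 1" using \<theta>(2) by simp
      have "sum \<nu> (\<Union>\<F>) \<le> C powr 2 * B0 * sum \<nu> U"
      proof (rule grid_measure_half_covered[OF d0 \<open>1 \<le> C\<close> _ B0(2)[OF d0] U(1)])
        fix a assume "a \<in> \<Union>\<F>"
        then obtain R where "R \<in> \<F>" "a \<in> R" by auto
        then show "\<exists>R\<in>grid_rects N UNIV. a \<in> R \<and> grid_vol len R \<le> 2 * grid_vol len (R \<inter> U)"
          using U(3) \<F> by auto
      qed simp
      also have "\<dots> \<le> C powr 2 * B0 * D"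
        using U(2) mult_left_mono[OF \<open>\<Phi> U \<le> 1\<close> \<open>0 \<le> D\<close>] B0(1) by (intro mult_left_mono) auto
      also have "\<dots> = B * A * (\<Prod>i\<in>UNIV. S i powr \<theta> i)"
      proof -
        have "W i powr \<theta> i = (C * B1 i) powr \<theta> i * S i powr \<theta> i" for i
          using B1(1)[of i] Spos[of i] \<open>1 \<le> C\<close> unfolding W_def by (intro powr_mult)
        then show ?thesis by (simp add: B_def D_def prod.distrib mult_ac)
      qed
      finally show ?thesis by (simp add: S_def)
    qed
  qed
qed

subsection \<open>From rectangles to a grid\<close>

text \<open>\<open>enn2real\<close> turns an infinite integral into 0, so the value is meaningful
  only together with finiteness of the integral, as \<open>rect_finite\<close> provides on
  rectangles.\<close>

definition mass :: "(real ^ 'n \<Rightarrow> ennreal) \<Rightarrow> (real ^ 'n) set \<Rightarrow> real" where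
  "mass \<tau> E = enn2real (\<integral>\<^sup>+ x\<in>E. \<tau> x \<partial>lebesgue)"

definition rect_finite :: "(real ^ 'n \<Rightarrow> ennreal) \<Rightarrow> bool" where
  "rect_finite \<tau> \<longleftrightarrow> \<tau> \<in> borel_measurable lebesgue \<and> (\<forall>R\<in>rectangles. (\<integral>\<^sup>+ x\<in>R. \<tau> x \<partial>lebesgue) < \<infinity>)"

definition rect_doubling :: "real \<Rightarrow> (real ^ 'n \<Rightarrow> ennreal) \<Rightarrow> bool" where
  "rect_doubling C \<tau> \<longleftrightarrow> rect_finite \<tau> \<and> (\<forall>R\<in>rectangles. 0 < mass \<tau> R) \<and>
    (\<forall>R\<in>rectangles. \<forall>E\<in>sets lebesgue. E \<subseteq> R \<longrightarrow> measure lebesgue R \<le> 2 * measure lebesgue E \<longrightarrow>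
       mass \<tau> R \<le> C * mass \<tau> E)"

text \<open>Half-open boxes with corners on the grid are exact disjoint unions of half-open cells,
  which fails for open ones. They differ from open boxes only by negligible sets.\<close>

definition half_open_box :: "real ^ 'n \<Rightarrow> real ^ 'n \<Rightarrow> (real ^ 'n) set" where
  "half_open_box l u = {x. \<forall>i. l $ i < x $ i \<and> x $ i \<le> u $ i}"

definition grid_point :: "(nat \<Rightarrow> real) \<Rightarrow> ('n::finite \<Rightarrow> nat) \<Rightarrow> real ^ 'n" where
  "grid_point t a = (\<chi> i. t (a i))"

definition cell :: "(nat \<Rightarrow> real) \<Rightarrow> ('n::finite \<Rightarrow> nat) \<Rightarrow> (real ^ 'n) set" where
  "cell t a = half_open_box (grid_point t a) (grid_point t (\<lambda>i. Suc (a i)))"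

lemma grid_point_nth [simp]: "grid_point t a $ i = t (a i)"
  by (simp add: grid_point_def)

lemma box_in_rectangles [simp]: "box a b \<in> rectangles \<longleftrightarrow> (\<forall>i. a $ i < b $ i)"
proof
  assume "box a b \<in> rectangles"
  then obtain c d where "box a b = box c d" "\<forall>i. c $ i < d $ i" by (auto simp: rectangles_def)
  then have "box a b \<noteq> {}" by (simp add: interval_ne_empty_cart)
  then show "\<forall>i. a $ i < b $ i" by (simp add: interval_ne_empty_cart)
qed (auto simp: rectangles_def)

lemma rectangle_sets [simp, measurable]: "R \<in> rectangles \<Longrightarrow> R \<in> sets lebesgue"
  by (auto simp: rectangles_def)

lemma open_rectangle: "R \<in> rectangles \<Longrightarrow> open R"
  by (auto simp: rectangles_def)

lemma half_open_box_diff_negligible: "negligible (half_open_box l u - box l u)"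
  by (rule negligible_subset[OF negligible_frontier_interval[of l u]])
     (auto simp: half_open_box_def mem_box_cart less_imp_le)

lemma box_subset_half_open_box: "box l u \<subseteq> half_open_box l u"
  by (auto simp: half_open_box_def mem_box_cart less_imp_le)

lemma half_open_box_sets [simp, measurable]: "half_open_box l u \<in> sets lebesgue"
proof -
  have "half_open_box l u = box l u \<union> (half_open_box l u - box l u)"
    using box_subset_half_open_box by auto
  then show ?thesis
    using half_open_box_diff_negligible[of l u] by (metis fmeasurableD lmeasurable_box negligible_imp_sets sets.Un)
qed

lemma cell_sets [simp, measurable]: "cell t a \<in> sets lebesgue"
  by (simp add: cell_def)

lemma set_nn_integral_negligible_diff:
  assumes "A \<subseteq> B" "negligible (B - A)"
  shows "(\<integral>\<^sup>+ x\<in>A. \<tau> x \<partial>lebesgue) = (\<integral>\<^sup>+ x\<in>B. \<tau> x \<partial>lebesgue)"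
proof (rule nn_integral_cong_AE)
  show "AE x in lebesgue. \<tau> x * indicator A x = \<tau> x * indicator B x"
    using assms by (intro AE_I'[of "B - A"]) (auto simp: negligible_iff_null_sets indicator_def)
qed

lemma set_nn_integral_half_open_box:
  "(\<integral>\<^sup>+ x\<in>half_open_box l u. \<tau> x \<partial>lebesgue) = (\<integral>\<^sup>+ x\<in>box l u. \<tau> x \<partial>lebesgue)"
  by (rule set_nn_integral_negligible_diff[OF box_subset_half_open_box half_open_box_diff_negligible, symmetric])

lemma between_breakpoints:
  fixes t :: "nat \<Rightarrow> real"
  assumes "strict_mono t" "t l < x" "x \<le> t u"
  obtains k where "l \<le> k" "k < u" "t k < x" "x \<le> t (Suc k)"
  using assms(3)
proof (induction u arbitrary: thesis)
  case 0
  then have "t l < t 0" using assms by simp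
  then show ?case using assms(1) by (simp add: strict_mono_less)
next
  case (Suc u)
  show ?case
  proof (cases "x \<le> t u")
    case True
    then show ?thesis using Suc less_SucI by blast
  next
    case False
    have "t l < t (Suc u)" using assms(2) Suc.prems(2) by simp
    then have "l \<le> u" using assms(1) by (simp add: strict_mono_less)
    then show ?thesis using Suc.prems False by auto
  qed
qed

lemma cell_disjoint:
  assumes "strict_mono t" "x \<in> cell t a" "x \<in> cell t b"
  shows "a = b"
proof (rule ext)
  fix i
  have "t (a i) < t (Suc (b i))" "t (b i) < t (Suc (a i))"
    using assms(2,3) unfolding cell_def half_open_box_def by (force intro: less_le_trans)+
  then show "a i = b i" using assms(1) by (simp add: strict_mono_less)
qed

lemma half_open_box_eq_cells:
  assumes "strict_mono t"
  shows "half_open_box (grid_point t l) (grid_point t u) = (\<Union>a\<in>grid_rect l u. cell t a)"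
proof (intro equalityI subsetI)
  fix x assume x: "x \<in> half_open_box (grid_point t l) (grid_point t u)"
  have "\<exists>k. l i \<le> k \<and> k < u i \<and> t k < x $ i \<and> x $ i \<le> t (Suc k)" for i
    using x between_breakpoints[OF assms, of "l i" "x $ i" "u i"] unfolding half_open_box_def by force
  then obtain a where "\<And>i. l i \<le> a i \<and> a i < u i \<and> t (a i) < x $ i \<and> x $ i \<le> t (Suc (a i))" by metis
  then show "x \<in> (\<Union>a\<in>grid_rect l u. cell t a)"
    by (intro UN_I[of a]) (auto simp: grid_rect_def cell_def half_open_box_def)
next
  fix x assume "x \<in> (\<Union>a\<in>grid_rect l u. cell t a)"
  then obtain a where a: "\<And>i. l i \<le> a i \<and> a i < u i" "\<And>i. t (a i) < x $ i \<and> x $ i \<le> t (Suc (a i))"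
    by (auto simp: grid_rect_def cell_def half_open_box_def)
  have "t (l i) < x $ i \<and> x $ i \<le> t (u i)" for i
  proof -
    have "t (l i) \<le> t (a i)" "t (Suc (a i)) \<le> t (u i)"
      using a(1)[of i] assms by (auto simp: strict_mono_less_eq Suc_le_eq)
    then show ?thesis using a(2)[of i] by linarith
  qed
  then show "x \<in> half_open_box (grid_point t l) (grid_point t u)"
    by (simp add: half_open_box_def)
qed

lemma set_nn_integral_cells:
  assumes "strict_mono t" "finite A" "\<tau> \<in> borel_measurable lebesgue"
  shows "(\<integral>\<^sup>+ x\<in>(\<Union>a\<in>A. cell t a). \<tau> x \<partial>lebesgue) = (\<Sum>a\<in>A. \<integral>\<^sup>+ x\<in>cell t a. \<tau> x \<partial>lebesgue)"
proof -
  have "disjoint_family_on (cell t) A"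
    using cell_disjoint[OF assms(1)] by (auto simp: disjoint_family_on_def)
  then have "indicator (\<Union>a\<in>A. cell t a) x = (\<Sum>a\<in>A. indicator (cell t a) x :: ennreal)" for x
    using assms(2) by (intro indicator_UN_disjoint) auto
  then show ?thesis
    using assms(3) by (simp add: sum_distrib_left nn_integral_sum)
qed

lemma rect_finite_cell:
  assumes "rect_finite \<tau>" "strict_mono t"
  shows "(\<integral>\<^sup>+ x\<in>cell t a. \<tau> x \<partial>lebesgue) < \<infinity>"
proof -
  have "box (grid_point t a) (grid_point t (\<lambda>i. Suc (a i))) \<in> rectangles"
    using assms(2) by (simp add: strict_mono_less)
  then show ?thesis
    using assms(1) unfolding cell_def set_nn_integral_half_open_box rect_finite_def by blast
qed

lemma mass_cells:
  assumes "strict_mono t" "finite A" "rect_finite \<tau>"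
  shows "(\<integral>\<^sup>+ x\<in>(\<Union>a\<in>A. cell t a). \<tau> x \<partial>lebesgue) = ennreal (\<Sum>a\<in>A. mass \<tau> (cell t a))"
    and "mass \<tau> (\<Union>a\<in>A. cell t a) = (\<Sum>a\<in>A. mass \<tau> (cell t a))"
proof -
  have "(\<integral>\<^sup>+ x\<in>(\<Union>a\<in>A. cell t a). \<tau> x \<partial>lebesgue) = (\<Sum>a\<in>A. ennreal (mass \<tau> (cell t a)))"
    using set_nn_integral_cells[OF assms(1,2)] rect_finite_cell[OF assms(3,1)] assms(3)
    by (simp add: rect_finite_def mass_def)
  then show *: "(\<integral>\<^sup>+ x\<in>(\<Union>a\<in>A. cell t a). \<tau> x \<partial>lebesgue) = ennreal (\<Sum>a\<in>A. mass \<tau> (cell t a))"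
    by (simp add: mass_def)
  show "mass \<tau> (\<Union>a\<in>A. cell t a) = (\<Sum>a\<in>A. mass \<tau> (cell t a))"
    unfolding mass_def[of _ "\<Union>a\<in>A. cell t a"] * by (simp add: mass_def sum_nonneg)
qed

lemma mass_box_grid:
  assumes "strict_mono t" "rect_finite \<tau>"
  shows "mass \<tau> (box (grid_point t l) (grid_point t u)) = (\<Sum>a\<in>grid_rect l u. mass \<tau> (cell t a))"
  using mass_cells(2)[OF assms(1) finite_grid_rect assms(2), of l u]
  by (simp add: mass_def set_nn_integral_half_open_box flip: half_open_box_eq_cells[OF assms(1)])

lemma rect_finite_one: "rect_finite (\<lambda>_ :: real ^ 'n. 1)"
  by (auto simp: rect_finite_def rectangles_def emeasure_lborel_box_eq nn_integral_indicator less_top[symmetric])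

lemma mass_one: "E \<in> sets lebesgue \<Longrightarrow> mass (\<lambda>_. 1) E = measure lebesgue E"
  by (simp add: mass_def measure_def)

lemma measure_rectangle: "(\<And>i. a $ i \<le> b $ i) \<Longrightarrow> measure lebesgue (box a b) = (\<Prod>i\<in>UNIV. b $ i - a $ i)"
  using content_cbox_cart[of a b]
  by (simp add: interval_ne_empty_cart measure_lborel_box_eq measure_lborel_cbox_eq del: content_cbox_if_cart)

lemma mass_one_cell:
  assumes "strict_mono t"
  shows "mass (\<lambda>_. 1) (cell t a) = cell_vol (\<lambda>k. t (Suc k) - t k) a"
proof -
  have "mass (\<lambda>_. 1) (cell t a) = measure lebesgue (box (grid_point t a) (grid_point t (\<lambda>i. Suc (a i))))"
    unfolding mass_def cell_def set_nn_integral_half_open_box by (simp add: measure_def)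
  also have "\<dots> = (\<Prod>i\<in>UNIV. t (Suc (a i)) - t (a i))"
    using assms by (subst measure_rectangle) (auto simp: strict_mono_less_eq)
  finally show ?thesis by (simp add: cell_vol_def)
qed

lemma measure_cells:
  assumes "strict_mono t" "finite A"
  shows "measure lebesgue (\<Union>a\<in>A. cell t a) = grid_vol (\<lambda>k. t (Suc k) - t k) A"
proof -
  have "(\<Union>a\<in>A. cell t a) \<in> sets lebesgue" using assms(2) by (intro sets.finite_UN) auto
  then show ?thesis
    using mass_cells(2)[OF assms rect_finite_one] by (simp only: mass_one mass_one_cell[OF assms(1)])
qed

text \<open>A set of cells is intersected with the open rectangle before doubling applies; this
  loses only a negligible set. The constant \<open>C\<close> is therefore the same for every choice
  of breakpoints.\<close>

lemma grid_doubling_cells: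
  fixes \<tau> :: "real ^ 'n \<Rightarrow> ennreal"
  assumes d: "rect_doubling C \<tau>" and t: "strict_mono t"
  shows "grid_doubling C (\<lambda>k. t (Suc k) - t k) (\<lambda>a. mass \<tau> (cell t a))"
  unfolding grid_doubling_def
proof (intro conjI allI impI)
  have fin: "rect_finite \<tau>" using d by (simp add: rect_doubling_def)
  show "0 < t (Suc k) - t k" for k using t by (simp add: strict_mono_less)
  show "0 < mass \<tau> (cell t a)" for a
  proof -
    have "box (grid_point t a) (grid_point t (\<lambda>i. Suc (a i))) \<in> rectangles"
      using t by (simp add: strict_mono_less)
    then show ?thesis
      using d unfolding cell_def mass_def set_nn_integral_half_open_box rect_doubling_def by blast
  qed
  fix l u :: "'n \<Rightarrow> nat" and A
  assume lu: "\<forall>i. l i < u i" and A: "A \<subseteq> grid_rect l u"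
    and v: "grid_vol (\<lambda>k. t (Suc k) - t k) (grid_rect l u) \<le> 2 * grid_vol (\<lambda>k. t (Suc k) - t k) A"
  let ?R = "box (grid_point t l) (grid_point t u)"
  let ?A = "\<Union>a\<in>A. cell t a"
  have "finite A" by (rule finite_subset[OF A finite_grid_rect])
  then have [measurable]: "?A \<in> sets lebesgue" by (intro sets.finite_UN) auto
  have "?A \<subseteq> half_open_box (grid_point t l) (grid_point t u)"
    unfolding half_open_box_eq_cells[OF t] using A by (rule UN_mono) simp
  then have "?A - ?A \<inter> ?R \<subseteq> half_open_box (grid_point t l) (grid_point t u) - ?R" by auto
  then have "negligible (?A - ?A \<inter> ?R)"
    by (rule negligible_subset[OF half_open_box_diff_negligible])
  then have mA: "mass \<rho> (?A \<inter> ?R) = mass \<rho> ?A" for \<rho> :: "real ^ 'n \<Rightarrow> ennreal"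
    unfolding mass_def by (subst set_nn_integral_negligible_diff[of "?A \<inter> ?R" ?A]) auto
  have R: "?R \<in> rectangles" using lu t by (simp add: strict_mono_less)
  have sets: "?A \<inter> ?R \<in> sets lebesgue" using R by auto
  have "measure lebesgue ?R = grid_vol (\<lambda>k. t (Suc k) - t k) (grid_rect l u)"
    using mass_box_grid[OF t rect_finite_one, of l u] mass_one[of ?R] by (simp add: mass_one_cell[OF t])
  also have "\<dots> \<le> 2 * measure lebesgue (?A \<inter> ?R)"
    using v mA[of "\<lambda>_. 1"] sets measure_cells[OF t \<open>finite A\<close>] by (simp add: mass_one)
  finally have "mass \<tau> ?R \<le> C * mass \<tau> (?A \<inter> ?R)"
    using d R sets unfolding rect_doubling_def by blast
  then show "(\<Sum>a\<in>grid_rect l u. mass \<tau> (cell t a)) \<le> C * (\<Sum>a\<in>A. mass \<tau> (cell t a))"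
    using mass_box_grid[OF t fin] mA mass_cells(2)[OF t \<open>finite A\<close> fin] by simp
qed

lemma strict_mono_breakpoints:
  assumes "finite (T :: real set)"
  obtains t :: "nat \<Rightarrow> real" where "strict_mono t" "T \<subseteq> range t"
proof -
  define xs where "xs = sorted_list_of_set T"
  \<comment> \<open>Beyond the sorted list the sequence continues in unit steps above the maximum,
    since \<open>t\<close> must increase on all of \<open>nat\<close>; \<open>insert 0\<close> keeps
    \<open>Max\<close> meaningful for empty \<open>T\<close>.\<close>
  define t where "t k = (if k < length xs then xs ! k else Max (insert 0 T) + 1 + real k)" for k
  have "t k < t (Suc k)" for k
  proof -
    consider "Suc k < length xs" | "Suc k = length xs" | "length xs \<le> k" by linarith
    then show ?thesis
    proof cases
      case 1
      then have "xs ! k < xs ! Suc k"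
        using strict_sorted_list_of_set[of T] unfolding xs_def[symmetric] by (simp add: sorted_wrt_nth_less)
      then show ?thesis using 1 by (simp add: t_def)
    next
      case 2
      then have "xs ! k \<in> T" using assms nth_mem[of k xs] by (simp add: xs_def)
      then have "xs ! k \<le> Max (insert 0 T)" using assms by (intro Max_ge) auto
      then show ?thesis using 2 by (simp add: t_def)
    qed (simp add: t_def)
  qed
  then have "strict_mono t" by (simp add: strict_mono_Suc_iff)
  moreover have "T \<subseteq> range t"
  proof
    fix x assume "x \<in> T"
    then obtain k where "k < length xs" "xs ! k = x"
      using assms in_set_conv_nth[of x xs] by (auto simp: xs_def)
    then have "x = t k" by (simp add: t_def)
    then show "x \<in> range t" by blast
  qed
  ultimately show ?thesis by (rule that)
qed

text \<open>The coordinates of all corners in all directions form one finite set, so a single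
  increasing sequence containing them can serve as breakpoints for every axis.\<close>

lemma rectangles_on_grid:
  assumes "finite \<F>" "\<F> \<subseteq> rectangles"
  obtains t :: "nat \<Rightarrow> real" and N where "strict_mono t"
    "\<forall>R\<in>\<F>. \<exists>l u. (\<forall>i. l i < u i \<and> u i \<le> N) \<and> R = box (grid_point t l) (grid_point t u)"
proof -
  have "\<forall>R\<in>\<F>. \<exists>a b. R = box a b \<and> (\<forall>i. a $ i < b $ i)"
    using assms(2) by (auto simp: rectangles_def)
  then obtain lo hi where lh: "\<And>R. R \<in> \<F> \<Longrightarrow> R = box (lo R) (hi R) \<and> (\<forall>i. lo R $ i < hi R $ i)"
    by metis
  define T where "T = (\<Union>R\<in>\<F>. range (($) (lo R)) \<union> range (($) (hi R)))"
  have "finite T" using assms(1) by (simp add: T_def)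
  obtain t :: "nat \<Rightarrow> real" where t: "strict_mono t" "T \<subseteq> range t"
    by (rule strict_mono_breakpoints[OF \<open>finite T\<close>])
  define rk where "rk x = inv t x" for x
  have rk: "t (rk x) = x" if "x \<in> T" for x
    using that t(2) by (auto simp: rk_def f_inv_into_f)
  define N where "N = Max (insert 0 (rk ` T))"
  show ?thesis
  proof (rule that[OF t(1)], intro ballI)
    fix R assume R: "R \<in> \<F>"
    have inT: "lo R $ i \<in> T" "hi R $ i \<in> T" for i using R by (auto simp: T_def)
    let ?l = "\<lambda>i. rk (lo R $ i)" and ?u = "\<lambda>i. rk (hi R $ i)"
    have "?l i < ?u i" for i
      using lh[OF R] rk inT t(1) by (metis strict_mono_less)
    moreover have "?u i \<le> N" for i
      unfolding N_def using inT \<open>finite T\<close> by (intro Max_ge) auto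
    moreover have "lo R = grid_point t ?l" "hi R = grid_point t ?u"
      using rk inT by (auto simp: vec_eq_iff)
    ultimately show "\<exists>l u. (\<forall>i. l i < u i \<and> u i \<le> N) \<and> R = box (grid_point t l) (grid_point t u)"
      using lh[OF R] by metis
  qed
qed

text \<open>\<open>F i\<close> plays the role of the absolute value of a function and
  \<open>G i\<close> that of its weighted power; the two are linked only through Hoelder's
  inequality on rectangles. The grid depends on the finite family \<open>\<F>\<close>, but
  \<open>B\<close> does not, so the bound can pass to infinite families.\<close>

lemma rectangles_weak_type_product:
  fixes P \<theta> :: "'m::finite \<Rightarrow> real"
  assumes P: "\<And>i. 1 < P i" and "1 \<le> C" and \<theta>: "\<And>i. 0 < \<theta> i" "sum \<theta> UNIV = 1"
  obtains B where "0 < B"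
    "\<And>(\<nu> :: real ^ 'n \<Rightarrow> ennreal) \<sigma> F G A \<F>. rect_doubling C \<nu> \<Longrightarrow> (\<And>i. rect_doubling C (\<sigma> i)) \<Longrightarrow>
      (\<And>i. rect_finite (F i)) \<Longrightarrow> (\<And>i. G i \<in> borel_measurable lebesgue) \<Longrightarrow> (\<And>i. (\<integral>\<^sup>+ x. G i x \<partial>lebesgue) < \<infinity>) \<Longrightarrow>
      (\<And>i R. R \<in> rectangles \<Longrightarrow> mass (F i) R powr P i \<le> mass (\<sigma> i) R powr (P i - 1) * mass (G i) R) \<Longrightarrow>
      0 \<le> A \<Longrightarrow> finite \<F> \<Longrightarrow> \<F> \<subseteq> rectangles \<Longrightarrow>
      (\<And>R. R \<in> \<F> \<Longrightarrow> mass \<nu> R \<le> A * (\<Prod>i\<in>UNIV. (mass (\<sigma> i) R * (mass (F i) R / mass (\<sigma> i) R) powr P i) powr \<theta> i)) \<Longrightarrow>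
      (\<integral>\<^sup>+ x\<in>\<Union>\<F>. \<nu> x \<partial>lebesgue) \<le> ennreal (B * A * (\<Prod>i\<in>UNIV. mass (G i) UNIV powr \<theta> i))"
proof (rule grid_weak_type_product[where 'n = 'n, of P C \<theta>, OF P \<open>1 \<le> C\<close> \<theta>])
  fix B assume B: "0 < B"
    "\<And>N len (\<nu> :: ('n \<Rightarrow> nat) \<Rightarrow> real) \<sigma> h A \<F>. grid_doubling C len \<nu> \<Longrightarrow> (\<And>i. grid_doubling C len (\<sigma> i)) \<Longrightarrow>
      (\<And>i a. 0 \<le> h i a) \<Longrightarrow> 0 \<le> A \<Longrightarrow> \<F> \<subseteq> grid_rects N UNIV \<Longrightarrow>
      (\<And>R. R \<in> \<F> \<Longrightarrow> sum \<nu> R \<le> A * (\<Prod>i\<in>UNIV. (sum (\<sigma> i) R * grid_avg (\<sigma> i) (h i) R powr P i) powr \<theta> i)) \<Longrightarrow>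
      sum \<nu> (\<Union>\<F>) \<le> B * A * (\<Prod>i\<in>UNIV. (\<Sum>a\<in>grid N. \<sigma> i a * h i a powr P i) powr \<theta> i)"
  show ?thesis
  proof (rule that[OF B(1)])
    fix \<nu> :: "real ^ 'n \<Rightarrow> ennreal" and \<sigma> F G A \<F>
    assume d\<nu>: "rect_doubling C \<nu>" and d\<sigma>: "\<And>i. rect_doubling C (\<sigma> i)"
      and F: "\<And>i. rect_finite (F i)" and G: "\<And>i. G i \<in> borel_measurable lebesgue" "\<And>i. (\<integral>\<^sup>+ x. G i x \<partial>lebesgue) < \<infinity>"
      and hoelder: "\<And>i R. R \<in> rectangles \<Longrightarrow> mass (F i) R powr P i \<le> mass (\<sigma> i) R powr (P i - 1) * mass (G i) R"
      and "0 \<le> A" and \<F>: "finite \<F>" "\<F> \<subseteq> rectangles"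
      and R\<F>: "\<And>R. R \<in> \<F> \<Longrightarrow> mass \<nu> R \<le> A * (\<Prod>i\<in>UNIV. (mass (\<sigma> i) R * (mass (F i) R / mass (\<sigma> i) R) powr P i) powr \<theta> i)"
    obtain t N where t: "strict_mono t" and
      grid: "\<forall>R\<in>\<F>. \<exists>l u. (\<forall>i. l i < u i \<and> u i \<le> N) \<and> R = box (grid_point t l) (grid_point t u)"
      by (rule rectangles_on_grid[OF \<F>])
    have fin\<nu>: "rect_finite \<nu>" and fin\<sigma>: "\<And>i. rect_finite (\<sigma> i)"
      using d\<nu> d\<sigma> by (auto simp: rect_doubling_def)
    have Gint: "(\<integral>\<^sup>+ x\<in>E. G i x \<partial>lebesgue) \<le> (\<integral>\<^sup>+ x. G i x \<partial>lebesgue)" for E i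
      by (intro nn_integral_mono) (auto simp: indicator_def)
    then have Gfin: "rect_finite (G i)" for i
      using G unfolding rect_finite_def by (meson le_less_trans)
    let ?n = "\<lambda>a. mass \<nu> (cell t a)" and ?s = "\<lambda>i a. mass (\<sigma> i) (cell t a)"
    \<comment> \<open>With this quotient on cells, the weighted grid average of \<open>h i\<close>
      equals the quotient of masses on every grid rectangle, while Hoelder's inequality on each cell
      keeps the weighted sum of \<open>h i a powr P i\<close> below the mass of
      \<open>G i\<close>.\<close>
    define h where "h i a = mass (F i) (cell t a) / ?s i a" for i a
    note dn = grid_doubling_cells[OF d\<nu> t] and ds = grid_doubling_cells[OF d\<sigma> t]
    have spos: "0 < ?s i a" for i a using grid_doubling_pos(1)[OF ds] .
    define \<F>' where "\<F>' = {R' \<in> grid_rects N UNIV. \<exists>l u. R' = grid_rect l u \<and> box (grid_point t l) (grid_point t u) \<in> \<F>}"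
    have "sum ?n (\<Union>\<F>') \<le> B * A * (\<Prod>i\<in>UNIV. (\<Sum>a\<in>grid N. ?s i a * h i a powr P i) powr \<theta> i)"
    proof (rule B(2)[OF dn ds _ \<open>0 \<le> A\<close>])
      show "0 \<le> h i a" for i a by (simp add: h_def mass_def)
      fix R' assume "R' \<in> \<F>'"
      then obtain l u where R': "R' = grid_rect l u" and R: "box (grid_point t l) (grid_point t u) \<in> \<F>"
        by (auto simp: \<F>'_def)
      have "grid_avg (?s i) (h i) R' = mass (F i) (box (grid_point t l) (grid_point t u)) / mass (\<sigma> i) (box (grid_point t l) (grid_point t u))" for i
      proof -
        have "?s i a * h i a = mass (F i) (cell t a)" for a
          using spos[of i a] by (simp add: h_def)
        then show ?thesis
          by (simp add: grid_avg_def R' mass_box_grid[OF t F] mass_box_grid[OF t fin\<sigma>])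
      qed
      then show "sum ?n R' \<le> A * (\<Prod>i\<in>UNIV. (sum (?s i) R' * grid_avg (?s i) (h i) R' powr P i) powr \<theta> i)"
        using R\<F>[OF R] unfolding R' by (simp add: mass_box_grid[OF t fin\<sigma>] mass_box_grid[OF t fin\<nu>])
    qed (auto simp: \<F>'_def)
    also have "\<dots> \<le> B * A * (\<Prod>i\<in>UNIV. mass (G i) UNIV powr \<theta> i)"
    proof (intro mult_left_mono prod_mono conjI powr_mono2)
      fix i
      have "?s i a * h i a powr P i \<le> mass (G i) (cell t a)" for a
      proof -
        have "box (grid_point t a) (grid_point t (\<lambda>i. Suc (a i))) \<in> rectangles"
          using t by (simp add: strict_mono_less)
        from hoelder[OF this, of i]
        have "mass (F i) (cell t a) powr P i \<le> ?s i a powr (P i - 1) * mass (G i) (cell t a)"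
          by (simp add: mass_def cell_def set_nn_integral_half_open_box)
        moreover have "?s i a * h i a powr P i = mass (F i) (cell t a) powr P i / ?s i a powr (P i - 1)"
          using spos[of i a] unfolding h_def
          by (simp add: powr_divide mass_def powr_diff)
        ultimately show ?thesis using spos[of i a] by (simp add: divide_le_eq mult.commute)
      qed
      then have "(\<Sum>a\<in>grid N. ?s i a * h i a powr P i) \<le> (\<Sum>a\<in>grid N. mass (G i) (cell t a))"
        by (rule sum_mono)
      also have "\<dots> = mass (G i) (\<Union>a\<in>grid N. cell t a)"
        by (rule mass_cells(2)[OF t finite_grid Gfin, symmetric])
      also have "\<dots> \<le> mass (G i) UNIV"
        unfolding mass_def using Gint[of i] G(2)[of i] by (intro enn2real_mono) auto
      finally show "(\<Sum>a\<in>grid N. ?s i a * h i a powr P i) \<le> mass (G i) UNIV" .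
      show "0 \<le> (\<Sum>a\<in>grid N. ?s i a * h i a powr P i)"
        using spos by (intro sum_nonneg mult_nonneg_nonneg) (auto simp: less_imp_le)
    qed (use B(1) \<open>0 \<le> A\<close> \<theta>(1) in \<open>auto simp: less_imp_le\<close>)
    finally have sum_le: "sum ?n (\<Union>\<F>') \<le> B * A * (\<Prod>i\<in>UNIV. mass (G i) UNIV powr \<theta> i)" .
    have "\<Union>\<F> \<subseteq> (\<Union>a\<in>\<Union>\<F>'. cell t a)"
    proof
      fix x assume "x \<in> \<Union>\<F>"
      then obtain R where R: "R \<in> \<F>" "x \<in> R" by auto
      obtain l u where lu: "\<And>i. l i < u i \<and> u i \<le> N" "R = box (grid_point t l) (grid_point t u)"
        using bspec[OF grid R(1)] by blast
      have "x \<in> (\<Union>a\<in>grid_rect l u. cell t a)"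
        using R(2) lu(2) box_subset_half_open_box unfolding half_open_box_eq_cells[OF t, symmetric] by blast
      moreover have "grid_rect l u \<in> \<F>'"
        unfolding \<F>'_def using R(1) lu by (auto intro!: grid_rectsI)
      ultimately show "x \<in> (\<Union>a\<in>\<Union>\<F>'. cell t a)" by blast
    qed
    then have "(\<integral>\<^sup>+ x\<in>\<Union>\<F>. \<nu> x \<partial>lebesgue) \<le> (\<integral>\<^sup>+ x\<in>(\<Union>a\<in>\<Union>\<F>'. cell t a). \<nu> x \<partial>lebesgue)"
      by (rule nn_set_integral_set_mono)
    also have "\<dots> = ennreal (sum ?n (\<Union>\<F>'))"
    proof (rule mass_cells(1)[OF t _ fin\<nu>])
      show "finite (\<Union>\<F>')"
        by (rule finite_subset[of _ "grid N"]) (auto simp: \<F>'_def dest: grid_rects_subset)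
    qed
    also have "\<dots> \<le> ennreal (B * A * (\<Prod>i\<in>UNIV. mass (G i) UNIV powr \<theta> i))"
      using sum_le by (rule ennreal_leI)
    finally show "(\<integral>\<^sup>+ x\<in>\<Union>\<F>. \<nu> x \<partial>lebesgue) \<le> ennreal (B * A * (\<Prod>i\<in>UNIV. mass (G i) UNIV powr \<theta> i))" .
  qed
qed

subsection \<open>Hoelder's inequality and doubling\<close>

lemma enn_powr_ennreal_nonneg: "0 < a \<Longrightarrow> 0 \<le> x \<Longrightarrow> ennreal x powr\<^sub>e a = ennreal (x powr a)"
  by (auto simp: enn_powr_def)

lemma enn_powr_zero [simp]: "0 < a \<Longrightarrow> 0 powr\<^sub>e a = 0"
  by (simp add: enn_powr_def)

lemma enn_powr_top [simp]: "0 < a \<Longrightarrow> top powr\<^sub>e a = top"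
  by (simp add: enn_powr_def)

lemma enn_powr_pos: "0 < x \<Longrightarrow> 0 < a \<Longrightarrow> 0 < x powr\<^sub>e a"
  by (cases x) (auto simp: enn_powr_ennreal)

lemma enn_powr_mono: "0 < a \<Longrightarrow> x \<le> y \<Longrightarrow> x powr\<^sub>e a \<le> y powr\<^sub>e a"
  by (cases x; cases y) (auto simp: enn_powr_ennreal_nonneg top_unique intro!: ennreal_leI powr_mono2)

lemma borel_measurable_enn_powr [measurable]: "(\<lambda>x. x powr\<^sub>e a) \<in> borel_measurable borel"
  unfolding enn_powr_def by measurable

lemma set_nn_integral_eq_mass:
  "(\<integral>\<^sup>+ x\<in>E. \<tau> x \<partial>lebesgue) < \<infinity> \<Longrightarrow> (\<integral>\<^sup>+ x\<in>E. \<tau> x \<partial>lebesgue) = ennreal (mass \<tau> E)"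
  by (simp add: mass_def)

lemma mass_nonneg [simp]: "0 \<le> mass \<tau> E"
  by (simp add: mass_def)

lemma mass_mono:
  assumes "A \<subseteq> B" "(\<integral>\<^sup>+ x\<in>B. \<tau> x \<partial>lebesgue) < \<infinity>"
  shows "mass \<tau> A \<le> mass \<tau> B"
  unfolding mass_def using assms by (intro enn2real_mono nn_set_integral_set_mono) auto

text \<open>Normalise each \<open>\<tau> k\<close> to mass one on \<open>E\<close>, apply the
  arithmetic-geometric mean inequality pointwise, and integrate. A factor of mass zero cannot be
  normalised; in that case it vanishes almost everywhere on \<open>E\<close>, and so does
  \<open>g\<close>.\<close>

lemma set_nn_integral_hoelder:
  fixes \<tau> :: "'k::finite \<Rightarrow> real ^ 'n \<Rightarrow> ennreal"
  assumes \<tau>: "\<And>k. \<tau> k \<in> borel_measurable lebesgue" and E: "E \<in> sets lebesgue"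
    and fin: "\<And>k. (\<integral>\<^sup>+ x\<in>E. \<tau> k x \<partial>lebesgue) < \<infinity>"
    and \<theta>: "\<And>k. 0 < \<theta> k" "sum \<theta> UNIV = 1"
    and g: "AE x in lebesgue. x \<in> E \<longrightarrow> g x \<le> ennreal (\<Prod>k\<in>UNIV. enn2real (\<tau> k x) powr \<theta> k)"
  shows "(\<integral>\<^sup>+ x\<in>E. g x \<partial>lebesgue) \<le> ennreal (\<Prod>k\<in>UNIV. mass (\<tau> k) E powr \<theta> k)"
proof (cases "\<exists>k. mass (\<tau> k) E = 0")
  case True
  then obtain k where "mass (\<tau> k) E = 0" by blast
  then have "(\<integral>\<^sup>+ x\<in>E. \<tau> k x \<partial>lebesgue) = 0" using set_nn_integral_eq_mass[OF fin[of k]] by simp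
  then have "AE x in lebesgue. \<tau> k x * indicator E x = 0"
    using \<tau> E by (subst (asm) nn_integral_0_iff_AE) auto
  then have "AE x in lebesgue. g x * indicator E x = 0"
    using g
  proof eventually_elim
    case (elim x)
    show ?case
    proof (cases "x \<in> E")
      case True
      then have "\<tau> k x = 0" using elim by simp
      then have "(\<Prod>k\<in>UNIV. enn2real (\<tau> k x) powr \<theta> k) = 0" by (intro prod_zero) (auto intro!: exI[of _ k])
      then show ?thesis using elim True by (simp only: simp_thms ennreal_0 le_zero_eq mult_zero_left)
    qed simp
  qed
  then have "(\<integral>\<^sup>+ x\<in>E. g x \<partial>lebesgue) = (\<integral>\<^sup>+ x. 0 \<partial>lebesgue :: (real ^ 'n) measure)"
    by (rule nn_integral_cong_AE)
  then show ?thesis by simp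
next
  case False
  then have pos: "0 < mass (\<tau> k) E" for k using mass_nonneg[of "\<tau> k" E] by (metis less_le)
  define D where "D = (\<Prod>k\<in>UNIV. mass (\<tau> k) E powr \<theta> k)"
  have "0 \<le> D" by (simp add: D_def prod_nonneg)
  define c where "c k = D * \<theta> k / mass (\<tau> k) E" for k
  have c: "0 \<le> c k" for k using \<open>0 \<le> D\<close> \<theta>(1)[of k] pos[of k] by (simp add: c_def)
  have "(\<integral>\<^sup>+ x\<in>E. g x \<partial>lebesgue) \<le> (\<integral>\<^sup>+ x. (\<Sum>k\<in>UNIV. ennreal (c k) * (\<tau> k x * indicator E x)) \<partial>lebesgue)"
  proof (rule nn_integral_mono_AE)
    show "AE x in lebesgue. g x * indicator E x \<le> (\<Sum>k\<in>UNIV. ennreal (c k) * (\<tau> k x * indicator E x))"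
      using g
    proof eventually_elim
      case (elim x)
      show ?case
      proof (cases "x \<in> E")
        case True
        have "(\<Prod>k\<in>UNIV. enn2real (\<tau> k x) powr \<theta> k) = D * (\<Prod>k\<in>UNIV. (enn2real (\<tau> k x) / mass (\<tau> k) E) powr \<theta> k)"
        proof -
          have "enn2real (\<tau> k x) powr \<theta> k = mass (\<tau> k) E powr \<theta> k * (enn2real (\<tau> k x) / mass (\<tau> k) E) powr \<theta> k" for k
            using pos[of k] by (simp add: powr_divide)
          then show ?thesis by (simp add: D_def prod.distrib)
        qed
        also have "\<dots> \<le> D * (\<Sum>k\<in>UNIV. \<theta> k * (enn2real (\<tau> k x) / mass (\<tau> k) E))"
          using \<theta> pos \<open>0 \<le> D\<close> by (intro mult_left_mono weighted_arith_geo_mean) (auto simp: less_imp_le)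
        also have "\<dots> = (\<Sum>k\<in>UNIV. c k * enn2real (\<tau> k x))"
          by (simp add: c_def sum_distrib_left mult_ac)
        finally have "g x \<le> ennreal (\<Sum>k\<in>UNIV. c k * enn2real (\<tau> k x))"
          using elim True ennreal_leI order_trans by blast
        also have "\<dots> = (\<Sum>k\<in>UNIV. ennreal (c k) * ennreal (enn2real (\<tau> k x)))"
          using c by (simp add: ennreal_mult flip: sum_ennreal)
        also have "\<dots> \<le> (\<Sum>k\<in>UNIV. ennreal (c k) * \<tau> k x)"
          by (intro sum_mono mult_left_mono) (auto simp: ennreal_enn2real_if)
        finally show ?thesis using True by simp
      qed simp
    qed
  qed
  also have "\<dots> = (\<Sum>k\<in>UNIV. ennreal (c k) * (\<integral>\<^sup>+ x\<in>E. \<tau> k x \<partial>lebesgue))"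
    using \<tau> E by (simp add: nn_integral_sum nn_integral_cmult)
  also have "\<dots> = (\<Sum>k\<in>UNIV. ennreal (D * \<theta> k))"
  proof (rule sum.cong)
    fix k
    show "ennreal (c k) * (\<integral>\<^sup>+ x\<in>E. \<tau> k x \<partial>lebesgue) = ennreal (D * \<theta> k)"
      unfolding set_nn_integral_eq_mass[OF fin] using c[of k] pos[of k] by (simp add: c_def flip: ennreal_mult)
  qed simp
  also have "\<dots> = ennreal (\<Sum>k\<in>UNIV. D * \<theta> k)"
    using \<open>0 \<le> D\<close> \<theta> by (intro sum_ennreal) (simp add: less_imp_le)
  also have "(\<Sum>k\<in>UNIV. D * \<theta> k) = D" using \<theta>(2) by (simp flip: sum_distrib_left)
  finally show ?thesis by (simp add: D_def)
qed

lemma mass_pos: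
  assumes "\<tau> \<in> borel_measurable lebesgue" "R \<in> rectangles" "(\<integral>\<^sup>+ x\<in>R. \<tau> x \<partial>lebesgue) < \<infinity>"
    and "AE x in lebesgue. x \<in> R \<longrightarrow> 0 < \<tau> x"
  shows "0 < mass \<tau> R"
proof (rule ccontr)
  assume "\<not> 0 < mass \<tau> R"
  then have "mass \<tau> R = 0" using mass_nonneg[of \<tau> R] by linarith
  then have "(\<integral>\<^sup>+ x\<in>R. \<tau> x \<partial>lebesgue) = 0" using set_nn_integral_eq_mass[OF assms(3)] by simp
  then have "AE x in lebesgue. \<tau> x * indicator R x = 0"
    using assms(1,2) by (subst (asm) nn_integral_0_iff_AE) auto
  then have "AE x in lebesgue. x \<notin> R" using assms(4) by eventually_elim auto
  then have "R \<in> null_sets lebesgue"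
    using assms(2) by (simp add: AE_iff_null_sets)
  then have "negligible R" by (simp add: negligible_iff_null_sets)
  moreover have "open R" "R \<noteq> {}" using assms(2) by (auto simp: rectangles_def interval_eq_empty_cart not_le[symmetric])
  ultimately show False using open_not_negligible by blast
qed

lemma measure_rectangle_pos:
  assumes "R \<in> rectangles"
  shows "0 < measure lebesgue R"
proof -
  obtain a b where ab: "R = box a b" "\<And>i. a $ i < b $ i" using assms by (auto simp: rectangles_def)
  then have "measure lebesgue R = (\<Prod>i\<in>UNIV. b $ i - a $ i)"
    unfolding ab(1) by (intro measure_rectangle) (simp add: less_imp_le)
  then show ?thesis using ab(2) by (simp add: prod_pos)
qed

lemma emeasure_rectangle:
  assumes "R \<in> rectangles"
  shows "emeasure lebesgue R = ennreal (measure lebesgue R)"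
proof -
  have "R \<in> lmeasurable" using assms by (auto simp: rectangles_def)
  from fmeasurableD2[OF this] show ?thesis by (rule emeasure_eq_ennreal_measure)
qed

text \<open>Hoelder's inequality on \<open>E\<close> and the hypothesis on \<open>R\<close> compare \<open>\<bar>E\<bar>\<close> and \<open>\<bar>R\<bar>\<close> with the same product.\<close>
lemma rect_doubling_of_product:
  fixes \<tau> :: "'k::finite \<Rightarrow> real ^ 'n \<Rightarrow> ennreal"
  assumes \<tau>: "\<And>k. rect_finite (\<tau> k)" and \<tau>pos: "\<And>k R. R \<in> rectangles \<Longrightarrow> 0 < mass (\<tau> k) R"
    and \<theta>: "\<And>k. 0 < \<theta> k" "sum \<theta> UNIV = 1" and "0 < K"
    and one: "\<And>R. R \<in> rectangles \<Longrightarrow> AE x in lebesgue. x \<in> R \<longrightarrow> (\<Prod>k\<in>UNIV. enn2real (\<tau> k x) powr \<theta> k) = 1"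
    and K: "\<And>R. R \<in> rectangles \<Longrightarrow> (\<Prod>k\<in>UNIV. mass (\<tau> k) R powr \<theta> k) \<le> K * measure lebesgue R"
  shows "\<exists>C\<ge>1. \<forall>k. rect_doubling C (\<tau> k)"
proof -
  \<comment> \<open>Solving for the mass of \<open>R\<close> under the exponent
    \<open>\<theta> k\<close> yields \<open>(2 * K) powr (1 / \<theta> k)\<close>; the maximum makes
    one constant serve the whole family.\<close>
  define C where "C = Max (insert 1 (range (\<lambda>k. (2 * K) powr (1 / \<theta> k))))"
  have C: "1 \<le> C" "(2 * K) powr (1 / \<theta> k) \<le> C" for k
    unfolding C_def by (rule Max_ge; simp)+
  have "mass (\<tau> k) R \<le> C * mass (\<tau> k) E"
    if R: "R \<in> rectangles" and E: "E \<in> sets lebesgue" "E \<subseteq> R" and RE: "measure lebesgue R \<le> 2 * measure lebesgue E" for k R E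
  proof -
    have finR: "(\<integral>\<^sup>+ x\<in>R. \<tau> k x \<partial>lebesgue) < \<infinity>" for k using \<tau> R by (simp add: rect_finite_def)
    then have finE: "(\<integral>\<^sup>+ x\<in>E. \<tau> k x \<partial>lebesgue) < \<infinity>" for k
      using nn_set_integral_set_mono[OF E(2)] le_less_trans by blast
    have "(\<integral>\<^sup>+ x\<in>E. 1 \<partial>lebesgue) \<le> ennreal (\<Prod>k\<in>UNIV. mass (\<tau> k) E powr \<theta> k)"
    proof (rule set_nn_integral_hoelder[OF _ E(1) finE \<theta>])
      show "AE x in lebesgue. x \<in> E \<longrightarrow> 1 \<le> ennreal (\<Prod>k\<in>UNIV. enn2real (\<tau> k x) powr \<theta> k)"
        using one[OF R] by eventually_elim (use E in auto)
    qed (use \<tau> in \<open>simp add: rect_finite_def\<close>)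
    then have "mass (\<lambda>_. 1) E \<le> (\<Prod>k\<in>UNIV. mass (\<tau> k) E powr \<theta> k)"
      unfolding mass_def[of "\<lambda>_. 1"] by (intro enn2real_leI) (auto intro: prod_nonneg)
    then have "measure lebesgue E \<le> (\<Prod>k\<in>UNIV. mass (\<tau> k) E powr \<theta> k)"
      using E(1) by (simp add: mass_one)
    also have "\<dots> = mass (\<tau> k) E powr \<theta> k * (\<Prod>j\<in>UNIV - {k}. mass (\<tau> j) E powr \<theta> j)"
      by (subst prod.remove[of _ k]) auto
    also have "\<dots> \<le> mass (\<tau> k) E powr \<theta> k * (\<Prod>j\<in>UNIV - {k}. mass (\<tau> j) R powr \<theta> j)"
      using mass_mono[OF E(2) finR] \<theta> by (intro mult_left_mono prod_mono conjI powr_mono2) (auto simp: less_imp_le)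
    \<comment> \<open>Multiplication by the missing factor on \<open>R\<close> completes the product
      over all indices, to which the hypothesis with \<open>K\<close> applies.\<close>
    finally have "mass (\<tau> k) R powr \<theta> k * measure lebesgue E
        \<le> mass (\<tau> k) R powr \<theta> k * (mass (\<tau> k) E powr \<theta> k * (\<Prod>j\<in>UNIV - {k}. mass (\<tau> j) R powr \<theta> j))"
      by (rule mult_left_mono) simp
    also have "\<dots> = mass (\<tau> k) E powr \<theta> k * (\<Prod>j\<in>UNIV. mass (\<tau> j) R powr \<theta> j)"
      by (subst (2) prod.remove[of _ k]) (auto simp: mult_ac)
    also have "\<dots> \<le> mass (\<tau> k) E powr \<theta> k * (K * measure lebesgue R)"
      using K[OF R] by (intro mult_left_mono) auto
    also have "\<dots> \<le> mass (\<tau> k) E powr \<theta> k * (K * (2 * measure lebesgue E))"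
      using RE \<open>0 < K\<close> by (intro mult_left_mono) auto
    finally have "mass (\<tau> k) R powr \<theta> k * measure lebesgue E \<le> (2 * K * mass (\<tau> k) E powr \<theta> k) * measure lebesgue E"
      by (simp add: mult_ac)
    then have "mass (\<tau> k) R powr \<theta> k \<le> 2 * K * mass (\<tau> k) E powr \<theta> k"
      using RE measure_rectangle_pos[OF R] by (simp add: mult_le_cancel_right)
    then have "(mass (\<tau> k) R powr \<theta> k) powr (1 / \<theta> k) \<le> (2 * K * mass (\<tau> k) E powr \<theta> k) powr (1 / \<theta> k)"
      using \<theta>(1)[of k] by (intro powr_mono2) auto
    then have "mass (\<tau> k) R \<le> (2 * K) powr (1 / \<theta> k) * mass (\<tau> k) E"
      using \<theta>(1)[of k] \<open>0 < K\<close> by (simp add: powr_powr powr_mult)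
    also have "\<dots> \<le> C * mass (\<tau> k) E" using C(2) by (intro mult_right_mono) auto
    finally show ?thesis .
  qed
  then show ?thesis
    using C(1) \<tau> \<tau>pos unfolding rect_doubling_def by (intro exI[of _ C]) blast
qed

subsection \<open>The multiple weight condition\<close>

lemma rect_average_rectangle:
  "R \<in> rectangles \<Longrightarrow> rect_average R g = (\<integral>\<^sup>+ x\<in>R. g x \<partial>lebesgue) / ennreal (measure lebesgue R)"
  unfolding rect_average_def by (subst emeasure_rectangle) auto

lemma rect_average_eq:
  assumes "R \<in> rectangles" "(\<integral>\<^sup>+ x\<in>R. \<tau> x \<partial>lebesgue) < \<infinity>"
  shows "rect_average R \<tau> = ennreal (mass \<tau> R / measure lebesgue R)"
  unfolding rect_average_rectangle[OF assms(1)] set_nn_integral_eq_mass[OF assms(2)]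
  using measure_rectangle_pos[OF assms(1)] by (simp add: divide_ennreal)

lemma rectangle_hull:
  assumes "R \<in> rectangles" "R' \<in> rectangles"
  obtains S where "S \<in> rectangles" "R \<subseteq> S" "R' \<subseteq> S"
proof -
  obtain a b c d where R: "R = box a b" "R' = box c d" "\<And>i. a $ i < b $ i" "\<And>i. c $ i < d $ i"
    using assms unfolding rectangles_def by blast
  let ?S = "box (\<chi> i. min (a $ i) (c $ i)) (\<chi> i. max (b $ i) (d $ i))"
  show ?thesis
    by (rule that[of ?S]) (use R in \<open>auto simp: mem_box_cart min_less_iff_disj less_max_iff_disj\<close>)
qed

lemma AE_zero_of_rectangles:
  assumes "\<tau> \<in> borel_measurable lebesgue" "\<And>R. R \<in> rectangles \<Longrightarrow> (\<integral>\<^sup>+ x\<in>R. \<tau> x \<partial>lebesgue) = 0"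
  shows "AE x in lebesgue. \<tau> (x :: real ^ 'n) = 0"
proof -
  define R where "R k = (box (\<chi> i. - real k - 1) (\<chi> i. real k + 1) :: (real ^ 'n) set)" for k
  have R: "R k \<in> rectangles" for k by (simp add: R_def)
  have "AE x in lebesgue. \<forall>k. \<tau> x * indicator (R k) x = 0"
    unfolding AE_all_countable
  proof
    fix k
    show "AE x in lebesgue. \<tau> x * indicator (R k) x = 0"
      using assms(2)[OF R[of k]] assms(1) R[of k] by (subst (asm) nn_integral_0_iff_AE) auto
  qed
  then show ?thesis
  proof eventually_elim
    case (elim x)
    obtain k :: nat where "norm x \<le> real k" using real_arch_simple by blast
    then have "\<bar>x $ i\<bar> \<le> real k" for i using component_le_norm_cart[of x i] by linarith
    then have "- real k - 1 < x $ i \<and> x $ i < real k + 1" for i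
      using abs_le_iff[of "x $ i" "real k"] by (smt (verit))
    then have "x \<in> R k" by (simp add: R_def mem_box_cart)
    then show ?case using elim[rule_format, of k] by simp
  qed
qed

locale weight_tuple =
  fixes P :: "'m::finite \<Rightarrow> real" and p :: real and w :: "'m \<Rightarrow> real ^ 'n \<Rightarrow> real"
  assumes P: "\<And>j. 1 < P j" and p_eq: "1 / p = (\<Sum>j\<in>UNIV. 1 / P j)" and w: "\<And>j. weight (w j)"
begin

abbreviation \<nu> :: "real ^ 'n \<Rightarrow> ennreal" where
  "\<nu> x \<equiv> ennreal (joint_weight P p w x)"

abbreviation \<sigma> :: "'m \<Rightarrow> real ^ 'n \<Rightarrow> ennreal" where
  "\<sigma> j x \<equiv> ennreal (w j x) powr\<^sub>e (1 - conj_exponent (P j))"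

abbreviation e :: "'m \<Rightarrow> real" where
  "e j \<equiv> p / conj_exponent (P j)"

lemma p_pos: "0 < p"
proof -
  have "0 < (\<Sum>j\<in>UNIV. 1 / P j)" using P by (intro sum_pos) (auto intro: less_trans[OF zero_less_one])
  then show ?thesis using p_eq by (metis zero_less_divide_1_iff)
qed

lemma P_pos: "0 < P j"
  using P[of j] by simp

lemma sum_theta: "(\<Sum>j\<in>UNIV. p / P j) = 1"
proof -
  have "(\<Sum>j\<in>UNIV. p / P j) = p * (\<Sum>j\<in>UNIV. 1 / P j)" by (simp add: sum_distrib_left)
  then show ?thesis using p_pos by (simp flip: p_eq)
qed

lemma sigma_exponent: "1 - conj_exponent (P j) = - 1 / (P j - 1)"
  using P[of j] by (simp add: conj_exponent_def field_simps)

lemma sigma_exponent_neg: "1 - conj_exponent (P j) < 0"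
  using P[of j] by (simp add: sigma_exponent)

lemma e_eq: "e j = p - p / P j"
  using P[of j] by (simp add: conj_exponent_def field_simps)

lemma e_pos: "0 < e j"
  using P[of j] p_pos by (simp add: conj_exponent_def)

text \<open>Adding the exponent 1 of \<open>\<nu>\<close> gives \<open>p * real CARD('m)\<close>,
  the total power of the volume in the multiple weight condition.\<close>

lemma sum_e: "(\<Sum>j\<in>UNIV. e j) = p * real CARD('m) - 1"
  by (simp add: e_eq sum_subtractf sum_theta)

lemma w_nonneg: "0 \<le> w j x"
  using w[of j] by (simp add: weight_def)

lemma w_measurable [measurable]: "w j \<in> borel_measurable lebesgue"
  using w[of j] by (simp add: weight_def)

lemma \<nu>_measurable [measurable]: "\<nu> \<in> borel_measurable lebesgue"
  unfolding joint_weight_def by measurable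

lemma \<sigma>_measurable [measurable]: "\<sigma> j \<in> borel_measurable lebesgue"
  by measurable

lemma joint_weight_nonneg: "0 \<le> joint_weight P p w x"
  by (simp add: joint_weight_def prod_nonneg)

lemma \<sigma>_pos: "0 < \<sigma> j x"
  using sigma_exponent_neg[of j] w_nonneg[of j x] by (auto simp: enn_powr_def)

lemma \<sigma>_eq: "0 < w j x \<Longrightarrow> \<sigma> j x = ennreal (w j x powr (- 1 / (P j - 1)))"
  by (simp only: enn_powr_ennreal sigma_exponent)

lemma \<sigma>_eq_top_iff: "\<sigma> j x = top \<longleftrightarrow> w j x = 0"
  using sigma_exponent_neg[of j] w_nonneg[of j x] by (auto simp: enn_powr_def)

lemma rect_average_\<sigma>_pos:
  assumes "R \<in> rectangles"
  shows "0 < rect_average R (\<sigma> j)"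
proof -
  have "(\<integral>\<^sup>+ x\<in>R. \<sigma> j x \<partial>lebesgue) \<noteq> 0"
  proof (cases "(\<integral>\<^sup>+ x\<in>R. \<sigma> j x \<partial>lebesgue) < \<infinity>")
    case True
    then have "0 < mass (\<sigma> j) R" using \<sigma>_pos by (intro mass_pos assms) auto
    then show ?thesis unfolding set_nn_integral_eq_mass[OF True] by simp
  qed auto
  then show ?thesis
    by (simp add: rect_average_rectangle[OF assms] measure_rectangle_pos[OF assms] zero_less_iff_neq_zero)
qed

lemma A_class_term_finite:
  assumes "A_class P p w" "R \<in> rectangles"
  shows "rect_average R \<nu> * (\<Prod>j\<in>UNIV. rect_average R (\<sigma> j) powr\<^sub>e e j) < \<infinity>"
  using assms unfolding A_class_def by (meson SUP_upper le_less_trans)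

text \<open>No average of \<open>\<sigma> j\<close> over a rectangle is zero, since
  \<open>\<sigma> j\<close> is positive everywhere; a finite product therefore forces a finite
  average of \<open>\<nu>\<close>.\<close>

lemma A_class_rect_finite_\<nu>:
  assumes A: "A_class P p w"
  shows "rect_finite \<nu>"
  unfolding rect_finite_def
proof (intro conjI ballI)
  fix R :: "(real ^ 'n) set" assume R: "R \<in> rectangles"
  have "rect_average R (\<sigma> j) powr\<^sub>e e j \<noteq> 0" for j
    using enn_powr_pos[OF rect_average_\<sigma>_pos[OF R] e_pos] by (metis less_irrefl)
  then have "rect_average R \<nu> < \<infinity>"
    using A_class_term_finite[OF A R] by (auto simp: ennreal_mult_less_top)
  then show "(\<integral>\<^sup>+ x\<in>R. \<nu> x \<partial>lebesgue) < \<infinity>"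
    by (auto simp: rect_average_rectangle[OF R] measure_rectangle_pos[OF R] less_top[symmetric] ennreal_divide_eq_top_iff)
qed simp

text \<open>
  \<open>\<sigma>\<^sub>j\<close> may be infinite where \<open>w\<^sub>j\<close> vanishes. Since \<open>0 * \<infinity> = 0\<close>, the condition \<open>A\<^sub>P\<close> forbids infinite
  averages of \<open>\<sigma>\<^sub>j\<close> only on rectangles that \<open>\<nu>\<close> charges, so the rectangle is enlarged first.
\<close>
lemma A_class_rect_finite_\<sigma>:
  assumes A: "A_class P p w" and nz: "\<not> (AE x in lebesgue. \<nu> x = 0)"
  shows "rect_finite (\<sigma> j)"
  unfolding rect_finite_def
proof (intro conjI ballI)
  fix R :: "(real ^ 'n) set" assume R: "R \<in> rectangles"
  obtain R0 :: "(real ^ 'n) set" where R0: "R0 \<in> rectangles" "(\<integral>\<^sup>+ x\<in>R0. \<nu> x \<partial>lebesgue) \<noteq> 0"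
    using AE_zero_of_rectangles[of \<nu>] nz by auto
  obtain S where S: "S \<in> rectangles" "R \<subseteq> S" "R0 \<subseteq> S" using rectangle_hull[OF R R0(1)] .
  have "rect_average S \<nu> \<noteq> 0"
    using nn_set_integral_set_mono[OF S(3), of lebesgue \<nu>] R0(2)
    by (auto simp: rect_average_rectangle[OF S(1)] measure_rectangle_pos[OF S(1)])
  moreover have nz: "rect_average S (\<sigma> i) powr\<^sub>e e i \<noteq> 0" for i
    using enn_powr_pos[OF rect_average_\<sigma>_pos[OF S(1)] e_pos] by (metis less_irrefl)
  ultimately have "(\<Prod>j\<in>UNIV. rect_average S (\<sigma> j) powr\<^sub>e e j) < \<infinity>"
    using A_class_term_finite[OF A S(1)] by (auto simp: ennreal_mult_less_top)
  then have "rect_average S (\<sigma> j) powr\<^sub>e e j \<noteq> top"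
    using nz by (auto simp: less_top[symmetric] ennreal_prod_eq_top)
  then have "rect_average S (\<sigma> j) \<noteq> top" using e_pos[of j] by auto
  then have "(\<integral>\<^sup>+ x\<in>S. \<sigma> j x \<partial>lebesgue) < \<infinity>"
    by (auto simp: rect_average_rectangle[OF S(1)] measure_rectangle_pos[OF S(1)] less_top[symmetric] ennreal_divide_eq_top_iff)
  then show "(\<integral>\<^sup>+ x\<in>R. \<sigma> j x \<partial>lebesgue) < \<infinity>"
    by (rule le_less_trans[OF nn_set_integral_set_mono[OF S(2)]])
qed simp

text \<open>With all masses finite, the denominators of the averages combine to the power
  \<open>p * real CARD('m)\<close> of the volume. Adding 1 to the supremum makes the constant
  positive.\<close>

lemma A_class_real_bound:
  assumes A: "A_class P p w" and fin: "\<And>j. rect_finite (\<sigma> j)"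
  obtains A where "0 < A" "\<forall>R\<in>rectangles.
    mass \<nu> R * (\<Prod>j\<in>UNIV. mass (\<sigma> j) R powr e j) \<le> A * measure lebesgue R powr (p * real CARD('m))"
proof -
  let ?t = "\<lambda>R. rect_average R \<nu> * (\<Prod>j\<in>UNIV. rect_average R (\<sigma> j) powr\<^sub>e e j)"
  define S where "S = (SUP R\<in>rectangles. ?t R)"
  have S: "S < \<infinity>" using A by (simp add: S_def A_class_def)
  show ?thesis
  proof (rule that[of "enn2real S + 1"], goal_cases)
    case 1
    show ?case by (simp add: add_nonneg_pos)
  next
    case 2
    show ?case
    proof
      fix R :: "(real ^ 'n) set" assume R: "R \<in> rectangles"
      let ?v = "measure lebesgue R"
      note v = measure_rectangle_pos[OF R]
      have \<nu>R: "(\<integral>\<^sup>+ x\<in>R. \<nu> x \<partial>lebesgue) < \<infinity>" and \<sigma>R: "(\<integral>\<^sup>+ x\<in>R. \<sigma> j x \<partial>lebesgue) < \<infinity>" for j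
        using A_class_rect_finite_\<nu>[OF A] fin R by (auto simp: rect_finite_def)
      have "?t R = ennreal (mass \<nu> R / ?v * (\<Prod>j\<in>UNIV. (mass (\<sigma> j) R / ?v) powr e j))"
        using v e_pos
        by (simp add: rect_average_eq[OF R \<nu>R] rect_average_eq[OF R \<sigma>R] enn_powr_ennreal_nonneg
            prod_ennreal prod_nonneg flip: ennreal_mult)
      also have "(\<Prod>j\<in>UNIV. (mass (\<sigma> j) R / ?v) powr e j) = (\<Prod>j\<in>UNIV. mass (\<sigma> j) R powr e j) / ?v powr (p * real CARD('m) - 1)"
        using v by (simp add: powr_divide prod_dividef powr_sum flip: sum_e)
      also have "mass \<nu> R / ?v * \<dots> = mass \<nu> R * (\<Prod>j\<in>UNIV. mass (\<sigma> j) R powr e j) / ?v powr (p * real CARD('m))"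
        using v by (simp add: powr_diff)
      finally have "?t R = ennreal (mass \<nu> R * (\<Prod>j\<in>UNIV. mass (\<sigma> j) R powr e j) / ?v powr (p * real CARD('m)))" .
      moreover have "?t R \<le> S" unfolding S_def using R by (intro SUP_upper)
      ultimately have "enn2real (ennreal (mass \<nu> R * (\<Prod>j\<in>UNIV. mass (\<sigma> j) R powr e j) / ?v powr (p * real CARD('m)))) \<le> enn2real S"
        using S by (intro enn2real_mono) auto
      then have "mass \<nu> R * (\<Prod>j\<in>UNIV. mass (\<sigma> j) R powr e j) / ?v powr (p * real CARD('m)) \<le> enn2real S"
        by (simp add: prod_nonneg)
      then show "mass \<nu> R * (\<Prod>j\<in>UNIV. mass (\<sigma> j) R powr e j) \<le> (enn2real S + 1) * ?v powr (p * real CARD('m))"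
        using v by (simp add: divide_le_eq algebra_simps add_increasing)
    qed
  qed
qed

end

lemma prod_option: "(\<Prod>k\<in>UNIV. f k) = f None * (\<Prod>j\<in>UNIV. f (Some (j :: 'a::finite)))"
  by (simp add: UNIV_option_conv prod.reindex)

lemma sum_option: "(\<Sum>k\<in>UNIV. f k) = f None + (\<Sum>j\<in>UNIV. f (Some (j :: 'a::finite)))"
  by (simp add: UNIV_option_conv sum.reindex)

text \<open>Lindelof's theorem leaves countably many open sets, and continuity from below of the
  measure with density \<open>\<tau>\<close> reduces these to finite subfamilies. This is why
  estimates for finite families of rectangles suffice.\<close>

lemma set_nn_integral_Union_le:
  fixes \<tau> :: "real ^ 'n \<Rightarrow> ennreal"
  assumes \<tau>: "\<tau> \<in> borel_measurable lebesgue" and "\<And>R. R \<in> \<G> \<Longrightarrow> open R"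
    and le: "\<And>\<F>. finite \<F> \<Longrightarrow> \<F> \<subseteq> \<G> \<Longrightarrow> (\<integral>\<^sup>+ x\<in>\<Union>\<F>. \<tau> x \<partial>lebesgue) \<le> c"
  shows "(\<integral>\<^sup>+ x\<in>\<Union>\<G>. \<tau> x \<partial>lebesgue) \<le> c"
proof -
  obtain \<G>' where \<G>': "\<G>' \<subseteq> \<G>" "countable \<G>'" "\<Union>\<G>' = \<Union>\<G>"
    using Lindelof[of \<G>] assms(2) by metis
  show ?thesis
  proof (cases "\<G>' = {}")
    case True
    then have "\<Union>\<G> = \<Union>{}" using \<G>'(3) by simp
    then show ?thesis using le[of "{}"] by (simp only: finite.emptyI empty_subsetI)
  next
    case False
    define U where "U n = \<Union>(from_nat_into \<G>' ` {..n})" for n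
    have in\<G>: "from_nat_into \<G>' ` {..n} \<subseteq> \<G>" for n
      using from_nat_into[OF False] \<G>'(1) by auto
    have "open (U n)" for n unfolding U_def using in\<G> assms(2) by blast
    then have U: "U n \<in> sets lebesgue" for n by auto
    have "(\<Union>n. U n) = \<Union>(range (from_nat_into \<G>'))" by (auto simp: U_def)
    also have "\<dots> = \<Union>\<G>" using range_from_nat_into[OF False \<G>'(2)] \<G>'(3) by simp
    finally have UU: "(\<Union>n. U n) = \<Union>\<G>" .
    have "incseq U" unfolding U_def incseq_def by (intro allI impI Union_mono image_mono) auto
    then have "(SUP n. emeasure (density lebesgue \<tau>) (U n)) = emeasure (density lebesgue \<tau>) (\<Union>n. U n)"
      using U by (intro SUP_emeasure_incseq) auto
    moreover have "emeasure (density lebesgue \<tau>) (U n) \<le> c" for n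
      using le[OF _ in\<G>[of n]] \<tau> U by (simp add: emeasure_density U_def)
    ultimately have "emeasure (density lebesgue \<tau>) (\<Union>n. U n) \<le> c"
      by (metis SUP_least)
    moreover have "(\<Union>n. U n) \<in> sets lebesgue" using U by auto
    ultimately show ?thesis using \<tau> unfolding UU by (simp add: emeasure_density)
  qed
qed

section \<open>Doubling and Hoelder's inequality for the weights\<close>

context weight_tuple
begin

lemma AE_w_pos:
  assumes "rect_finite (\<sigma> j)" "R \<in> rectangles"
  shows "AE x in lebesgue. x \<in> R \<longrightarrow> 0 < w j x"
proof -
  have "(\<integral>\<^sup>+ x\<in>R. \<sigma> j x \<partial>lebesgue) \<noteq> \<infinity>" using assms by (auto simp: rect_finite_def)
  then have "AE x in lebesgue. \<sigma> j x * indicator R x \<noteq> \<infinity>"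
    using assms(2) by (intro nn_integral_noteq_infinite) auto
  then show ?thesis
  proof eventually_elim
    case (elim x)
    then show ?case using \<sigma>_eq_top_iff[of j x] w_nonneg[of j x] by (auto simp: less_le)
  qed
qed

lemma AE_all_w_pos:
  assumes "\<And>j. rect_finite (\<sigma> j)" "R \<in> rectangles"
  shows "AE x in lebesgue. x \<in> R \<longrightarrow> (\<forall>j. 0 < w j x)"
proof -
  have "AE x in lebesgue. \<forall>j\<in>UNIV. x \<in> R \<longrightarrow> 0 < w j x"
    by (intro AE_finite_allI AE_w_pos assms) auto
  then show ?thesis by eventually_elim auto
qed

text \<open>In each factor the exponents cancel, because \<open>e j / (P j - 1) = p / P j\<close>.
  Raised to the power \<open>1 / (p * real CARD('m))\<close>, this is the factorisation of 1 to
  which Hoelder's inequality is applied.\<close>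

lemma joint_weight_sigma:
  assumes "\<And>j. 0 < w j x"
  shows "joint_weight P p w x * (\<Prod>j\<in>UNIV. enn2real (\<sigma> j x) powr e j) = 1"
proof -
  have "w j x powr (p / P j) * enn2real (\<sigma> j x) powr e j = 1" for j
  proof -
    have "- 1 / (P j - 1) * e j = - (p / P j)"
      using P[of j] by (simp add: e_eq field_simps)
    moreover have "enn2real (\<sigma> j x) = w j x powr (- 1 / (P j - 1))"
      by (simp only: \<sigma>_eq[OF assms] enn2real_ennreal powr_ge_zero)
    ultimately have "enn2real (\<sigma> j x) powr e j = w j x powr (- (p / P j))"
      by (simp only: powr_powr)
    then show ?thesis
      using assms[of j] by (simp flip: powr_add)
  qed
  then show ?thesis by (simp add: joint_weight_def flip: prod.distrib)
qed

lemma A_class_doubling: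
  assumes A: "A_class P p w" and fin: "\<And>j. rect_finite (\<sigma> j)"
  obtains C where "1 \<le> C" "rect_doubling C \<nu>" "\<forall>j. rect_doubling C (\<sigma> j)"
proof -
  \<comment> \<open>The type \<open>'m option\<close> joins \<open>\<nu>\<close> and all
    \<open>\<sigma> j\<close> into one finite family; dividing the exponents 1 and
    \<open>e j\<close> by \<open>q\<close> makes them add up to 1.\<close>
  define \<tau> where "\<tau> k = (case k of None \<Rightarrow> \<nu> | Some j \<Rightarrow> \<sigma> j)" for k
  define q where "q = p * real CARD('m)"
  define \<theta> where "\<theta> k = (case k of None \<Rightarrow> 1 / q | Some j \<Rightarrow> e j / q)" for k
  have q: "0 < q" using p_pos by (simp add: q_def)
  have fin\<nu>: "rect_finite \<nu>" using A by (rule A_class_rect_finite_\<nu>)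
  obtain A where A: "0 < A" "\<forall>R\<in>rectangles.
    mass \<nu> R * (\<Prod>j\<in>UNIV. mass (\<sigma> j) R powr e j) \<le> A * measure lebesgue R powr q"
    unfolding q_def by (rule A_class_real_bound[OF A fin])
  have factor: "(\<Prod>k\<in>UNIV. g k powr \<theta> k) = (g None * (\<Prod>j\<in>UNIV. g (Some j) powr e j)) powr (1 / q)"
    if "\<And>k. 0 \<le> g k" for g :: "'m option \<Rightarrow> real"
  proof -
    have "(\<Prod>j\<in>UNIV. g (Some j) powr (e j / q)) = (\<Prod>j\<in>UNIV. g (Some j) powr e j) powr (1 / q)"
      by (subst prod_powr_distrib) (auto simp: powr_powr)
    then show ?thesis
      using that by (simp add: prod_option \<theta>_def powr_mult prod_nonneg)
  qed
  have "\<exists>C\<ge>1. \<forall>k. rect_doubling C (\<tau> k)"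
  proof (rule rect_doubling_of_product[where \<theta> = \<theta> and K = "A powr (1 / q)"])
    show "rect_finite (\<tau> k)" for k
      using fin fin\<nu> by (auto simp: \<tau>_def split: option.split)
    show "0 < \<theta> k" for k
      using q divide_pos_pos[OF e_pos q] by (cases k) (simp_all add: \<theta>_def)
    show "sum \<theta> UNIV = 1"
    proof -
      have "sum \<theta> UNIV = (1 + (\<Sum>j\<in>UNIV. e j)) / q"
        by (simp add: sum_option \<theta>_def add_divide_distrib sum_divide_distrib)
      then show ?thesis using p_pos unfolding sum_e by (simp add: q_def)
    qed
    show "0 < A powr (1 / q)" using A by simp
    fix R :: "(real ^ 'n) set" assume R: "R \<in> rectangles"
    show "0 < mass (\<tau> k) R" for k
    proof (cases k)
      case None
      have "AE x in lebesgue. x \<in> R \<longrightarrow> 0 < \<nu> x"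
        using AE_all_w_pos[OF fin R]
      proof eventually_elim
        case (elim x)
        have "0 < (\<Prod>j\<in>UNIV. w j x powr (p / P j))" if "x \<in> R"
          using elim that by (intro prod_pos ballI) (metis less_irrefl powr_gt_zero)
        then show ?case by (simp add: joint_weight_def)
      qed
      then show ?thesis
        using None fin\<nu> R by (auto simp: \<tau>_def rect_finite_def intro!: mass_pos)
    next
      case (Some j)
      then show ?thesis
        using fin[of j] R \<sigma>_pos by (auto simp: \<tau>_def rect_finite_def intro!: mass_pos)
    qed
    show "AE x in lebesgue. x \<in> R \<longrightarrow> (\<Prod>k\<in>UNIV. enn2real (\<tau> k x) powr \<theta> k) = 1"
      using AE_all_w_pos[OF fin R]
    proof eventually_elim
      case (elim x)
      then show ?case
        using joint_weight_sigma[of x]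
        by (simp only: factor enn2real_nonneg) (simp add: \<tau>_def joint_weight_nonneg)
    qed
    have "(\<Prod>k\<in>UNIV. mass (\<tau> k) R powr \<theta> k) = (mass \<nu> R * (\<Prod>j\<in>UNIV. mass (\<sigma> j) R powr e j)) powr (1 / q)"
      by (simp add: factor) (simp add: \<tau>_def)
    also have "\<dots> \<le> (A * measure lebesgue R powr q) powr (1 / q)"
      using bspec[OF A(2) R] q by (intro powr_mono2) (auto simp: prod_nonneg)
    also have "\<dots> = A powr (1 / q) * measure lebesgue R"
      using A(1) q by (simp add: powr_mult powr_powr)
    finally show "(\<Prod>k\<in>UNIV. mass (\<tau> k) R powr \<theta> k) \<le> A powr (1 / q) * measure lebesgue R" .
  qed
  then obtain C where C: "1 \<le> C" "\<And>k. rect_doubling C (\<tau> k)" by blast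
  have "\<tau> None = \<nu>" "\<tau> (Some j) = \<sigma> j" for j by (simp_all add: \<tau>_def)
  then show ?thesis
    using that[OF C(1)] C(2)[of None] C(2)[of "Some _"] by simp
qed

text \<open>Where \<open>w i\<close> is positive, \<open>\<bar>f x\<bar>\<close> is the
  \<open>1 / P i\<close> power of the weighted integrand times the \<open>1 - 1 / P i\<close> power
  of \<open>\<sigma> i x\<close>. This covers almost all of \<open>R\<close>, because
  \<open>\<sigma> i\<close> is infinite at the zeros of \<open>w i\<close> but integrable on
  \<open>R\<close>.\<close>

lemma mass_hoelder:
  assumes fin: "rect_finite (\<sigma> i)" and R: "R \<in> rectangles"
    and f: "f \<in> borel_measurable lebesgue" and W: "weighted_integral (P i) (w i) f < \<infinity>"
  shows "mass (\<lambda>x. ennreal \<bar>f x\<bar>) R powr P i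
    \<le> mass (\<sigma> i) R powr (P i - 1) * mass (\<lambda>x. ennreal (\<bar>f x\<bar> powr P i * w i x)) R"
proof -
  let ?G = "\<lambda>x. ennreal (\<bar>f x\<bar> powr P i * w i x)"
  note [measurable] = f
  \<comment> \<open>\<open>bool\<close> serves as the index type of the two factors.\<close>
  define \<tau> where "\<tau> b = (if b then ?G else \<sigma> i)" for b
  define \<theta> where "\<theta> b = (if b then 1 / P i else 1 - 1 / P i)" for b
  have "(\<integral>\<^sup>+ x\<in>R. ?G x \<partial>lebesgue) \<le> weighted_integral (P i) (w i) f"
    unfolding weighted_integral_def by (intro nn_integral_mono) (auto simp: indicator_def)
  then have GR: "(\<integral>\<^sup>+ x\<in>R. ?G x \<partial>lebesgue) < \<infinity>" using W by (rule le_less_trans)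
  have "(\<integral>\<^sup>+ x\<in>R. ennreal \<bar>f x\<bar> \<partial>lebesgue) \<le> ennreal (\<Prod>b\<in>UNIV. mass (\<tau> b) R powr \<theta> b)"
  proof (rule set_nn_integral_hoelder)
    show "\<tau> b \<in> borel_measurable lebesgue" for b unfolding \<tau>_def by (cases b) auto
    show "(\<integral>\<^sup>+ x\<in>R. \<tau> b x \<partial>lebesgue) < \<infinity>" for b
      using GR fin R by (auto simp: \<tau>_def rect_finite_def)
    show "0 < \<theta> b" for b using P[of i] by (auto simp: \<theta>_def)
    show "AE x in lebesgue. x \<in> R \<longrightarrow> ennreal \<bar>f x\<bar> \<le> ennreal (\<Prod>b\<in>UNIV. enn2real (\<tau> b x) powr \<theta> b)"
      using AE_w_pos[OF fin R]
    proof eventually_elim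
      case (elim x)
      have "\<bar>f x\<bar> = (\<Prod>b\<in>UNIV. enn2real (\<tau> b x) powr \<theta> b)" if "0 < w i x"
      proof -
        have "- 1 / (P i - 1) * (1 - 1 / P i) = - (1 / P i)"
          using P[of i] by (simp add: field_simps)
        then show ?thesis
          using that P_pos[of i] by (simp add: \<tau>_def \<theta>_def UNIV_bool \<sigma>_eq powr_mult powr_powr flip: powr_add)
      qed
      then show ?case using elim by auto
    qed
  qed (use R in \<open>auto simp: \<theta>_def UNIV_bool\<close>)
  then have "mass (\<lambda>x. ennreal \<bar>f x\<bar>) R \<le> mass ?G R powr (1 / P i) * mass (\<sigma> i) R powr (1 - 1 / P i)"
    unfolding mass_def[of "\<lambda>x. ennreal \<bar>f x\<bar>"]
    by (intro enn2real_leI) (auto simp: \<tau>_def \<theta>_def UNIV_bool mult_ac)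
  then have "mass (\<lambda>x. ennreal \<bar>f x\<bar>) R powr P i
      \<le> (mass ?G R powr (1 / P i) * mass (\<sigma> i) R powr (1 - 1 / P i)) powr P i"
    using P_pos[of i] by (intro powr_mono2) auto
  also have "\<dots> = mass (\<sigma> i) R powr (P i - 1) * mass ?G R"
  proof -
    have "(1 - 1 / P i) * P i = P i - 1" "1 / P i * P i = 1"
      using P_pos[of i] by (simp_all add: field_simps)
    then show ?thesis by (simp only: powr_mult powr_powr mass_nonneg powr_ge_zero powr_one mult.commute)
  qed
  finally show ?thesis .
qed

text \<open>The lower bound on the averages turns the volume power in the weight condition into
  \<open>t powr (- p)\<close> times the product of the \<open>mass (F i) R powr p\<close>. Since
  \<open>e i = p - p / P i\<close>, dividing each factor by
  \<open>mass (\<sigma> i) R powr e i\<close> regroups it into the form that the weak type estimate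
  for products expects.\<close>

lemma mass_\<nu>_le_of_average_gt:
  assumes A: "mass \<nu> R * (\<Prod>j\<in>UNIV. mass (\<sigma> j) R powr e j) \<le> A * measure lebesgue R powr (p * real CARD('m))" "0 \<le> A"
    and R: "R \<in> rectangles" and "0 < t" and \<sigma>R: "\<And>j. 0 < mass (\<sigma> j) R"
    and t: "t < (\<Prod>i\<in>UNIV. mass (F i) R / measure lebesgue R)"
  shows "mass \<nu> R \<le> (A * t powr (- p)) * (\<Prod>i\<in>UNIV. (mass (\<sigma> i) R * (mass (F i) R / mass (\<sigma> i) R) powr P i) powr (p / P i))"
proof -
  let ?v = "measure lebesgue R"
  note v = measure_rectangle_pos[OF R]
  let ?S = "\<Prod>j\<in>UNIV. mass (\<sigma> j) R powr e j"
  have S: "0 < ?S" by (intro prod_pos ballI) (metis \<sigma>R less_irrefl powr_gt_zero)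
  have "(\<Prod>i\<in>UNIV. mass (F i) R / ?v) = (\<Prod>i\<in>UNIV. mass (F i) R) / ?v powr real CARD('m)"
    using v by (simp add: prod_dividef powr_realpow)
  then have "t * ?v powr real CARD('m) \<le> (\<Prod>i\<in>UNIV. mass (F i) R)"
    using t v by (metis less_imp_le pos_less_divide_eq powr_gt_zero less_irrefl)
  then have "(t * ?v powr real CARD('m)) powr p \<le> (\<Prod>i\<in>UNIV. mass (F i) R) powr p"
    using p_pos \<open>0 < t\<close> by (intro powr_mono2) auto
  then have "t powr p * ?v powr (p * real CARD('m)) \<le> (\<Prod>i\<in>UNIV. mass (F i) R powr p)"
    using \<open>0 < t\<close> by (simp add: powr_mult powr_powr prod_powr_distrib mult.commute)
  then have "?v powr (p * real CARD('m)) \<le> t powr (- p) * (\<Prod>i\<in>UNIV. mass (F i) R powr p)"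
    using \<open>0 < t\<close> by (simp add: powr_minus field_simps)
  then have "mass \<nu> R * ?S \<le> A * (t powr (- p) * (\<Prod>i\<in>UNIV. mass (F i) R powr p))"
    using A by (meson mult_left_mono order_trans)
  then have "mass \<nu> R \<le> A * t powr (- p) * ((\<Prod>i\<in>UNIV. mass (F i) R powr p) / ?S)"
    using S by (simp add: field_simps)
  also have "(\<Prod>i\<in>UNIV. mass (F i) R powr p) / ?S
      = (\<Prod>i\<in>UNIV. (mass (\<sigma> i) R * (mass (F i) R / mass (\<sigma> i) R) powr P i) powr (p / P i))"
    unfolding prod_dividef[symmetric]
  proof (rule prod.cong)
    fix i
    show "mass (F i) R powr p / mass (\<sigma> i) R powr e i
        = (mass (\<sigma> i) R * (mass (F i) R / mass (\<sigma> i) R) powr P i) powr (p / P i)"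
      using \<sigma>R[of i] P_pos[of i]
      by (simp add: powr_mult powr_divide powr_powr e_eq powr_diff)
  qed simp
  finally show ?thesis .
qed

end

section \<open>The weight condition implies the weak type estimate\<close>

context weight_tuple
begin

lemma weak_bounded_of_A_class:
  assumes A: "A_class P p w"
  shows "strong_maximal_weak_bounded P p w"
proof (cases "AE x in lebesgue. \<nu> x = 0")
  \<comment> \<open>If \<open>\<nu>\<close> vanishes almost everywhere, every weak quasinorm is
    zero. The case is separate because then the weight condition says nothing about the
    \<open>\<sigma> j\<close>, which may fail to be integrable on rectangles.\<close>
  case True
  have "weak_quasinorm p (joint_weight P p w) g = 0" for g
  proof -
    have "(\<integral>\<^sup>+ x\<in>E. \<nu> x \<partial>lebesgue) = (\<integral>\<^sup>+ x. 0 \<partial>lebesgue :: (real ^ 'n) measure)" for E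
      using True by (intro nn_integral_cong_AE) (auto elim: eventually_mono)
    then show ?thesis using p_pos unfolding weak_quasinorm_def by (simp add: SUP_constant)
  qed
  then show ?thesis
    unfolding strong_maximal_weak_bounded_def by (intro exI[of _ 0]) simp
next
  case False
  note fin\<sigma> = A_class_rect_finite_\<sigma>[OF A False]
  obtain C where C: "1 \<le> C" "rect_doubling C \<nu>" "\<forall>j. rect_doubling C (\<sigma> j)"
    by (rule A_class_doubling[OF A fin\<sigma>])
  obtain A where A: "0 < A" "\<forall>R\<in>rectangles.
      mass \<nu> R * (\<Prod>j\<in>UNIV. mass (\<sigma> j) R powr e j) \<le> A * measure lebesgue R powr (p * real CARD('m))"
    by (rule A_class_real_bound[OF A fin\<sigma>])
  have \<theta>: "0 < p / P j" for j using p_pos P_pos by simp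
  show ?thesis
  proof (rule rectangles_weak_type_product[where 'n = 'n, of P C "\<lambda>j. p / P j", OF P C(1) \<theta> sum_theta])
    fix B :: real
    assume B: "0 < B" "\<And>(\<nu> :: real ^ 'n \<Rightarrow> ennreal) \<sigma> F G A \<F>. rect_doubling C \<nu> \<Longrightarrow> (\<And>i. rect_doubling C (\<sigma> i)) \<Longrightarrow>
      (\<And>i. rect_finite (F i)) \<Longrightarrow> (\<And>i. G i \<in> borel_measurable lebesgue) \<Longrightarrow> (\<And>i. (\<integral>\<^sup>+ x. G i x \<partial>lebesgue) < \<infinity>) \<Longrightarrow>
      (\<And>i R. R \<in> rectangles \<Longrightarrow> mass (F i) R powr P i \<le> mass (\<sigma> i) R powr (P i - 1) * mass (G i) R) \<Longrightarrow>
      0 \<le> A \<Longrightarrow> finite \<F> \<Longrightarrow> \<F> \<subseteq> rectangles \<Longrightarrow>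
      (\<And>R. R \<in> \<F> \<Longrightarrow> mass \<nu> R \<le> A * (\<Prod>i\<in>UNIV. (mass (\<sigma> i) R * (mass (F i) R / mass (\<sigma> i) R) powr P i) powr (p / P i))) \<Longrightarrow>
      (\<integral>\<^sup>+ x\<in>\<Union>\<F>. \<nu> x \<partial>lebesgue) \<le> ennreal (B * A * (\<Prod>i\<in>UNIV. mass (G i) UNIV powr (p / P i)))"
    \<comment> \<open>The level estimate carries the factor \<open>t powr (- p)\<close>; under the
      exponent \<open>1 / p\<close> it cancels \<open>t\<close>, leaving this constant uniform in
      \<open>t\<close>.\<close>
    define c where "c = (B * A) powr (1 / p)"
    show ?thesis
      unfolding strong_maximal_weak_bounded_def
    proof (intro exI[of _ c] conjI allI impI)
      show "0 \<le> c" by (simp add: c_def)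
      fix f :: "'m \<Rightarrow> real ^ 'n \<Rightarrow> real"
      assume f: "\<forall>i. locally_integrable (f i) \<and> weighted_integral (P i) (w i) (f i) < \<infinity>"
      define F where "F i = (\<lambda>x. ennreal \<bar>f i x\<bar>)" for i
      define G where "G i = (\<lambda>x. ennreal (\<bar>f i x\<bar> powr P i * w i x))" for i
      have fm [measurable]: "f i \<in> borel_measurable lebesgue" for i
        using f by (simp add: locally_integrable_def)
      have Gm: "G i \<in> borel_measurable lebesgue" for i unfolding G_def by measurable
      have Gfin: "(\<integral>\<^sup>+ x. G i x \<partial>lebesgue) < \<infinity>" for i
        using f by (simp add: weighted_integral_def G_def)
      have Ffin: "rect_finite (F i)" for i
        unfolding rect_finite_def
      proof (intro conjI ballI)
        show "F i \<in> borel_measurable lebesgue" unfolding F_def by measurable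
        fix R :: "(real ^ 'n) set" assume "R \<in> rectangles"
        then obtain a b where R: "R = box a b" by (auto simp: rectangles_def)
        have "integrable lebesgue (\<lambda>x. indicator (cbox a b) x *\<^sub>R f i x)"
          using f compact_cbox[of a b] unfolding locally_integrable_def set_integrable_def by blast
        then have "(\<integral>\<^sup>+ x. ennreal (norm (indicator (cbox a b) x *\<^sub>R f i x)) \<partial>lebesgue) < \<infinity>"
          by (simp add: integrable_iff_bounded)
        moreover have "(\<integral>\<^sup>+ x\<in>R. F i x \<partial>lebesgue) \<le> (\<integral>\<^sup>+ x. ennreal (norm (indicator (cbox a b) x *\<^sub>R f i x)) \<partial>lebesgue)"
          using box_subset_cbox[of a b] unfolding R F_def
          by (intro nn_integral_mono) (auto simp: indicator_def)
        ultimately show "(\<integral>\<^sup>+ x\<in>R. F i x \<partial>lebesgue) < \<infinity>" by (rule le_less_trans[rotated])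
      qed
      let ?\<Pi> = "\<Prod>i\<in>UNIV. mass (G i) UNIV powr (p / P i)"
      have level: "(\<integral>\<^sup>+ x\<in>{x. strong_maximal f x > ennreal t}. \<nu> x \<partial>lebesgue) \<le> ennreal (B * (A * t powr (- p)) * ?\<Pi>)"
        if "0 < t" for t
      proof -
        \<comment> \<open>The supremum exceeds \<open>t\<close> exactly when the product for one
          rectangle does, so the level set is the union of this family of open rectangles, which is
          in general uncountable.\<close>
        define \<G> where "\<G> = {R \<in> rectangles. ennreal t < (\<Prod>i\<in>UNIV. rect_average R (F i))}"
        have "{x. strong_maximal f x > ennreal t} = \<Union>\<G>"
          unfolding strong_maximal_def \<G>_def F_def less_SUP_iff by auto
        moreover have "(\<integral>\<^sup>+ x\<in>\<Union>\<G>. \<nu> x \<partial>lebesgue) \<le> ennreal (B * (A * t powr (- p)) * ?\<Pi>)"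
        proof (rule set_nn_integral_Union_le)
          fix \<F> assume \<F>: "finite \<F>" "\<F> \<subseteq> \<G>"
          show "(\<integral>\<^sup>+ x\<in>\<Union>\<F>. \<nu> x \<partial>lebesgue) \<le> ennreal (B * (A * t powr (- p)) * ?\<Pi>)"
          proof (rule B(2)[of \<nu> \<sigma> F G "A * t powr (- p)" \<F>, OF C(2) spec[OF C(3)] Ffin Gm Gfin _ _ \<F>(1)])
            show "mass (F i) R powr P i \<le> mass (\<sigma> i) R powr (P i - 1) * mass (G i) R" if "R \<in> rectangles" for i R
              unfolding F_def G_def using f by (intro mass_hoelder fin\<sigma> that) auto
            show "0 \<le> A * t powr (- p)" using A(1) by simp
            show "\<F> \<subseteq> rectangles" using \<F>(2) by (auto simp: \<G>_def)
            fix R assume "R \<in> \<F>"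
            then have R: "R \<in> rectangles" "ennreal t < (\<Prod>i\<in>UNIV. rect_average R (F i))"
              using \<F>(2) by (auto simp: \<G>_def)
            have "(\<Prod>i\<in>UNIV. rect_average R (F i)) = ennreal (\<Prod>i\<in>UNIV. mass (F i) R / measure lebesgue R)"
              using Ffin R(1) by (simp add: rect_average_eq rect_finite_def prod_ennreal)
            then have "t < (\<Prod>i\<in>UNIV. mass (F i) R / measure lebesgue R)"
              using R(2) that by (simp add: ennreal_less_iff)
            then show "mass \<nu> R \<le> A * t powr (- p) *
                (\<Prod>i\<in>UNIV. (mass (\<sigma> i) R * (mass (F i) R / mass (\<sigma> i) R) powr P i) powr (p / P i))"
              using A C(3) R(1) that
              by (intro mass_\<nu>_le_of_average_gt) (auto simp: rect_doubling_def)
          qed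
        qed (auto simp: \<G>_def open_rectangle)
        ultimately show ?thesis by simp
      qed
      have rhs: "(\<Prod>i\<in>UNIV. weighted_integral (P i) (w i) (f i) powr\<^sub>e (1 / P i))
          = ennreal (\<Prod>i\<in>UNIV. mass (G i) UNIV powr (1 / P i))"
      proof -
        have "weighted_integral (P i) (w i) (f i) = ennreal (mass (G i) UNIV)" for i
          using set_nn_integral_eq_mass[of "G i" UNIV] Gfin[of i] by (simp add: weighted_integral_def G_def)
        then show ?thesis using P_pos by (simp add: enn_powr_ennreal_nonneg prod_ennreal)
      qed
      have "ennreal t * (\<integral>\<^sup>+ x\<in>{x. strong_maximal f x > ennreal t}. \<nu> x \<partial>lebesgue) powr\<^sub>e (1 / p)
          \<le> ennreal c * ennreal (\<Prod>i\<in>UNIV. mass (G i) UNIV powr (1 / P i))" if "0 < t" for t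
      proof -
        have "ennreal t * (\<integral>\<^sup>+ x\<in>{x. strong_maximal f x > ennreal t}. \<nu> x \<partial>lebesgue) powr\<^sub>e (1 / p)
            \<le> ennreal t * ennreal (B * (A * t powr (- p)) * ?\<Pi>) powr\<^sub>e (1 / p)"
          using level[OF that] p_pos by (intro mult_left_mono enn_powr_mono) auto
        also have "\<dots> = ennreal (t * (B * (A * t powr (- p)) * ?\<Pi>) powr (1 / p))"
          using that A(1) B(1) p_pos by (subst enn_powr_ennreal_nonneg) (auto simp: prod_nonneg ennreal_mult)
        also have "t * (B * (A * t powr (- p)) * ?\<Pi>) powr (1 / p) = c * ?\<Pi> powr (1 / p)"
        proof -
          have "(B * (A * t powr (- p)) * ?\<Pi>) powr (1 / p) = c * (t powr (- p)) powr (1 / p) * ?\<Pi> powr (1 / p)"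
            using that A(1) B(1) unfolding c_def by (simp add: powr_mult prod_nonneg mult_ac)
          also have "(t powr (- p)) powr (1 / p) = 1 / t"
            using that p_pos by (simp only: powr_powr) (simp add: powr_minus_divide)
          finally show ?thesis using that by simp
        qed
        also have "?\<Pi> powr (1 / p) = (\<Prod>i\<in>UNIV. mass (G i) UNIV powr (1 / P i))"
          using p_pos by (subst prod_powr_distrib) (auto simp: powr_powr)
        finally show ?thesis by (simp add: ennreal_mult c_def prod_nonneg)
      qed
      then show "weak_quasinorm p (joint_weight P p w) (strong_maximal f)
          \<le> ennreal c * (\<Prod>i\<in>UNIV. weighted_integral (P i) (w i) (f i) powr\<^sub>e (1 / P i))"
        unfolding weak_quasinorm_def rhs by (intro SUP_least) auto
    qed
  qed
qed

section \<open>The weak type estimate implies the weight condition\<close>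

lemma shifted_weight_tendsto:
  "(\<lambda>N. ennreal ((w j x + 1 / real (Suc N)) powr (- 1 / (P j - 1)))) \<longlonglongrightarrow> \<sigma> j x"
proof (cases "w j x = 0")
  case True
  have "filterlim (\<lambda>N. real (Suc N) powr (1 / (P j - 1))) at_top sequentially"
    using P[of j] by real_asymp
  moreover have "(1 / real (Suc N)) powr (- 1 / (P j - 1)) = real (Suc N) powr (1 / (P j - 1))" for N
    by (simp add: powr_divide powr_minus_divide)
  ultimately have "filterlim (\<lambda>N. (w j x + 1 / real (Suc N)) powr (- 1 / (P j - 1))) at_top sequentially"
    using True by simp
  moreover have "\<sigma> j x = top" using True \<sigma>_eq_top_iff by blast
  ultimately show ?thesis by (simp only: ennreal_tendsto_top_eq_at_top)
next
  case False
  then have pos: "0 < w j x" using w_nonneg[of j x] by simp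
  have "(\<lambda>N. w j x + 1 / real (Suc N)) \<longlonglongrightarrow> w j x + 0"
    by (intro tendsto_add tendsto_const LIMSEQ_Suc[OF lim_1_over_n])
  then have "(\<lambda>N. (w j x + 1 / real (Suc N)) powr (- 1 / (P j - 1))) \<longlonglongrightarrow> w j x powr (- 1 / (P j - 1))"
    using pos by (intro tendsto_powr) auto
  then show ?thesis unfolding \<sigma>_eq[OF pos] by (rule tendsto_ennrealI)
qed

lemma A_class_of_weak_bounded:
  assumes "strong_maximal_weak_bounded P p w"
  shows "A_class P p w"
proof -
  obtain C where C: "0 \<le> C" and bound: "\<And>f. (\<forall>i. locally_integrable (f i) \<and> weighted_integral (P i) (w i) (f i) < \<infinity>) \<Longrightarrow>
      weak_quasinorm p (joint_weight P p w) (strong_maximal f)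
          \<le> ennreal C * (\<Prod>i\<in>UNIV. weighted_integral (P i) (w i) (f i) powr\<^sub>e (1 / P i))"
    using assms unfolding strong_maximal_weak_bounded_def by blast
  \<comment> \<open>The 2 comes from testing at half the product of averages, the exponent from
    raising the weak type inequality to the power \<open>p\<close>.\<close>
  define K where "K = (2 * C) powr p"
  have "rect_average R \<nu> * (\<Prod>j\<in>UNIV. rect_average R (\<sigma> j) powr\<^sub>e e j) \<le> ennreal K"
    if R: "R \<in> rectangles" for R
  proof -
    let ?v = "measure lebesgue R"
    note v = measure_rectangle_pos[OF R]
    have Rs [measurable]: "R \<in> sets lebesgue" using R by simp
    \<comment> \<open>The shift bounds \<open>g N i\<close> from above even where \<open>w i\<close>
      vanishes, so the test functions are integrable although \<open>\<sigma> i\<close> need not be.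
      As \<open>N\<close> grows, \<open>g N i\<close> increases to
      \<open>\<sigma> i\<close>.\<close>
    define g where "g N i x = (w i x + 1 / real (Suc N)) powr (- 1 / (P i - 1))" for N i x
    define f where "f N i x = indicator R x * g N i x" for N i x
    define s where "s N i = mass (\<lambda>x. ennreal (g N i x)) R" for N i
    have gm [measurable]: "g N i \<in> borel_measurable lebesgue" for N i
      unfolding g_def by measurable
    have fm [measurable]: "f N i \<in> borel_measurable lebesgue" for N i
      unfolding f_def by measurable
    have wN: "0 < w i x + 1 / real (Suc N)" for i x N
      using w_nonneg[of i x] by (simp add: add_nonneg_pos)
    have g_pos: "0 < g N i x" for N i x
      unfolding g_def using wN[of i x N] by (metis powr_gt_zero less_irrefl)
    have g_le: "g N i x \<le> (1 / real (Suc N)) powr (- 1 / (P i - 1))" for N i x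
      unfolding g_def using P[of i] w_nonneg[of i x] by (intro powr_mono2') auto
    have g_fin: "(\<integral>\<^sup>+ x\<in>R. ennreal (g N i x) \<partial>lebesgue) < \<infinity>" for N i
    proof -
      let ?c = "(1 / real (Suc N)) powr (- 1 / (P i - 1))"
      have "(\<integral>\<^sup>+ x\<in>R. ennreal (g N i x) \<partial>lebesgue) \<le> (\<integral>\<^sup>+ x. ennreal ?c * indicator R x \<partial>lebesgue)"
        using g_le by (intro nn_integral_mono mult_right_mono ennreal_leI) auto
      also have "\<dots> = ennreal ?c * ennreal ?v"
        by (subst nn_integral_cmult_indicator[OF Rs]) (simp only: emeasure_rectangle[OF R])
      finally show ?thesis by (rule le_less_trans) (simp add: ennreal_mult_less_top)
    qed
    have s_pos: "0 < s N i" for N i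
      unfolding s_def using g_fin g_pos by (intro mass_pos R) auto
    have f_local: "locally_integrable (f N i)" for N i
      unfolding locally_integrable_def set_integrable_def
    proof (intro conjI allI impI)
      fix L :: "(real ^ 'n) set" assume "compact L"
      have "(\<integral>\<^sup>+ x. ennreal (norm (f N i x)) \<partial>lebesgue) = (\<integral>\<^sup>+ x\<in>R. ennreal (g N i x) \<partial>lebesgue)"
        using g_pos by (intro nn_integral_cong) (auto simp: f_def indicator_def less_imp_le)
      then have "integrable lebesgue (f N i)"
        using g_fin by (simp add: integrable_iff_bounded)
      then show "integrable lebesgue (\<lambda>x. indicator L x *\<^sub>R f N i x)"
        using \<open>compact L\<close> by (intro integrable_mult_indicator) (auto simp: borel_compact)
    qed simp
    \<comment> \<open>The exponent makes \<open>g N i x powr (P i - 1)\<close> the reciprocal of the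
      shifted weight, which absorbs the factor \<open>w i x\<close>.\<close>
    have W: "weighted_integral (P i) (w i) (f N i) \<le> ennreal (s N i)" for N i
    proof -
      have "g N i x powr P i * w i x \<le> g N i x" for x
      proof -
        have "- 1 / (P i - 1) * (P i - 1) = - 1" using P[of i] by (simp add: field_simps)
        then have "g N i x powr (P i - 1) = (w i x + 1 / real (Suc N)) powr (- 1)"
          unfolding g_def by (simp only: powr_powr)
        also have "\<dots> = 1 / (w i x + 1 / real (Suc N))"
          using wN[of i x N] by (simp only: powr_minus_divide powr_one less_imp_le)
        finally have "g N i x powr (P i - 1) * w i x \<le> 1"
          using wN[of i x N] w_nonneg[of i x] by (simp add: divide_le_eq)
        then have "g N i x * (g N i x powr (P i - 1) * w i x) \<le> g N i x * 1"
          using g_pos[of N i x] by (intro mult_left_mono) auto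
        moreover have "g N i x * g N i x powr (P i - 1) = g N i x powr P i"
          using g_pos[of N i x] by (simp add: powr_mult_base)
        ultimately show ?thesis by (simp only: mult.assoc[symmetric] mult_1_right)
      qed
      then have "weighted_integral (P i) (w i) (f N i) \<le> (\<integral>\<^sup>+ x\<in>R. ennreal (g N i x) \<partial>lebesgue)"
        unfolding weighted_integral_def f_def using g_pos
        by (intro nn_integral_mono) (auto simp: indicator_def less_imp_le intro!: ennreal_leI)
      then show ?thesis using set_nn_integral_eq_mass[OF g_fin] by (simp add: s_def)
    qed
    have avg: "rect_average R (\<lambda>x. ennreal (g N i x)) = ennreal (s N i / ?v)" for N i
      unfolding s_def by (rule rect_average_eq[OF R g_fin])
    have maximal: "ennreal (\<Prod>i\<in>UNIV. s N i / ?v) \<le> strong_maximal (f N) x" if "x \<in> R" for N x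
    proof -
      have "rect_average R (\<lambda>y. ennreal \<bar>f N i y\<bar>) = rect_average R (\<lambda>x. ennreal (g N i x))" for i
        unfolding rect_average_def f_def using g_pos
        by (intro arg_cong2[where f = "(/)"] nn_integral_cong) (auto simp: indicator_def less_imp_le)
      then have "(\<Prod>i\<in>UNIV. rect_average R (\<lambda>y. ennreal \<bar>f N i y\<bar>)) = ennreal (\<Prod>i\<in>UNIV. s N i / ?v)"
        using s_pos v by (simp add: avg prod_ennreal less_imp_le)
      then show ?thesis
        unfolding strong_maximal_def using R that by (metis (mono_tags, lifting) SUP_upper mem_Collect_eq)
    qed
    have Tpos: "0 < (\<Prod>i\<in>UNIV. s N i / ?v)" for N using s_pos v by (intro prod_pos) auto
    have weak: "ennreal ((\<Prod>i\<in>UNIV. s N i / ?v) / 2) * (\<integral>\<^sup>+ x\<in>R. \<nu> x \<partial>lebesgue) powr\<^sub>e (1 / p)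
        \<le> ennreal (C * (\<Prod>i\<in>UNIV. s N i powr (1 / P i)))" for N
    proof -
      \<comment> \<open>Half of the product of averages, since the level set is defined by a strict
        inequality and the maximal function on \<open>R\<close> is only known to be at least that
        product.\<close>
      let ?t = "(\<Prod>i\<in>UNIV. s N i / ?v) / 2"
      have "R \<subseteq> {x. strong_maximal (f N) x > ennreal ?t}"
      proof
        fix x assume "x \<in> R"
        have "ennreal ?t < ennreal (\<Prod>i\<in>UNIV. s N i / ?v)" using Tpos[of N] by (intro ennreal_lessI) auto
        also have "\<dots> \<le> strong_maximal (f N) x" by (rule maximal[OF \<open>x \<in> R\<close>])
        finally show "x \<in> {x. strong_maximal (f N) x > ennreal ?t}" by simp
      qed
      then have "ennreal ?t * (\<integral>\<^sup>+ x\<in>R. \<nu> x \<partial>lebesgue) powr\<^sub>e (1 / p)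
          \<le> ennreal ?t * (\<integral>\<^sup>+ x\<in>{x. strong_maximal (f N) x > ennreal ?t}. \<nu> x \<partial>lebesgue) powr\<^sub>e (1 / p)"
        using p_pos by (intro mult_left_mono enn_powr_mono nn_set_integral_set_mono) auto
      also have "\<dots> \<le> weak_quasinorm p (joint_weight P p w) (strong_maximal (f N))"
        unfolding weak_quasinorm_def using Tpos[of N] by (intro SUP_upper) auto
      also have "\<dots> \<le> ennreal C * (\<Prod>i\<in>UNIV. weighted_integral (P i) (w i) (f N i) powr\<^sub>e (1 / P i))"
        using f_local le_less_trans[OF W ennreal_less_top] by (intro bound) auto
      also have "\<dots> \<le> ennreal C * (\<Prod>i\<in>UNIV. ennreal (s N i) powr\<^sub>e (1 / P i))"
        using W P_pos by (intro mult_left_mono prod_mono_ennreal enn_powr_mono) auto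
      also have "\<dots> = ennreal (C * (\<Prod>i\<in>UNIV. s N i powr (1 / P i)))"
        using C P_pos s_pos by (simp add: enn_powr_ennreal prod_ennreal ennreal_mult prod_nonneg)
      finally show ?thesis .
    qed
    \<comment> \<open>The test functions for \<open>N = 0\<close> already exclude an infinite
      integral, which would make the left side of \<open>weak\<close> infinite. Finiteness must come
      first, because \<open>mass\<close> would turn infinity into 0.\<close>
    have \<nu>R: "(\<integral>\<^sup>+ x\<in>R. \<nu> x \<partial>lebesgue) < \<infinity>"
    proof (rule ccontr)
      assume "\<not> ?thesis"
      then have "(\<integral>\<^sup>+ x\<in>R. \<nu> x \<partial>lebesgue) = top" by (simp add: less_top[symmetric])
      then have "ennreal ((\<Prod>i\<in>UNIV. s 0 i / ?v) / 2) * top \<le> ennreal (C * (\<Prod>i\<in>UNIV. s 0 i powr (1 / P i)))"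
        using weak[of 0] p_pos by simp
      moreover have "ennreal ((\<Prod>i\<in>UNIV. s 0 i / ?v) / 2) * top = top"
        using Tpos[of 0] by (subst ennreal_mult_eq_top_iff) (simp add: ennreal_eq_0_iff)
      ultimately show False by (simp add: top_unique)
    qed
    define \<xi> where "\<xi> = mass \<nu> R"
    have "0 \<le> \<xi>" by (simp add: \<xi>_def)
    \<comment> \<open>After raising \<open>weak\<close> to the power \<open>p\<close>, each
      \<open>s N i\<close> has exponent \<open>p\<close> on the left and \<open>p / P i\<close> on
      the right, so the quotient leaves exactly \<open>e i\<close>. As the \<open>p / P i\<close>
      add up to 1, the volume contributes one factor \<open>?v\<close>.\<close>
    have real_bound: "\<xi> / ?v * (\<Prod>i\<in>UNIV. (s N i / ?v) powr e i) \<le> K" for N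
    proof -
      let ?T = "\<Prod>i\<in>UNIV. s N i / ?v"
      let ?S = "\<Prod>i\<in>UNIV. s N i powr (p / P i)"
      have "?S > 0" using s_pos by (intro prod_pos ballI) (metis powr_gt_zero less_irrefl)
      have "ennreal (?T / 2 * \<xi> powr (1 / p)) \<le> ennreal (C * (\<Prod>i\<in>UNIV. s N i powr (1 / P i)))"
        using weak[of N] p_pos Tpos[of N] unfolding set_nn_integral_eq_mass[OF \<nu>R] \<xi>_def[symmetric]
        by (simp add: enn_powr_ennreal_nonneg \<open>0 \<le> \<xi>\<close> flip: ennreal_mult)
      then have "?T / 2 * \<xi> powr (1 / p) \<le> C * (\<Prod>i\<in>UNIV. s N i powr (1 / P i))"
        using C by (subst (asm) ennreal_le_iff) (auto intro!: mult_nonneg_nonneg prod_nonneg)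
      then have "?T * \<xi> powr (1 / p) \<le> 2 * C * (\<Prod>i\<in>UNIV. s N i powr (1 / P i))" by simp
      then have "(?T * \<xi> powr (1 / p)) powr p \<le> (2 * C * (\<Prod>i\<in>UNIV. s N i powr (1 / P i))) powr p"
        using p_pos Tpos[of N] by (intro powr_mono2) auto
      also have "\<dots> = K * ?S"
        using C s_pos by (simp add: K_def powr_mult prod_nonneg prod_powr_distrib powr_powr)
      finally have 1: "?T powr p * \<xi> \<le> K * ?S"
        using Tpos[of N] \<open>0 \<le> \<xi>\<close> p_pos by (simp add: powr_mult powr_powr less_imp_le)
      have "(\<Prod>i\<in>UNIV. (s N i / ?v) powr e i) = (\<Prod>i\<in>UNIV. (s N i / ?v) powr p) / (\<Prod>i\<in>UNIV. (s N i / ?v) powr (p / P i))"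
        by (simp add: e_eq powr_diff prod_dividef)
      also have "(\<Prod>i\<in>UNIV. (s N i / ?v) powr p) = ?T powr p"
        using s_pos v by (subst prod_powr_distrib) (auto simp: less_imp_le)
      also have "(\<Prod>i\<in>UNIV. (s N i / ?v) powr (p / P i)) = ?S / (\<Prod>i\<in>UNIV. ?v powr (p / P i))"
        using s_pos v by (simp add: powr_divide prod_dividef less_imp_le)
      also have "(\<Prod>i\<in>UNIV. ?v powr (p / P i)) = ?v"
        using v by (subst powr_sum[symmetric]) (auto simp: sum_theta)
      finally have "\<xi> / ?v * (\<Prod>i\<in>UNIV. (s N i / ?v) powr e i) = ?T powr p * \<xi> / ?S"
        using v by simp
      then show ?thesis using 1 \<open>?S > 0\<close> by (simp add: divide_le_eq)
    qed
    have lim: "(\<lambda>N. ennreal (s N i / ?v)) \<longlonglongrightarrow> rect_average R (\<sigma> i)" for i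
    proof -
      have "(\<lambda>N. \<integral>\<^sup>+ x\<in>R. ennreal (g N i x) \<partial>lebesgue) \<longlonglongrightarrow> (\<integral>\<^sup>+ x\<in>R. \<sigma> i x \<partial>lebesgue)"
      proof (rule nn_integral_LIMSEQ)
        show "incseq (\<lambda>N x. ennreal (g N i x) * indicator R x)"
        proof (intro incseq_SucI le_funI mult_right_mono ennreal_leI)
          show "g N i x \<le> g (Suc N) i x" for N x
            unfolding g_def using P[of i] wN[of i x "Suc N"]
            by (intro powr_mono2') (auto simp: field_simps)
        qed simp
        show "(\<lambda>N. ennreal (g N i x) * indicator R x) \<longlonglongrightarrow> \<sigma> i x * indicator R x" for x
          using shifted_weight_tendsto[of i x] by (cases "x \<in> R") (simp_all add: g_def)
      qed simp
      then have "(\<lambda>N. inverse (ennreal ?v) * (\<integral>\<^sup>+ x\<in>R. ennreal (g N i x) \<partial>lebesgue))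
          \<longlonglongrightarrow> inverse (ennreal ?v) * (\<integral>\<^sup>+ x\<in>R. \<sigma> i x \<partial>lebesgue)"
        using v by (intro ennreal_tendsto_cmult) (auto simp: less_top[symmetric])
      then show ?thesis
        unfolding avg[symmetric] rect_average_rectangle[OF R] divide_ennreal_def by (simp add: mult.commute)
    qed
    show ?thesis
    \<comment> \<open>With \<open>\<xi> = 0\<close> the term vanishes even if some average of
      \<open>\<sigma> j\<close> is infinite, as \<open>0 * \<infinity> = 0\<close>. Only in the
      other case can the averages be shown finite.\<close>
    proof (cases "\<xi> = 0")
      case True
      then have "rect_average R \<nu> = 0" using rect_average_eq[OF R \<nu>R] by (simp add: \<xi>_def)
      then show ?thesis by simp
    next
      case False
      then have "0 < \<xi>" using \<open>0 \<le> \<xi>\<close> by simp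
      have s_mono: "s 0 i \<le> s N i" for N i
      proof -
        have "g 0 i x \<le> g N i x" for x
          unfolding g_def using P[of i] wN[of i x N]
          by (intro powr_mono2') (auto simp: field_simps)
        then have "(\<integral>\<^sup>+ x\<in>R. ennreal (g 0 i x) \<partial>lebesgue) \<le> (\<integral>\<^sup>+ x\<in>R. ennreal (g N i x) \<partial>lebesgue)"
          by (intro nn_integral_mono mult_right_mono ennreal_leI) auto
        then show ?thesis unfolding s_def mass_def using g_fin[of N i] by (intro enn2real_mono) auto
      qed
      \<comment> \<open>Finiteness has to precede the limit in \<open>real_bound\<close>. The
        factors with index other than \<open>i\<close> are at least their values at
        \<open>N = 0\<close>, by monotonicity in \<open>N\<close>, so the bound controls
        \<open>s N i\<close> uniformly in \<open>N\<close>.\<close>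
      have "rect_average R (\<sigma> i) < \<infinity>" for i
      proof -
        define c where "c = \<xi> / ?v * (\<Prod>j\<in>UNIV - {i}. (s 0 j / ?v) powr e j)"
        have "0 < (\<Prod>j\<in>UNIV - {i}. (s 0 j / ?v) powr e j)"
          using s_pos[of 0] v by (intro prod_pos ballI) (metis divide_pos_pos less_irrefl powr_gt_zero)
        then have "0 < c" using \<open>0 < \<xi>\<close> v by (simp add: c_def)
        have "s N i / ?v \<le> (K / c) powr (1 / e i)" for N
        proof -
          have "c * (s N i / ?v) powr e i \<le> \<xi> / ?v * (\<Prod>j\<in>UNIV - {i}. (s N j / ?v) powr e j) * (s N i / ?v) powr e i"
            unfolding c_def using s_mono s_pos[of 0] v \<open>0 < \<xi>\<close> less_imp_le[OF e_pos]
            by (intro mult_right_mono mult_left_mono prod_mono conjI powr_mono2 divide_right_mono) (auto simp: less_imp_le)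
          also have "\<dots> = \<xi> / ?v * (\<Prod>j\<in>UNIV. (s N j / ?v) powr e j)"
            by (subst prod.remove[of UNIV i]) (simp_all only: finite UNIV_I mult_ac)
          also have "\<dots> \<le> K" by (rule real_bound)
          finally have "(s N i / ?v) powr e i \<le> K / c"
            using \<open>0 < c\<close> by (simp only: pos_le_divide_eq mult.commute)
          moreover have "y powr a \<le> b \<Longrightarrow> 0 \<le> y \<Longrightarrow> y \<le> b powr (1 / a)" if "0 < a" for y a b :: real
            using powr_mono2[of "1 / a" "y powr a" b] that by (simp add: powr_powr)
          ultimately show ?thesis
            using e_pos[of i] s_pos[of N i] v by (metis divide_nonneg_pos less_imp_le)
        qed
        then have "rect_average R (\<sigma> i) \<le> ennreal ((K / c) powr (1 / e i))"
          by (intro LIMSEQ_le_const2[OF lim] exI allI impI ennreal_leI)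
        then show ?thesis by (rule le_less_trans) simp
      qed
      then have "\<exists>z. rect_average R (\<sigma> i) = ennreal z \<and> 0 \<le> z" for i
        by (metis ennreal_cases infinity_ennreal_def less_irrefl)
      then obtain z where z: "\<And>i. rect_average R (\<sigma> i) = ennreal (z i)" "\<And>i. 0 \<le> z i" by metis
      have zpos: "0 < z i" for i
        using rect_average_\<sigma>_pos[OF R, of i] z by simp
      have "(\<lambda>N. s N i / ?v) \<longlonglongrightarrow> z i" for i
        using lim[of i] unfolding z(1) using z(2) s_pos v by (subst (asm) tendsto_ennreal_iff) (auto simp: less_imp_le)
      then have "(\<lambda>N. \<xi> / ?v * (\<Prod>i\<in>UNIV. (s N i / ?v) powr e i)) \<longlonglongrightarrow> \<xi> / ?v * (\<Prod>i\<in>UNIV. z i powr e i)"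
        using zpos by (intro tendsto_intros tendsto_prod) (auto simp: less_imp_neq[symmetric])
      then have "\<xi> / ?v * (\<Prod>i\<in>UNIV. z i powr e i) \<le> K"
        using real_bound by (intro LIMSEQ_le_const2) auto
      moreover have "rect_average R \<nu> * (\<Prod>j\<in>UNIV. rect_average R (\<sigma> j) powr\<^sub>e e j)
          = ennreal (\<xi> / ?v * (\<Prod>i\<in>UNIV. z i powr e i))"
        using rect_average_eq[OF R \<nu>R] z zpos v \<open>0 \<le> \<xi>\<close>
        by (simp add: enn_powr_ennreal prod_ennreal prod_nonneg \<xi>_def flip: ennreal_mult)
      ultimately show ?thesis by (simp add: ennreal_leI)
    qed
  qed
  then have "(SUP R \<in> rectangles. rect_average R \<nu> * (\<Prod>j\<in>UNIV. rect_average R (\<sigma> j) powr\<^sub>e e j)) \<le> ennreal K"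
    by (rule SUP_least)
  then show ?thesis unfolding A_class_def by (rule le_less_trans) simp
qed

end

theorem corollary2p4:
  fixes P :: "'m::finite \<Rightarrow> real"
    and p :: real
    and w :: "'m \<Rightarrow> real ^ 'n \<Rightarrow> real"
  assumes "\<And>j. 1 < P j"
    and "1 / p = (\<Sum>j\<in>UNIV. 1 / P j)"
    and "\<And>j. weight (w j)"
  shows "strong_maximal_weak_bounded P p w \<longleftrightarrow> A_class P p w"
proof -
  interpret weight_tuple P p w
    by unfold_locales (use assms in auto)
  show ?thesis
    using weak_bounded_of_A_class A_class_of_weak_bounded by blast
qed

end
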